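(* Let $n\ge1$, $t>0$, $\lambda\in\mathbb{R}\setminus\{0\}$. Then $H_t^\lambda$ maps $L^2(\mathbb{R}^{2n})$ isometrically and surjectively onto the twisted Bergman space $\mathcal B_t^\lambda(\mathbb{C}^{2n})$. Moreover, the functions $\widetilde\Phi^\lambda_{\alpha,\beta}:=H_t^\lambda(\Phi^\lambda_{\alpha,\beta})$, $\alpha,\beta\in\mathbb{N}_0^n$, form an orthonormal basis of $\mathcal B_t^\lambda(\mathbb{C}^{2n})$.
   Context: For $\mathbf a,\mathbf b\in\mathbb{C}^n$ write $\mathbf a\cdot\mathbf b=\sum_j a_jb_j$ (complex bilinear). For $s>0$ let $p_s^\lambda(\mathbf z,\mathbf w)=(4\pi)^{-n}\left(\frac{\lambda}{\sinh(s\lambda)}\right)^n\exp\!\big(-\tfrac{\lambda}{4}\coth(s\lambda)(\mathbf z\cdot\mathbf z+\mathbf w\cdot\mathbf w)\big)$, $(\mathbf z,\mathbf w)\in\mathbb{C}^{2n}$. The $\lambda$-twisted heat kernel transform is $H_t^\lambda(f)(\mathbf z,\mathbf w)=\int_{\mathbb{R}^{2n}} f(\mathbf x',\mathbf u')p_t^\lambda(\mathbf z-\mathbf x',\mathbf w-\mathbf u')e^{-\frac{i\lambda}{2}(\mathbf x'\cdot\mathbf w-\mathbf u'\cdot\mathbf z)}d\mathbf x'd\mathbf u'$ for $f\in L^2(\mathbb{R}^{2n})$ (an entire function on $\mathbb{C}^{2n}$). Let $W_t^\lambda(\mathbf x+i\mathbf y,\mathbf u+i\mathbf v)=4^n e^{\lambda(\mathbf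 u\cdot\mathbf y-\mathbf v\cdot\mathbf x)}p_{2t}^\lambda(2\mathbf y,2\mathbf v)$ ($\mathbf x,\mathbf y,\mathbf u,\mathbf v\in\mathbb{R}^n$), and let $\mathcal B_t^\lambda(\mathbb{C}^{2n})$ be the space of entire functions $F$ on $\mathbb{C}^{2n}$ with $\|F\|_\lambda^2=\int_{\mathbb{C}^{2n}}|F|^2W_t^\lambda\,d\mathbf z\,d\mathbf w<\infty$, with inner product $\langle F,G\rangle_\lambda=\int F\overline G\,W_t^\lambda$. Special Hermite functions: let $\Phi_\alpha$ ($\alpha\in\mathbb{N}_0^n$) be the normalized Hermite functions on $\mathbb{R}^n$, $\Phi_{\alpha,\beta}(\mathbf x,\mathbf u)=(2\pi)^{-n/2}\int_{\mathbb{R}^n}e^{i(\mathbf x\cdot\xi+\frac12\mathbf x\cdot\mathbf u)}\Phi_\alpha(\xi+\mathbf u)\Phi_\beta(\xi)\,d\xi$, and $\Phi^\lambda_{\alpha,\beta}(\mathbf x,\mathbf u)=|\lambda|^{n/2}\Phi_{\alpha,\beta}(\sqrt{|\lambda|}\mathbf x,\operatorname{sgn}(\lambda)\sqrt{|\lambda|}\mathbf u)$; these form an orthonormal basis of $L^2(\mathbb{R}^{2n})$. *)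

theory Defs
  imports "HOL-Analysis.Analysis"
begin

text \<open>Dimension n = CARD('n). Real vectors R^n are real^'n, complex vectors C^n are complex^'n.
  R^{2n} is modelled as (real^'n) \<times> (real^'n) and C^{2n} as (complex^'n) \<times> (complex^'n),
  both with Lebesgue measure lborel.\<close>

definition cdot :: "complex^'n \<Rightarrow> complex^'n \<Rightarrow> complex" where
  "cdot a b = (\<Sum>j\<in>UNIV. a$j * b$j)"

definition cvec :: "real^'n \<Rightarrow> complex^'n" where
  "cvec x = (\<chi> j. complex_of_real (x$j))"

definition Re_vec :: "complex^'n \<Rightarrow> real^'n" where
  "Re_vec z = (\<chi> j. Re (z$j))"

definition Im_vec :: "complex^'n \<Rightarrow> real^'n" where
  "Im_vec z = (\<chi> j. Im (z$j))"

definition cmul :: "complex \<Rightarrow> (complex^'n) \<times> (complex^'n) \<Rightarrow> (complex^'n) \<times> (complex^'n)" where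
  "cmul c p = ((\<chi> j. c * fst p $ j), (\<chi> j. c * snd p $ j))"

definition heat_p :: "real \<Rightarrow> real \<Rightarrow> complex^'n \<Rightarrow> complex^'n \<Rightarrow> complex" where
  "heat_p lam s z w =
     complex_of_real ((4*pi) powr (- real CARD('n)) * (lam / sinh (s*lam)) ^ CARD('n)) *
     exp (- complex_of_real (lam / 4 * (cosh (s*lam) / sinh (s*lam))) * (cdot z z + cdot w w))"

definition twisted_heat :: "real \<Rightarrow> real \<Rightarrow> ((real^'n) \<times> (real^'n) \<Rightarrow> complex)
                               \<Rightarrow> (complex^'n) \<times> (complex^'n) \<Rightarrow> complex" where
  "twisted_heat lam t f = (\<lambda>(z, w). integral\<^sup>L lborel (\<lambda>(x', u').
      f (x', u') * heat_p lam t (z - cvec x') (w - cvec u') *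
      exp (- \<i> * complex_of_real lam / 2 * (cdot (cvec x') w - cdot (cvec u') z))))"

text \<open>Weight W_t^lambda(x+iy, u+iv) = 4^n e^{lambda(u.y - v.x)} p_{2t}^lambda(2y,2v)
  (the heat kernel is real at real arguments; we take its real part).\<close>
definition bergman_weight :: "real \<Rightarrow> real \<Rightarrow> (complex^'n) \<times> (complex^'n) \<Rightarrow> real" where
  "bergman_weight lam t = (\<lambda>(z, w).
     4 ^ CARD('n) * exp (lam * (Re_vec w \<bullet> Im_vec z - Im_vec w \<bullet> Re_vec z)) *
     Re (heat_p lam (2*t) (cvec (2 *\<^sub>R Im_vec z)) (cvec (2 *\<^sub>R Im_vec w))))"

definition entire_fun :: "((complex^'n) \<times> (complex^'n) \<Rightarrow> complex) \<Rightarrow> bool" where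
  "entire_fun F \<longleftrightarrow> (\<forall>p. \<exists>D. (F has_derivative D) (at p) \<and> (\<forall>v. D (cmul \<i> v) = \<i> * D v))"

definition L2 :: "((real^'n) \<times> (real^'n) \<Rightarrow> complex) set" where
  "L2 = {f. f \<in> borel_measurable lborel \<and> (\<integral>\<^sup>+ x. ennreal ((cmod (f x))\<^sup>2) \<partial>lborel) < \<infinity>}"

definition bergman_space :: "real \<Rightarrow> real \<Rightarrow> ((complex^'n) \<times> (complex^'n) \<Rightarrow> complex) set" where
  "bergman_space lam t = {F. entire_fun F \<and>
      (\<integral>\<^sup>+ p. ennreal ((cmod (F p))\<^sup>2 * bergman_weight lam t p) \<partial>lborel) < \<infinity>}"

definition bergman_inner :: "real \<Rightarrow> real \<Rightarrow> ((complex^'n) \<times> (complex^'n) \<Rightarrow> complex)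
                                \<Rightarrow> ((complex^'n) \<times> (complex^'n) \<Rightarrow> complex) \<Rightarrow> complex" where
  "bergman_inner lam t F G =
     integral\<^sup>L lborel (\<lambda>p. F p * cnj (G p) * complex_of_real (bergman_weight lam t p))"

definition bergman_norm :: "real \<Rightarrow> real \<Rightarrow> ((complex^'n) \<times> (complex^'n) \<Rightarrow> complex) \<Rightarrow> real" where
  "bergman_norm lam t F =
     sqrt (integral\<^sup>L lborel (\<lambda>p. (cmod (F p))\<^sup>2 * bergman_weight lam t p))"

definition bergman_ONB :: "real \<Rightarrow> real \<Rightarrow> ('i \<Rightarrow> (complex^'n) \<times> (complex^'n) \<Rightarrow> complex) \<Rightarrow> bool" where
  "bergman_ONB lam t \<Psi> \<longleftrightarrow>
     (\<forall>k. \<Psi> k \<in> bergman_space lam t) \<and>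
     (\<forall>k l. bergman_inner lam t (\<Psi> k) (\<Psi> l) = (if k = l then 1 else 0)) \<and>
     (\<forall>F\<in>bergman_space lam t. \<forall>e>0. \<exists>S c. finite S \<and>
         bergman_norm lam t (\<lambda>p. F p - (\<Sum>k\<in>S. c k * \<Psi> k p)) < e)"

fun hermite_poly :: "nat \<Rightarrow> real \<Rightarrow> real" where
  "hermite_poly 0 x = 1"
| "hermite_poly (Suc 0) x = 2 * x"
| "hermite_poly (Suc (Suc k)) x = 2 * x * hermite_poly (Suc k) x - 2 * real (Suc k) * hermite_poly k x"

definition hermite_fun :: "nat \<Rightarrow> real \<Rightarrow> real" where
  "hermite_fun k x = hermite_poly k x * exp (- (x\<^sup>2) / 2) / sqrt (2 ^ k * fact k * sqrt pi)"

definition hermite_fun_n :: "('n \<Rightarrow> nat) \<Rightarrow> real^'n \<Rightarrow> real" where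
  "hermite_fun_n \<alpha> x = (\<Prod>j\<in>UNIV. hermite_fun (\<alpha> j) (x$j))"

definition special_hermite :: "('n \<Rightarrow> nat) \<Rightarrow> ('n \<Rightarrow> nat) \<Rightarrow> (real^'n) \<times> (real^'n) \<Rightarrow> complex" where
  "special_hermite \<alpha> \<beta> = (\<lambda>(x, u).
     complex_of_real ((2*pi) powr (- real CARD('n) / 2)) *
     integral\<^sup>L lborel (\<lambda>\<xi>. exp (\<i> * complex_of_real (x \<bullet> \<xi> + 1/2 * (x \<bullet> u))) *
        complex_of_real (hermite_fun_n \<alpha> (\<xi> + u) * hermite_fun_n \<beta> \<xi>)))"

definition special_hermite_lam :: "real \<Rightarrow> ('n \<Rightarrow> nat) \<Rightarrow> ('n \<Rightarrow> nat) \<Rightarrow> (real^'n) \<times> (real^'n) \<Rightarrow> complex" where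
  "special_hermite_lam lam \<alpha> \<beta> = (\<lambda>(x, u).
     complex_of_real (\<bar>lam\<bar> powr (real CARD('n) / 2)) *
     special_hermite \<alpha> \<beta> (sqrt \<bar>lam\<bar> *\<^sub>R x, (sgn lam * sqrt \<bar>lam\<bar>) *\<^sub>R u))"

end

theory Submission
  imports Defs "HOL-Probability.Probability" "HOL-Complex_Analysis.Complex_Analysis"
begin

text \<open>
  Write \<open>c = (\<lambda>/4) coth(t\<lambda>)\<close>. Expanding the Gaussian kernel, the transform of \<open>f\<close> is, up to a constant,
  \<open>exp(-c(z\<cdot>z + w\<cdot>w))\<close> times the Laplace transform of \<open>f exp(-c|q|^2)\<close> at
  \<open>\<zeta> = (2cz - i(\<lambda>/2)w, 2cw + i(\<lambda>/2)z)\<close>, and \<open>|exp(-c(z\<cdot>z + w\<cdot>w))|^2 W\<close> is a constant times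
  \<open>exp(-|Re \<zeta>|^2/2c)\<close>. Plancherel in \<open>Im \<zeta>\<close> followed by a Gaussian integral in \<open>Re \<zeta>\<close> gives the isometry.

  For surjectivity, let \<open>G\<close> be an element of the Bergman space that is orthogonal to the image. Testing
  \<open>G\<close> against the transform of \<open>exp(-c|q|^2)\<close> and its twisted translates produces integrals of entire
  functions against a weight invariant under \<open>p \<mapsto> e^(i\<theta>)p\<close>; by the mean value property they
  evaluate \<open>G\<close> at the real points, so \<open>G\<close> vanishes there and hence identically. As the image is complete,
  it is the whole space.

  The special Hermite functions are orthonormal by Plancherel in \<open>x\<close>. Their span is
  stable under multiplication by the coordinates and contains a Gaussian, so a function orthogonal to all of
  them has, after multiplication by this Gaussian, vanishing Fourier transform.
\<close>

subsection \<open>Square-integrable functions\<close>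

text \<open>Square integrability is a predicate on functions over an arbitrary measure, so one set
  of Hilbert space arguments serves both Lebesgue measure and the weighted measure on the complex
  side. No reproducing kernel is set up, and limits of entire functions are never taken: Cauchy
  sequences are pulled back through the isometry, limits are formed in the real L2 space, and their
  transforms are entire anyway.

  Two hyperbolic identities carry the constants. With \<open>c\<close> the rate at time
  \<open>t\<close>, \<open>4 * c\<^sup>2 - lam\<^sup>2 / 4\<close> is a positive square, which makes
  the linear change of variable to \<zeta> invertible, and four times the rate at time
  \<open>2 * t\<close> equals \<open>2 * c + lam\<^sup>2 / (8 * c)\<close>, which is what completes
  the square in the weight. The Gaussian of rate \<open>c\<close> is a multiple of the heat kernel
  at time \<open>t\<close>, so its transform is a Gaussian with the rate of time
  \<open>2 * t\<close>. The weight has this same rate; this is why, in the test for orthogonality,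
  the conjugated transform times the weight splits into a holomorphic factor and a circle-invariant
  one.\<close>

definition sq_integrable :: "'a measure \<Rightarrow> ('a \<Rightarrow> complex) \<Rightarrow> bool" where
  "sq_integrable M f \<longleftrightarrow> f \<in> borel_measurable M \<and> integrable M (\<lambda>x. (cmod (f x))\<^sup>2)"

definition l2_inner :: "'a measure \<Rightarrow> ('a \<Rightarrow> complex) \<Rightarrow> ('a \<Rightarrow> complex) \<Rightarrow> complex" where
  "l2_inner M f g = (\<integral>x. f x * cnj (g x) \<partial>M)"

definition l2_normsq :: "'a measure \<Rightarrow> ('a \<Rightarrow> complex) \<Rightarrow> real" where
  "l2_normsq M f = (\<integral>x. (cmod (f x))\<^sup>2 \<partial>M)"

lemma l2_normsq_nonneg [simp]: "0 \<le> l2_normsq M f"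
  by (simp add: l2_normsq_def)

lemma sq_integrable_measurable [measurable_dest]:
  "sq_integrable M f \<Longrightarrow> f \<in> borel_measurable M"
  by (simp add: sq_integrable_def)

lemma sq_integrableI_bound:
  assumes "f \<in> borel_measurable M" "integrable M g" "\<And>x. (cmod (f x))\<^sup>2 \<le> g x"
  shows "sq_integrable M f"
  unfolding sq_integrable_def
proof
  show "integrable M (\<lambda>x. (cmod (f x))\<^sup>2)"
    using assms(1) order_trans[OF assms(3) abs_ge_self]
    by (intro Bochner_Integration.integrable_bound[OF assms(2)]) auto
qed (fact assms)

lemma borel_measurable_cnj [measurable (raw)]:
  assumes "f \<in> borel_measurable M"
  shows "(\<lambda>x. cnj (f x)) \<in> borel_measurable M"
  using measurable_compose[OF assms borel_measurable_continuous_onI[of cnj]]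
  by (simp add: continuous_on_cnj)

lemma sq_integrable_iff_nn_integral:
  assumes "f \<in> borel_measurable M"
  shows "sq_integrable M f \<longleftrightarrow> (\<integral>\<^sup>+x. ennreal ((cmod (f x))\<^sup>2) \<partial>M) < \<infinity>"
  using assms by (simp add: sq_integrable_def integrable_iff_bounded)

lemma nn_integral_eq_l2_normsq:
  assumes "sq_integrable M f"
  shows "(\<integral>\<^sup>+x. ennreal ((cmod (f x))\<^sup>2) \<partial>M) = ennreal (l2_normsq M f)"
  using assms unfolding sq_integrable_def l2_normsq_def by (intro nn_integral_eq_integral) auto

lemma tendsto_zero_bound:
  fixes a b :: "nat \<Rightarrow> real"
  assumes "\<And>k. 0 \<le> a k" "\<And>k. a k \<le> b k" "b \<longlonglongrightarrow> 0"
  shows "a \<longlonglongrightarrow> 0"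
  using assms by (intro tendsto_sandwich[OF _ _ tendsto_const assms(3)] always_eventually allI) 

lemma cmod_add_sq_le: "(cmod (a + b))\<^sup>2 \<le> 2 * (cmod a)\<^sup>2 + 2 * (cmod b)\<^sup>2"
proof -
  have "(cmod (a + b))\<^sup>2 \<le> (cmod a + cmod b)\<^sup>2"
    by (intro power_mono norm_triangle_ineq) auto
  also have "\<dots> \<le> 2 * (cmod a)\<^sup>2 + 2 * (cmod b)\<^sup>2"
    using sum_squares_bound[of "cmod a" "cmod b"] by (simp add: power2_sum)
  finally show ?thesis .
qed

lemma cmod_diff_sq_le: "(cmod (a - b))\<^sup>2 \<le> 2 * (cmod a)\<^sup>2 + 2 * (cmod b)\<^sup>2"
  using cmod_add_sq_le[of a "- b"] by simp

lemma sq_integrable_add: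
  assumes "sq_integrable M f" "sq_integrable M g"
  shows "sq_integrable M (\<lambda>x. f x + g x)"
  using assms
  by (intro sq_integrableI_bound[where g = "\<lambda>x. 2 * (cmod (f x))\<^sup>2 + 2 * (cmod (g x))\<^sup>2"] cmod_add_sq_le)
    (auto simp: sq_integrable_def)

lemma sq_integrable_diff:
  assumes "sq_integrable M f" "sq_integrable M g"
  shows "sq_integrable M (\<lambda>x. f x - g x)"
  using assms
  by (intro sq_integrableI_bound[where g = "\<lambda>x. 2 * (cmod (f x))\<^sup>2 + 2 * (cmod (g x))\<^sup>2"] cmod_diff_sq_le)
    (auto simp: sq_integrable_def)

lemma sq_integrable_cmult:
  assumes "sq_integrable M f"
  shows "sq_integrable M (\<lambda>x. c * f x)"
  using assms by (auto simp: sq_integrable_def norm_mult power_mult_distrib)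

lemma sq_integrable_zero: "sq_integrable M (\<lambda>x. 0)"
  by (simp add: sq_integrable_def)

lemma sq_integrable_sum:
  assumes "\<And>k. k \<in> A \<Longrightarrow> sq_integrable M (f k)"
  shows "sq_integrable M (\<lambda>x. \<Sum>k\<in>A. f k x)"
  using assms
  by (induction A rule: infinite_finite_induct) (auto simp: sq_integrable_zero intro!: sq_integrable_add)

lemma l2_normsq_add_le:
  assumes "sq_integrable M f" "sq_integrable M g"
  shows "l2_normsq M (\<lambda>x. f x + g x) \<le> 2 * l2_normsq M f + 2 * l2_normsq M g"
proof -
  have "l2_normsq M (\<lambda>x. f x + g x) \<le> (\<integral>x. 2 * (cmod (f x))\<^sup>2 + 2 * (cmod (g x))\<^sup>2 \<partial>M)"
    unfolding l2_normsq_def using assms sq_integrable_add[OF assms]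
    by (intro integral_mono cmod_add_sq_le) (auto simp: sq_integrable_def)
  also have "\<dots> = 2 * l2_normsq M f + 2 * l2_normsq M g"
    using assms by (simp add: l2_normsq_def sq_integrable_def)
  finally show ?thesis .
qed

lemma l2_normsq_minus_commute:
  "l2_normsq M (\<lambda>x. f x - g x) = l2_normsq M (\<lambda>x. g x - f x)"
  by (simp add: l2_normsq_def norm_minus_commute)

lemma integrable_mult_cnj:
  assumes "sq_integrable M f" "sq_integrable M g"
  shows "integrable M (\<lambda>x. f x * cnj (g x))"
proof (rule Bochner_Integration.integrable_bound)
  show "integrable M (\<lambda>x. (cmod (f x))\<^sup>2 + (cmod (g x))\<^sup>2)"
    using assms by (auto simp: sq_integrable_def)
  show "(\<lambda>x. f x * cnj (g x)) \<in> borel_measurable M"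
    using assms by measurable
  have "cmod (f x) * cmod (g x) \<le> (cmod (f x))\<^sup>2 + (cmod (g x))\<^sup>2" for x
    using sum_squares_bound[of "cmod (f x)" "cmod (g x)"] zero_le_power2[of "cmod (f x)"]
      zero_le_power2[of "cmod (g x)"] mult_nonneg_nonneg[OF norm_ge_zero norm_ge_zero, of "f x" "g x"]
    by linarith
  then show "AE x in M. norm (f x * cnj (g x)) \<le> norm ((cmod (f x))\<^sup>2 + (cmod (g x))\<^sup>2)"
    by (auto simp: norm_mult)
qed

lemma integrable_mult_sq_integrable:
  assumes "sq_integrable M f" "sq_integrable M g"
  shows "integrable M (\<lambda>x. f x * g x)"
proof -
  have "sq_integrable M (\<lambda>x. cnj (g x))"
    using assms by (auto simp: sq_integrable_def)
  from integrable_mult_cnj[OF assms(1) this] show ?thesis by simp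
qed

text \<open>Expansion of a quadratic form along a complex line. Suitable choices of \<open>c\<close>
  yield the Cauchy-Schwarz inequality, the polarization identity and the estimate for
  near-minimizers of the distance.\<close>

lemma l2_normsq_diff_cmult:
  assumes f: "sq_integrable M f" and g: "sq_integrable M g"
  shows "l2_normsq M (\<lambda>x. f x - c * g x)
    = l2_normsq M f - 2 * Re (cnj c * l2_inner M f g) + (cmod c)\<^sup>2 * l2_normsq M g"
proof -
  have i: "integrable M (\<lambda>x. f x * cnj (g x))" "integrable M (\<lambda>x. (cmod (f x))\<^sup>2)"
    "integrable M (\<lambda>x. (cmod (g x))\<^sup>2)"
    using f g integrable_mult_cnj[OF f g] by (auto simp: sq_integrable_def)
  have "(cmod (f x - c * g x))\<^sup>2
      = (cmod (f x))\<^sup>2 - 2 * Re (cnj c * (f x * cnj (g x))) + (cmod c)\<^sup>2 * (cmod (g x))\<^sup>2" for x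
    unfolding cmod_power2 by (simp add: algebra_simps power2_eq_square)
  then have "l2_normsq M (\<lambda>x. f x - c * g x) =
     (\<integral>x. (cmod (f x))\<^sup>2 - 2 * Re (cnj c * (f x * cnj (g x))) + (cmod c)\<^sup>2 * (cmod (g x))\<^sup>2 \<partial>M)"
    by (simp add: l2_normsq_def)
  also have "\<dots> = l2_normsq M f - 2 * (\<integral>x. Re (cnj c * (f x * cnj (g x))) \<partial>M) + (cmod c)\<^sup>2 * l2_normsq M g"
    unfolding l2_normsq_def using i integrable_Re[OF integrable_mult_right[OF i(1), of "cnj c"]] by (simp del: times_complex.simps)
  also have "(\<integral>x. Re (cnj c * (f x * cnj (g x))) \<partial>M) = Re (cnj c * l2_inner M f g)"
    unfolding l2_inner_def
    using integral_Re[OF integrable_mult_right[OF i(1)], of "cnj c"] by (simp only: integral_mult_right_zero)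
  finally show ?thesis .
qed

lemma l2_cauchy_schwarz:
  assumes f: "sq_integrable M f" and g: "sq_integrable M g"
  shows "(cmod (l2_inner M f g))\<^sup>2 \<le> l2_normsq M f * l2_normsq M g"
proof -
  define ip where "ip = l2_inner M f g"
  \<comment> \<open>The multiple \<open>of_real s * ip\<close> of \<open>g\<close> is removed from
    \<open>f\<close>; its phase makes the cross term real, which leaves a real quadratic in
    \<open>s\<close>.\<close>
  have *: "0 \<le> l2_normsq M f - 2 * s * (cmod ip)\<^sup>2 + s\<^sup>2 * (cmod ip)\<^sup>2 * l2_normsq M g" for s :: real
  proof -
    have "cnj (of_real s * ip) * ip = of_real (s * (cmod ip)\<^sup>2)"
      by (simp add: complex_norm_square mult_ac del: of_real_power)
    moreover have "0 \<le> l2_normsq M (\<lambda>x. f x - (of_real s * ip) * g x)"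
      by simp
    ultimately show ?thesis
      unfolding l2_normsq_diff_cmult[OF f g] ip_def
      by (simp del: complex_cnj_mult add: norm_mult power_mult_distrib)
  qed
  show ?thesis
  proof (cases "l2_normsq M g = 0")
    case True
    then have "0 \<le> l2_normsq M f - 2 * s * (cmod ip)\<^sup>2" for s :: real
      using *[of s] by simp
    \<comment> \<open>If \<open>g\<close> has norm zero, the bound is affine in \<open>s\<close>,
      and this large \<open>s\<close> would make it negative unless \<open>ip\<close>
      vanishes.\<close>
    from this[of "(l2_normsq M f + 1) / (cmod ip)\<^sup>2"] l2_normsq_nonneg[of M f] have "ip = 0"
      by (cases "ip = 0") auto
    then show ?thesis by (simp add: ip_def[symmetric])
  next
    case False
    then have "l2_normsq M g > 0"
      using l2_normsq_nonneg[of M g] by linarith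
    \<comment> \<open>The chosen \<open>s\<close> is the minimizer of the quadratic.\<close>
    then show ?thesis
      using *[of "1 / l2_normsq M g"] unfolding ip_def[symmetric]
      by (simp add: power2_eq_square field_simps)
  qed
qed

lemma l2_inner_diff_left:
  assumes "sq_integrable M f" "sq_integrable M f'" "sq_integrable M g"
  shows "l2_inner M (\<lambda>x. f x - f' x) g = l2_inner M f g - l2_inner M f' g"
  unfolding l2_inner_def left_diff_distrib
  by (intro Bochner_Integration.integral_diff integrable_mult_cnj assms)

lemma l2_inner_tendsto:
  assumes "\<And>k. sq_integrable M (f k)" "sq_integrable M f'" "sq_integrable M g"
    and "(\<lambda>k. l2_normsq M (\<lambda>x. f k x - f' x)) \<longlonglongrightarrow> 0"
  shows "(\<lambda>k. l2_inner M (f k) g) \<longlonglongrightarrow> l2_inner M f' g"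
proof -
  have "(\<lambda>k. l2_normsq M (\<lambda>x. f k x - f' x) * l2_normsq M g) \<longlonglongrightarrow> 0 * l2_normsq M g"
    by (intro tendsto_intros assms)
  then have "(\<lambda>k. (cmod (l2_inner M (\<lambda>x. f k x - f' x) g))\<^sup>2) \<longlonglongrightarrow> 0"
    by (intro tendsto_zero_bound[OF _ l2_cauchy_schwarz[OF sq_integrable_diff[OF assms(1,2)] assms(3)]]) auto
  then have "(\<lambda>k. l2_inner M (\<lambda>x. f k x - f' x) g) \<longlonglongrightarrow> 0"
    by (simp add: tendsto_norm_zero_iff)
  then show ?thesis
    unfolding l2_inner_diff_left[OF assms(1-3)] by (simp add: LIM_zero_iff)
qed

text \<open>All four terms have the form \<open>f x - c * g x\<close>, so a map that preserves the
  norms of such combinations up to a constant does the same to inner products. It is applied to the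
  Fourier transform and to the twisted heat transform.\<close>

lemma l2_polarization:
  assumes f: "sq_integrable M f" and g: "sq_integrable M g"
  shows "4 * l2_inner M f g = l2_normsq M (\<lambda>x. f x - (-1) * g x) - l2_normsq M (\<lambda>x. f x - 1 * g x)
     + \<i> * l2_normsq M (\<lambda>x. f x - (-\<i>) * g x) - \<i> * l2_normsq M (\<lambda>x. f x - \<i> * g x)"
  unfolding l2_normsq_diff_cmult[OF f g] by (simp add: complex_eq_iff)

text \<open>The Hilbert space projection, stopped before the limit is taken: near-minimizers of the
  distance from \<open>F\<close> to the subspace \<open>P\<close> are Cauchy, and their residuals
  become orthogonal to \<open>P\<close>. Each application supplies the limit in its own way.\<close>

lemma l2_minimizing_sequence:
  assumes P: "\<And>g. g \<in> P \<Longrightarrow> sq_integrable M g" and zero: "(\<lambda>x. 0) \<in> P"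
    and lin: "\<And>g h c. g \<in> P \<Longrightarrow> h \<in> P \<Longrightarrow> (\<lambda>x. g x + c * h x) \<in> P"
    and F: "sq_integrable M F"
  obtains g where "\<And>k. g k \<in> P"
    "\<And>e. e > 0 \<Longrightarrow> \<exists>N. \<forall>k\<ge>N. \<forall>m\<ge>N. l2_normsq M (\<lambda>x. g k x - g m x) < e"
    "\<And>h. h \<in> P \<Longrightarrow> (\<lambda>k. l2_inner M (\<lambda>x. F x - g k x) h) \<longlonglongrightarrow> 0"
proof -
  define \<delta> where "\<delta> = (INF g\<in>P. l2_normsq M (\<lambda>x. F x - g x))"
  have bdd: "bdd_below ((\<lambda>g. l2_normsq M (\<lambda>x. F x - g x)) ` P)"
    by (intro bdd_belowI[of _ 0]) auto
  have lower: "\<delta> \<le> l2_normsq M (\<lambda>x. F x - g x)" if "g \<in> P" for g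
    unfolding \<delta>_def by (rule cINF_lower[OF bdd that])
  have "\<exists>g\<in>P. l2_normsq M (\<lambda>x. F x - g x) < \<delta> + 1 / real (Suc k)" for k
    using cINF_less_iff[of P, OF _ bdd, of "\<delta> + 1 / real (Suc k)"] zero
    unfolding \<delta>_def by auto
  then obtain g where gP: "\<And>k. g k \<in> P"
    and gk: "\<And>k. l2_normsq M (\<lambda>x. F x - g k x) < \<delta> + 1 / real (Suc k)"
    by metis
  have Fg: "sq_integrable M (\<lambda>x. F x - g k x)" for k
    by (intro sq_integrable_diff F P gP)
  have cau: "l2_normsq M (\<lambda>x. g k x - g m x) \<le> 2 / real (Suc k) + 2 / real (Suc m)" for k m
  proof -
    \<comment> \<open>The midpoint of two near-minimizers lies in \<open>P\<close>, so its square
      distance to \<open>F\<close> is at least \<open>\<delta>\<close>; the parallelogram law then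
      bounds the distance between the two.\<close>
    let ?h = "\<lambda>x. 1/2 * g m x + 1/2 * g k x"
    have hP: "?h \<in> P"
      using lin[OF lin[OF zero gP[of m], of "1/2"] gP[of k], of "1/2"] by simp
    have mean: "sq_integrable M (\<lambda>x. F x - ?h x)"
      by (intro sq_integrable_diff F P hP)
    have diff: "sq_integrable M (\<lambda>x. g k x - g m x)"
      by (intro sq_integrable_diff P gP)
    have "(cmod (g k x - g m x))\<^sup>2 = 2 * (cmod (F x - g k x))\<^sup>2 + 2 * (cmod (F x - g m x))\<^sup>2
        - 4 * (cmod (F x - ?h x))\<^sup>2" for x
      unfolding cmod_power2 by (simp add: field_simps power2_eq_square)
    then have "l2_normsq M (\<lambda>x. g k x - g m x) = 2 * l2_normsq M (\<lambda>x. F x - g k x)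
        + 2 * l2_normsq M (\<lambda>x. F x - g m x) - 4 * l2_normsq M (\<lambda>x. F x - ?h x)"
      unfolding l2_normsq_def using Fg[of k] Fg[of m] mean by (simp add: sq_integrable_def)
    with lower[OF hP] gk[of k] gk[of m] show ?thesis by simp
  qed
  have orth: "(\<lambda>k. l2_inner M (\<lambda>x. F x - g k x) h) \<longlonglongrightarrow> 0" if h: "h \<in> P" for h
  proof -
    define N where "N = l2_normsq M h"
    \<comment> \<open>A step length that works for every \<open>h\<close>, including one of norm
      zero. It ensures \<open>s * N \<le> 1\<close>, so the quadratic term eats up at most half of
      the linear gain.\<close>
    define s where "s = 1 / (N + 1)"
    have N: "N \<ge> 0" by (simp add: N_def)
    then have s: "s > 0" "s * N \<le> 1" by (auto simp: s_def field_simps)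
    have b: "(cmod (l2_inner M (\<lambda>x. F x - g k x) h))\<^sup>2 \<le> (N + 1) * (1 / real (Suc k))" for k
    proof -
      define ip where "ip = l2_inner M (\<lambda>x. F x - g k x) h"
      \<comment> \<open>Moving from \<open>g k\<close> along \<open>h\<close> stays in
        \<open>P\<close>, so the square distance cannot fall below \<open>\<delta>\<close>, hence it
        drops by at most \<open>1 / real (Suc k)\<close>.\<close>
      have "(\<lambda>x. g k x + (of_real s * ip) * h x) \<in> P"
        by (intro lin gP h)
      from lower[OF this] have "\<delta> \<le> l2_normsq M (\<lambda>x. (F x - g k x) - (of_real s * ip) * h x)"
        by (simp add: algebra_simps)
      also have "\<dots> = l2_normsq M (\<lambda>x. F x - g k x) - 2 * (s * (cmod ip)\<^sup>2) + s\<^sup>2 * (cmod ip)\<^sup>2 * N"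
      proof -
        have "cnj (of_real s * ip) * ip = of_real (s * (cmod ip)\<^sup>2)"
          by (simp add: complex_norm_square mult_ac del: of_real_power)
        then show ?thesis
          unfolding l2_normsq_diff_cmult[OF Fg P[OF h]] ip_def[symmetric] N_def
          using s by (simp del: complex_cnj_mult add: norm_mult power_mult_distrib)
      qed
      finally have "2 * (s * (cmod ip)\<^sup>2) - (s * N) * (s * (cmod ip)\<^sup>2) \<le> 1 / real (Suc k)"
        using gk[of k] by (simp add: power2_eq_square algebra_simps)
      moreover have "(s * N) * (s * (cmod ip)\<^sup>2) \<le> 1 * (s * (cmod ip)\<^sup>2)"
        using s by (intro mult_right_mono) auto
      ultimately have "s * (cmod ip)\<^sup>2 \<le> 1 / real (Suc k)" by linarith
      then have "(cmod ip)\<^sup>2 \<le> (1 / real (Suc k)) / s"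
        using s by (simp only: pos_le_divide_eq mult.commute)
      then show ?thesis by (simp add: ip_def s_def mult.commute)
    qed
    have "(\<lambda>k. (N + 1) * (1 / real (Suc k))) \<longlonglongrightarrow> (N + 1) * 0"
      by (intro tendsto_mult tendsto_const LIMSEQ_inverse_real_of_nat[unfolded inverse_eq_divide])
    then have "(\<lambda>k. (cmod (l2_inner M (\<lambda>x. F x - g k x) h))\<^sup>2) \<longlonglongrightarrow> 0"
      by (intro tendsto_zero_bound[OF _ b]) auto
    then show ?thesis by (simp add: tendsto_norm_zero_iff)
  qed
  show ?thesis
  proof (rule that[OF gP])
    fix e :: real assume e: "e > 0"
    then obtain N where N: "1 / real (Suc N) < e / 4"
      using nat_approx_posE[of "e/4"] by auto
    have "l2_normsq M (\<lambda>x. g k x - g m x) < e" if "k \<ge> N" "m \<ge> N" for k m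
    proof -
      have "1 / real (Suc k) \<le> 1 / real (Suc N)" "1 / real (Suc m) \<le> 1 / real (Suc N)"
        using that by (auto simp: field_simps)
      with N cau[of k m] show ?thesis by simp
    qed
    then show "\<exists>N. \<forall>k\<ge>N. \<forall>m\<ge>N. l2_normsq M (\<lambda>x. g k x - g m x) < e" by blast
  qed (rule orth)
qed

text \<open>Riesz-Fischer: a subsequence whose successive square distances shrink like powers of 1/4
  converges almost everywhere, and Fatou's lemma turns the Cauchy estimate into convergence to its
  limit.\<close>

lemma l2_complete:
  assumes s: "\<And>k. sq_integrable M (s k)"
    and cauchy: "\<And>e. e > 0 \<Longrightarrow> \<exists>N. \<forall>k\<ge>N. \<forall>m\<ge>N. l2_normsq M (\<lambda>x. s k x - s m x) < e"
  obtains f where "sq_integrable M f" "(\<lambda>k. l2_normsq M (\<lambda>x. s k x - f x)) \<longlonglongrightarrow> 0"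
proof -
  have [measurable]: "s k \<in> borel_measurable M" for k
    using s by measurable
  have diff: "sq_integrable M (\<lambda>x. s k x - s m x)" for k m
    by (intro sq_integrable_diff s)
  have "\<exists>N. \<forall>k\<ge>N. \<forall>m\<ge>N. l2_normsq M (\<lambda>x. s k x - s m x) < (1/4) ^ j" for j
    by (rule cauchy) simp
  then obtain N where N: "\<And>j k m. k \<ge> N j \<Longrightarrow> m \<ge> N j \<Longrightarrow> l2_normsq M (\<lambda>x. s k x - s m x) < (1/4) ^ j"
    by metis
  \<comment> \<open>Summing the thresholds gives \<open>n (Suc j) \<ge> N j\<close> without a
    recursive choice of indices; the summand \<open>j\<close> sends the subsequence to
    infinity.\<close>
  define n where "n j = j + (\<Sum>i\<le>j. N i)" for j
  have n: "n j \<ge> N j" "n (Suc j) \<ge> N j" "n j \<ge> j" for j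
    using member_le_sum[of j "{..j}" N] by (auto simp: n_def)
  define D where "D j x = cmod (s (n (Suc j)) x - s (n j) x)" for j x
  have [measurable]: "D j \<in> borel_measurable M" for j
    by (simp add: D_def[abs_def])
  \<comment> \<open>Weighting the squares of the increments by \<open>2 ^ j\<close> makes the increments themselves summable by AM-GM.\<close>
  have "(\<integral>\<^sup>+x. (\<Sum>j. ennreal (2 ^ j * (D j x)\<^sup>2)) \<partial>M) = (\<Sum>j. \<integral>\<^sup>+x. ennreal (2 ^ j * (D j x)\<^sup>2) \<partial>M)"
    by (rule nn_integral_suminf) measurable
  also have "\<dots> \<le> (\<Sum>j. ennreal ((1/2) ^ j))"
  proof (rule suminf_le)
    fix j
    have "(\<integral>\<^sup>+x. ennreal (2 ^ j * (D j x)\<^sup>2) \<partial>M) = ennreal (2 ^ j) * (\<integral>\<^sup>+x. ennreal ((D j x)\<^sup>2) \<partial>M)"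
      by (subst nn_integral_cmult[symmetric]) (auto simp: ennreal_mult)
    also have "(\<integral>\<^sup>+x. ennreal ((D j x)\<^sup>2) \<partial>M) = ennreal (l2_normsq M (\<lambda>x. s (n (Suc j)) x - s (n j) x))"
      unfolding D_def by (rule nn_integral_eq_l2_normsq[OF diff])
    also have "\<dots> \<le> ennreal ((1/4) ^ j)"
      using N[OF n(2,1), of j] by (intro ennreal_leI) auto
    finally show "(\<integral>\<^sup>+x. ennreal (2 ^ j * (D j x)\<^sup>2) \<partial>M) \<le> ennreal ((1/2) ^ j)"
      by (auto simp: ennreal_mult[symmetric] power_mult_distrib[symmetric] mult_left_mono)
  qed auto
  also have "\<dots> = ennreal (\<Sum>j. (1/2) ^ j)"
    by (rule suminf_ennreal2) auto
  also have "\<dots> < \<infinity>"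
    by simp
  finally have "AE x in M. (\<Sum>j. ennreal (2 ^ j * (D j x)\<^sup>2)) \<noteq> \<infinity>"
    by (intro nn_integral_PInf_AE) auto
  then have ae: "AE x in M. convergent (\<lambda>j. s (n j) x)"
  proof eventually_elim
    fix x assume "(\<Sum>j. ennreal (2 ^ j * (D j x)\<^sup>2)) \<noteq> \<infinity>"
    then have "summable (\<lambda>j. 2 ^ j * (D j x)\<^sup>2)"
      by (intro summable_suminf_not_top) auto
    moreover have "summable (\<lambda>j. (1/2 :: real) ^ j)"
      by (rule summable_geometric) simp
    ultimately have "summable (\<lambda>j. (1/2) ^ j + 2 ^ j * (D j x)\<^sup>2)"
      by (intro summable_add)
    then have "summable (\<lambda>j. D j x)"
    proof (rule summable_comparison_test[rotated], intro exI allI impI)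
      fix j
      have "2 * sqrt ((1/2) ^ j) * (sqrt (2 ^ j) * D j x) \<le> (sqrt ((1/2) ^ j))\<^sup>2 + (sqrt (2 ^ j) * D j x)\<^sup>2"
        by (rule sum_squares_bound)
      moreover have "sqrt ((1/2) ^ j) * sqrt (2 ^ j) = 1"
        by (simp add: real_sqrt_mult[symmetric] power_mult_distrib[symmetric])
      ultimately have "2 * D j x \<le> (1/2) ^ j + 2 ^ j * (D j x)\<^sup>2"
        by (simp add: power_mult_distrib) (metis mult.assoc mult.commute mult_1)
      moreover have "0 \<le> D j x" by (simp add: D_def)
      ultimately show "norm (D j x) \<le> (1/2) ^ j + 2 ^ j * (D j x)\<^sup>2" by simp
    qed
    then have "summable (\<lambda>j. s (n (Suc j)) x - s (n j) x)"
      unfolding D_def by (rule summable_norm_cancel)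
    then have "convergent (\<lambda>m. (\<Sum>j<m. s (n (Suc j)) x - s (n j) x) + s (n 0) x)"
      by (intro convergent_add convergent_const) (simp add: summable_iff_convergent)
    then show "convergent (\<lambda>j. s (n j) x)"
      by (simp add: sum_lessThan_telescope[of "\<lambda>j. s (n j) x"])
  qed
  \<comment> \<open>Where the subsequence diverges, which happens on a null set only, this is
    whatever value \<open>lim\<close> assigns.\<close>
  define f where "f x = lim (\<lambda>j. s (n j) x)" for x
  have fm [measurable]: "f \<in> borel_measurable M"
    unfolding f_def[abs_def] by measurable
  \<comment> \<open>Fatou's lemma along the subsequence, with \<open>k\<close> held fixed.\<close>
  have close: "(\<integral>\<^sup>+x. ennreal ((cmod (s k x - f x))\<^sup>2) \<partial>M) \<le> ennreal e"
    if K: "\<forall>k\<ge>K. \<forall>m\<ge>K. l2_normsq M (\<lambda>x. s k x - s m x) < e" and k: "k \<ge> K" for K k e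
  proof -
    have "(\<integral>\<^sup>+x. ennreal ((cmod (s k x - f x))\<^sup>2) \<partial>M)
        = (\<integral>\<^sup>+x. liminf (\<lambda>j. ennreal ((cmod (s k x - s (n j) x))\<^sup>2)) \<partial>M)"
      using ae
    proof (intro nn_integral_cong_AE, eventually_elim)
      fix x assume "convergent (\<lambda>j. s (n j) x)"
      then have "(\<lambda>j. s (n j) x) \<longlonglongrightarrow> f x"
        by (simp add: f_def convergent_LIMSEQ_iff)
      then have "(\<lambda>j. ennreal ((cmod (s k x - s (n j) x))\<^sup>2)) \<longlonglongrightarrow> ennreal ((cmod (s k x - f x))\<^sup>2)"
        by (intro tendsto_ennrealI tendsto_intros)
      then show "ennreal ((cmod (s k x - f x))\<^sup>2) = liminf (\<lambda>j. ennreal ((cmod (s k x - s (n j) x))\<^sup>2))"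
        by (rule lim_imp_Liminf[OF sequentially_bot, symmetric])
    qed
    also have "\<dots> \<le> liminf (\<lambda>j. \<integral>\<^sup>+x. ennreal ((cmod (s k x - s (n j) x))\<^sup>2) \<partial>M)"
      by (rule nn_integral_liminf) measurable
    also have "\<dots> = liminf (\<lambda>j. ennreal (l2_normsq M (\<lambda>x. s k x - s (n j) x)))"
      by (simp add: nn_integral_eq_l2_normsq[OF diff])
    also have "\<dots> \<le> liminf (\<lambda>j. ennreal e)"
    proof (rule Liminf_mono, rule eventually_sequentiallyI[of K])
      fix j assume "j \<ge> K"
      then have "n j \<ge> K" using n(3)[of j] by linarith
      with K k have "l2_normsq M (\<lambda>x. s k x - s (n j) x) < e" by blast
      then show "ennreal (l2_normsq M (\<lambda>x. s k x - s (n j) x)) \<le> ennreal e"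
        by (intro ennreal_leI) simp
    qed
    also have "\<dots> = ennreal e"
      by (simp add: Liminf_const)
    finally show ?thesis .
  qed
  have sf: "sq_integrable M (\<lambda>x. s (N 0) x - f x)"
  proof -
    have "(\<integral>\<^sup>+x. ennreal ((cmod (s (N 0) x - f x))\<^sup>2) \<partial>M) \<le> ennreal 1"
      using N[of 0] by (intro close[of "N 0"]) auto
    also have "\<dots> < \<infinity>" by simp
    finally show ?thesis
      by (subst sq_integrable_iff_nn_integral) auto
  qed
  have f: "sq_integrable M f"
    using sq_integrable_diff[OF s[of "N 0"] sf] by simp
  show ?thesis
  proof (rule that[OF f], rule LIMSEQ_I)
    fix e :: real assume e: "e > 0"
    obtain K where K: "\<forall>k\<ge>K. \<forall>m\<ge>K. l2_normsq M (\<lambda>x. s k x - s m x) < e / 2"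
      using cauchy[of "e/2"] e by auto
    have "l2_normsq M (\<lambda>x. s k x - f x) \<le> e / 2" if "k \<ge> K" for k
      using close[OF K that] e
      unfolding nn_integral_eq_l2_normsq[OF sq_integrable_diff[OF s f]] by simp
    with e show "\<exists>no. \<forall>k\<ge>no. norm (l2_normsq M (\<lambda>x. s k x - f x) - 0) < e"
      by (intro exI[of _ K]) fastforce
  qed
qed

subsection \<open>Continuity of translations\<close>

lemma nn_integral_lborel_shift:
  fixes c :: "'a::euclidean_space"
  assumes [measurable]: "f \<in> borel_measurable borel"
  shows "(\<integral>\<^sup>+x. f (c + x) \<partial>lborel) = (\<integral>\<^sup>+x. f x \<partial>lborel)"
  by (subst (2) lborel_distr_plus[of c, symmetric]) (simp add: nn_integral_distr)

lemma integral_lborel_shift: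
  fixes c :: "'a::euclidean_space" and f :: "'a \<Rightarrow> 'b::{banach,second_countable_topology}"
  assumes [measurable]: "f \<in> borel_measurable borel"
  shows "(\<integral>x. f (c + x) \<partial>lborel) = (\<integral>x. f x \<partial>lborel)"
  by (subst (2) lborel_distr_plus[of c, symmetric]) (simp add: integral_distr)

lemma integrable_lborel_shift:
  fixes c :: "'a::euclidean_space" and f :: "'a \<Rightarrow> 'b::{banach,second_countable_topology}"
  assumes "integrable lborel f"
  shows "integrable lborel (\<lambda>x. f (c + x))"
proof -
  have [measurable]: "f \<in> borel_measurable borel" using assms by auto
  show ?thesis
    using assms by (subst (asm) lborel_distr_plus[of c, symmetric]) (simp add: integrable_distr_eq)
qed

lemma nn_integral_lborel_affine:
  fixes a :: "'a::euclidean_space"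
  assumes [measurable]: "f \<in> borel_measurable borel" and c: "c \<noteq> 0"
  shows "(\<integral>\<^sup>+x. f x \<partial>lborel) = ennreal (\<bar>c\<bar> ^ DIM('a)) * (\<integral>\<^sup>+x. f (a + c *\<^sub>R x) \<partial>lborel)"
  by (subst lborel_affine[OF c, of a])
    (simp add: nn_integral_density nn_integral_distr nn_integral_cmult)

lemma integral_lborel_affine:
  fixes a :: "'a::euclidean_space" and f :: "'a \<Rightarrow> 'b::{banach,second_countable_topology}"
  assumes [measurable]: "f \<in> borel_measurable borel" and c: "c \<noteq> 0"
  shows "(\<integral>x. f x \<partial>lborel) = (\<bar>c\<bar> ^ DIM('a)) *\<^sub>R (\<integral>x. f (a + c *\<^sub>R x) \<partial>lborel)"
  by (subst lborel_affine[OF c, of a])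
    (simp add: integral_density integral_distr)

lemma integrable_lborel_affine:
  fixes a :: "'a::euclidean_space" and f :: "'a \<Rightarrow> 'b::{banach,second_countable_topology}"
  assumes f: "integrable lborel f" and c: "c \<noteq> 0"
  shows "integrable lborel (\<lambda>x. f (a + c *\<^sub>R x))"
proof -
  have [measurable]: "f \<in> borel_measurable borel" using f by auto
  have "integrable lborel (\<lambda>x. (\<bar>c\<bar> ^ DIM('a)) *\<^sub>R f (a + c *\<^sub>R x))"
    using f by (subst (asm) lborel_affine[OF c, of a]) (simp add: integrable_density integrable_distr_eq)
  from integrable_scaleR_right[OF this, of "1 / \<bar>c\<bar> ^ DIM('a)"] c show ?thesis
    by simp
qed

text \<open>The usual three-term estimate, with the outer two terms equal by translation invariance.
  The approximant may depend on the tolerance, so open sets and members of a dominated sequence can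
  both serve.\<close>

lemma L1_translation_approx:
  fixes f :: "'a::euclidean_space \<Rightarrow> complex"
  assumes f: "integrable lborel f"
    and approx: "\<And>e. e > 0 \<Longrightarrow> \<exists>g. integrable lborel g
      \<and> (\<lambda>k. \<integral>x. norm (g (h k + x) - g x) \<partial>lborel) \<longlonglongrightarrow> 0 \<and> (\<integral>x. norm (f x - g x) \<partial>lborel) < e"
  shows "(\<lambda>k. \<integral>x. norm (f (h k + x) - f x) \<partial>lborel) \<longlonglongrightarrow> 0"
proof (rule LIMSEQ_I)
  fix e :: real assume e: "e > 0"
  then obtain g where g: "integrable lborel g"
    and lim: "(\<lambda>k. \<integral>x. norm (g (h k + x) - g x) \<partial>lborel) \<longlonglongrightarrow> 0"
    and small: "(\<integral>x. norm (f x - g x) \<partial>lborel) < e / 3"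
    using approx[of "e/3"] by auto
  have [measurable]: "f \<in> borel_measurable borel" "g \<in> borel_measurable borel" using f g by auto
  obtain N where N: "\<And>k. k \<ge> N \<Longrightarrow> (\<integral>x. norm (g (h k + x) - g x) \<partial>lborel) < e / 3"
    using LIMSEQ_D[OF lim, of "e/3"] e by auto
  have "(\<integral>x. norm (f (h k + x) - f x) \<partial>lborel) < e" if "k \<ge> N" for k
  proof -
    have i: "integrable lborel (\<lambda>x. f (h k + x))" "integrable lborel (\<lambda>x. g (h k + x))"
      by (intro integrable_lborel_shift f g)+
    have "(\<integral>x. norm (f (h k + x) - f x) \<partial>lborel)
       \<le> (\<integral>x. norm (f (h k + x) - g (h k + x)) + norm (g (h k + x) - g x) + norm (f x - g x) \<partial>lborel)"
    proof (rule integral_mono)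
      fix x
      have "f (h k + x) - f x = (f (h k + x) - g (h k + x)) + (g (h k + x) - g x) - (f x - g x)" by simp
      then show "norm (f (h k + x) - f x) \<le> norm (f (h k + x) - g (h k + x)) + norm (g (h k + x) - g x) + norm (f x - g x)"
        by (metis norm_triangle_ineq norm_triangle_ineq4 add_right_mono order_trans)
    qed (use i f g in auto)
    also have "\<dots> = (\<integral>x. norm (f (h k + x) - g (h k + x)) \<partial>lborel)
        + (\<integral>x. norm (g (h k + x) - g x) \<partial>lborel) + (\<integral>x. norm (f x - g x) \<partial>lborel)"
      using i f g by simp
    also have "(\<integral>x. norm (f (h k + x) - g (h k + x)) \<partial>lborel) = (\<integral>x. norm (f x - g x) \<partial>lborel)"
      by (rule integral_lborel_shift[where f = "\<lambda>x. norm (f x - g x)"]) measurable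
    finally show ?thesis using N[OF that] small by simp
  qed
  then show "\<exists>no. \<forall>k\<ge>no. norm ((\<integral>x. norm (f (h k + x) - f x) \<partial>lborel) - 0) < e"
    by (intro exI[of _ N]) auto
qed

text \<open>The modulus of a difference of two indicators is their sum minus twice their product. By
  openness the product tends to the indicator of \<open>U\<close> pointwise, and translation
  invariance keeps the integrals of the other terms constant.\<close>

lemma L1_translation_open:
  fixes U :: "'a::euclidean_space set"
  assumes U: "open U" "emeasure lborel U < \<infinity>" and h: "h \<longlonglongrightarrow> 0"
  shows "(\<lambda>k. \<integral>x. norm (indicator U (h k + x) *\<^sub>R (c::complex) - indicator U x *\<^sub>R c) \<partial>lborel) \<longlonglongrightarrow> 0"
proof -
  define I where "I x = (indicator U x :: real)" for x
  have [measurable]: "U \<in> sets borel" using U by simp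
  have Im [measurable]: "I \<in> borel_measurable borel" by (simp add: I_def[abs_def])
  have I: "integrable lborel I" using U by (simp add: I_def[abs_def])
  have Ih: "integrable lborel (\<lambda>x. I (h k + x))" for k by (rule integrable_lborel_shift[OF I])
  have II: "integrable lborel (\<lambda>x. I x * I (h k + x))" for k
    by (rule Bochner_Integration.integrable_bound[OF I]) (auto simp: I_def indicator_def)
  have "(\<lambda>k. \<integral>x. I x * I (h k + x) \<partial>lborel) \<longlonglongrightarrow> (\<integral>x. I x \<partial>lborel)"
  proof (rule integral_dominated_convergence[OF _ _ I])
    show "AE x in lborel. (\<lambda>k. I x * I (h k + x)) \<longlonglongrightarrow> I x"
    proof (rule AE_I2)
      fix x
      show "(\<lambda>k. I x * I (h k + x)) \<longlonglongrightarrow> I x"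
      proof (cases "x \<in> U")
        case True
        have "(\<lambda>k. h k + x) \<longlonglongrightarrow> 0 + x" by (intro tendsto_intros h)
        then have "eventually (\<lambda>k. h k + x \<in> U) sequentially"
          using True U by (simp add: topological_tendstoD)
        then have "eventually (\<lambda>k. I x * I (h k + x) = I x) sequentially"
          by eventually_elim (simp add: I_def)
        then show ?thesis by (rule tendsto_eventually)
      qed (simp add: I_def)
    qed
  qed (auto simp: I_def indicator_def)
  then have "(\<lambda>k. norm c * (2 * (\<integral>x. I x \<partial>lborel) - 2 * (\<integral>x. I x * I (h k + x) \<partial>lborel)))
      \<longlonglongrightarrow> norm c * (2 * (\<integral>x. I x \<partial>lborel) - 2 * (\<integral>x. I x \<partial>lborel))"
    by (intro tendsto_intros)
  moreover have "(\<integral>x. norm (indicator U (h k + x) *\<^sub>R c - indicator U x *\<^sub>R c) \<partial>lborel)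
     = norm c * (2 * (\<integral>x. I x \<partial>lborel) - 2 * (\<integral>x. I x * I (h k + x) \<partial>lborel))" for k
  proof -
    have "norm (indicator U (h k + x) *\<^sub>R c - indicator U x *\<^sub>R c)
        = norm c * (I (h k + x) + I x - 2 * (I x * I (h k + x)))" for x
      by (auto simp: I_def indicator_def)
    then have "(\<integral>x. norm (indicator U (h k + x) *\<^sub>R c - indicator U x *\<^sub>R c) \<partial>lborel)
      = norm c * ((\<integral>x. I (h k + x) \<partial>lborel) + (\<integral>x. I x \<partial>lborel) - 2 * (\<integral>x. I x * I (h k + x) \<partial>lborel))"
      using I Ih II by simp
    also have "(\<integral>x. I (h k + x) \<partial>lborel) = (\<integral>x. I x \<partial>lborel)"
      by (rule integral_lborel_shift[OF Im])
    finally show ?thesis by simp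
  qed
  ultimately show ?thesis by simp
qed

text \<open>Induction over integrable functions. The base case passes from a Borel set to an open
  superset of nearly the same measure, because shifted indicators of a general set need not converge
  pointwise.\<close>

lemma L1_translation:
  fixes f :: "'a::euclidean_space \<Rightarrow> complex"
  assumes f: "integrable lborel f" and h: "h \<longlonglongrightarrow> 0"
  shows "(\<lambda>k. \<integral>x. norm (f (h k + x) - f x) \<partial>lborel) \<longlonglongrightarrow> 0"
  using f
proof (induction rule: integrable_induct)
  case (base A c)
  have A [measurable]: "A \<in> sets borel" and fin: "emeasure lborel A < \<infinity>" using base by auto
  have ind: "integrable lborel (\<lambda>x. indicator B x *\<^sub>R c)" if "B \<in> sets borel" "emeasure lborel B < \<infinity>"
    for B :: "'a set"
    using that by (intro integrable_scaleR_left) simp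
  show ?case
  proof (rule L1_translation_approx)
    fix e :: real assume e: "e > 0"
    \<comment> \<open>Adding 1 to the norm keeps the quotient meaningful when
      \<open>c = 0\<close>.\<close>
    define e' where "e' = e / (norm c + 1)"
    have e': "e' > 0" using e by (auto simp: e'_def intro!: divide_pos_pos add_nonneg_pos)
    obtain U where U: "open U" "A \<subseteq> U" "emeasure lborel (U - A) < e'"
      using outer_regular_lborel[OF A e'] by blast
    have Um [measurable]: "U \<in> sets borel" using U by simp
    have "emeasure lborel U = emeasure lborel A + emeasure lborel (U - A)"
      using U by (subst plus_emeasure) (auto intro!: arg_cong2[where f = emeasure])
    also have "\<dots> < \<infinity>" using fin U(3) by (auto simp: less_top[symmetric] top_unique)
    finally have Uf: "emeasure lborel U < \<infinity>" .
    have "(\<integral>x. norm (indicator A x *\<^sub>R c - indicator U x *\<^sub>R c) \<partial>lborel) = (\<integral>x. indicator (U - A) x * norm c \<partial>lborel)"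
      using U by (intro Bochner_Integration.integral_cong) (auto simp: indicator_def)
    also have "\<dots> = measure lborel (U - A) * norm c"
      by simp
    also have "\<dots> \<le> e' * norm c"
      using U(3) e' by (intro mult_right_mono) (auto simp: measure_def enn2real_leI)
    also have "\<dots> < e" using e add_nonneg_pos[of "norm c" 1] by (simp add: e'_def divide_less_eq)
    finally have "(\<integral>x. norm (indicator A x *\<^sub>R c - indicator U x *\<^sub>R c) \<partial>lborel) < e" .
    then show "\<exists>g. integrable lborel g \<and> (\<lambda>k. \<integral>x. norm (g (h k + x) - g x) \<partial>lborel) \<longlonglongrightarrow> 0
        \<and> (\<integral>x. norm (indicator A x *\<^sub>R c - g x) \<partial>lborel) < e"
      using L1_translation_open[OF U(1) Uf h, of c] ind[OF Um Uf]
      by (intro exI[of _ "\<lambda>x. indicator U x *\<^sub>R c"]) auto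
  qed (rule ind[OF A fin])
next
  case (add f g)
  have i: "integrable lborel (\<lambda>x. f (h k + x))" "integrable lborel (\<lambda>x. g (h k + x))" for k
    by (intro integrable_lborel_shift add)+
  have "(\<lambda>k. (\<integral>x. norm (f (h k + x) - f x) \<partial>lborel) + (\<integral>x. norm (g (h k + x) - g x) \<partial>lborel)) \<longlonglongrightarrow> 0 + 0"
    by (intro tendsto_intros add)
  then have "(\<lambda>k. (\<integral>x. norm (f (h k + x) - f x) \<partial>lborel) + (\<integral>x. norm (g (h k + x) - g x) \<partial>lborel)) \<longlonglongrightarrow> 0"
    by simp
  then show ?case
  proof (rule tendsto_zero_bound[rotated 2])
    fix k
    have "(\<integral>x. norm ((f (h k + x) + g (h k + x)) - (f x + g x)) \<partial>lborel)
      \<le> (\<integral>x. norm (f (h k + x) - f x) + norm (g (h k + x) - g x) \<partial>lborel)"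
      using i add.hyps by (intro integral_mono) (auto simp: norm_diff_triangle_ineq)
    then show "(\<integral>x. norm ((f (h k + x) + g (h k + x)) - (f x + g x)) \<partial>lborel)
      \<le> (\<integral>x. norm (f (h k + x) - f x) \<partial>lborel) + (\<integral>x. norm (g (h k + x) - g x) \<partial>lborel)"
      using i add.hyps by simp
  qed simp
next
  case (lim f s)
  show ?case
  proof (rule L1_translation_approx[OF lim.hyps(4)])
    fix e :: real assume e: "e > 0"
    have [measurable]: "f \<in> borel_measurable borel" "s i \<in> borel_measurable borel" for i
      using lim.hyps(4) lim.hyps(1)[of i] by auto
    have "(\<lambda>i. \<integral>x. norm (f x - s i x) \<partial>lborel) \<longlonglongrightarrow> (\<integral>x. 0 \<partial>(lborel :: 'a measure))"
    proof (rule integral_dominated_convergence)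
      show "integrable lborel (\<lambda>x. 3 * norm (f x))" using lim.hyps(4) by auto
      show "AE x in lborel. (\<lambda>i. norm (f x - s i x)) \<longlonglongrightarrow> 0"
      proof (rule AE_I2)
        fix x :: 'a
        have "(\<lambda>i. norm (f x - s i x)) \<longlonglongrightarrow> norm (f x - f x)"
          using lim.hyps(2)[of x] by (intro tendsto_intros) auto
        then show "(\<lambda>i. norm (f x - s i x)) \<longlonglongrightarrow> 0" by simp
      qed
      show "AE x in lborel. norm (norm (f x - s i x)) \<le> 3 * norm (f x)" for i
      proof (rule AE_I2)
        fix x :: 'a
        show "norm (norm (f x - s i x)) \<le> 3 * norm (f x)"
          using norm_triangle_ineq4[of "f x" "s i x"] lim.hyps(3)[of x i] by simp
      qed
    qed auto
    then have "(\<lambda>i. \<integral>x. norm (f x - s i x) \<partial>lborel) \<longlonglongrightarrow> 0" by simp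
    from LIMSEQ_D[OF this e] obtain i where "(\<integral>x. norm (f x - s i x) \<partial>lborel) < e" by auto
    then show "\<exists>g. integrable lborel g \<and> (\<lambda>k. \<integral>x. norm (g (h k + x) - g x) \<partial>lborel) \<longlonglongrightarrow> 0
        \<and> (\<integral>x. norm (f x - g x) \<partial>lborel) < e"
      using lim.hyps(1) lim.IH by blast
  qed
qed

text \<open>The map taking \<open>a\<close> to \<open>cmod a * a\<close> carries L2 functions to L1
  functions (the Mazur map), and by this bound L1 closeness of the images gives L2 closeness of the
  originals. Thus L2 continuity of translations follows from the L1 case without a second density
  argument.\<close>

lemma mazur_map_bound: "(cmod (a - b))\<^sup>2 \<le> 2 * cmod (of_real (cmod a) * a - of_real (cmod b) * b)"
proof -
  define s m R where "s = (cmod a)\<^sup>2 + (cmod b)\<^sup>2" and "m = cmod a * cmod b" and "R = Re (a * cnj b)"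
  have m: "0 \<le> m" "2 * m \<le> s"
    using sum_squares_bound[of "cmod a" "cmod b"] by (auto simp: s_def m_def)
  have R: "- m \<le> R" "R \<le> m"
    using abs_Re_le_cmod[of "a * cnj b"] by (auto simp: R_def m_def norm_mult)
  have e1: "(cmod (a - b))\<^sup>2 = s - 2 * R"
    unfolding cmod_power2 s_def R_def by (simp add: power2_eq_square algebra_simps)
  have e2: "(cmod (of_real (cmod a) * a - of_real (cmod b) * b))\<^sup>2 = s\<^sup>2 - 2 * m\<^sup>2 - 2 * m * R"
  proof -
    have "(cmod (of_real (cmod a) * a - of_real (cmod b) * b))\<^sup>2
        = (cmod a)\<^sup>2 * ((Re a)\<^sup>2 + (Im a)\<^sup>2) + (cmod b)\<^sup>2 * ((Re b)\<^sup>2 + (Im b)\<^sup>2) - 2 * m * R"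
      by (subst cmod_power2) (simp add: m_def R_def power2_eq_square algebra_simps)
    then show ?thesis
      unfolding cmod_power2[of a, symmetric] cmod_power2[of b, symmetric]
      by (simp add: s_def m_def power2_eq_square algebra_simps)
  qed
  \<comment> \<open>After squaring, a polynomial inequality in \<open>s\<close>, \<open>m\<close>
    and \<open>R\<close> on the region \<open>0 \<le> 2 * m \<le> s\<close>,
    \<open>\<bar>R\<bar> \<le> m\<close>; the six products below are the nonnegative quantities from
    which it is assembled.\<close>
  have "(s - 2 * R)\<^sup>2 \<le> 4 * (s\<^sup>2 - 2 * m\<^sup>2 - 2 * m * R)"
  proof -
    have "0 \<le> (m - R) * (m + R)" using R by (intro mult_nonneg_nonneg) auto
    moreover have "0 \<le> (s - 2 * m) * (s + 2 * m)" using m by (intro mult_nonneg_nonneg) auto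
    moreover have "0 \<le> (s - 2 * m) * (m + R)" using m R by (intro mult_nonneg_nonneg) auto
    moreover have "0 \<le> (s - 2 * m) * s" using m by (intro mult_nonneg_nonneg) auto
    moreover have "0 \<le> (s - 2 * m) * (s - 2 * m)" by simp
    moreover have "0 \<le> (s - 2 * m) * (m - R)" using m R by (intro mult_nonneg_nonneg) auto
    ultimately show ?thesis by (simp add: power2_eq_square algebra_simps)
  qed
  then have "((cmod (a - b))\<^sup>2)\<^sup>2 \<le> (2 * cmod (of_real (cmod a) * a - of_real (cmod b) * b))\<^sup>2"
    by (simp only: e1 power_mult_distrib e2) simp
  then show ?thesis
    by (rule power2_le_imp_le) simp
qed

lemma l2_translation:
  fixes g :: "'a::euclidean_space \<Rightarrow> complex"
  assumes g: "sq_integrable lborel g" and h: "h \<longlonglongrightarrow> 0"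
  shows "(\<lambda>k. l2_normsq lborel (\<lambda>x. g (h k + x) - g x)) \<longlonglongrightarrow> 0"
proof -
  have [measurable]: "g \<in> borel_measurable borel" using g by (auto simp: sq_integrable_def)
  define F where "F x = of_real (cmod (g x)) * g x" for x
  have F: "integrable lborel F"
  proof -
    have "integrable lborel (\<lambda>x. norm (F x))"
      using g by (simp add: F_def norm_mult sq_integrable_def power2_eq_square)
    then show ?thesis
      by (subst (asm) integrable_norm_iff) (auto simp: F_def[abs_def])
  qed
  have "(\<lambda>k. 2 * (\<integral>x. norm (F (h k + x) - F x) \<partial>lborel)) \<longlonglongrightarrow> 2 * 0"
    by (intro tendsto_mult tendsto_const L1_translation F h)
  then have "(\<lambda>k. 2 * (\<integral>x. norm (F (h k + x) - F x) \<partial>lborel)) \<longlonglongrightarrow> 0"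
    by simp
  then show ?thesis
  proof (rule tendsto_zero_bound[rotated 2])
    fix k
    have i: "integrable lborel (\<lambda>x. F (h k + x))" by (rule integrable_lborel_shift[OF F])
    have "l2_normsq lborel (\<lambda>x. g (h k + x) - g x) \<le> (\<integral>x. 2 * norm (F (h k + x) - F x) \<partial>lborel)"
      unfolding l2_normsq_def
    proof (rule integral_mono_AE')
      show "AE x in lborel. (cmod (g (h k + x) - g x))\<^sup>2 \<le> 2 * norm (F (h k + x) - F x)"
        unfolding F_def by (intro AE_I2 mazur_map_bound)
    qed (use i F in auto)
    then show "l2_normsq lborel (\<lambda>x. g (h k + x) - g x) \<le> 2 * (\<integral>x. norm (F (h k + x) - F x) \<partial>lborel)"
      by simp
  qed simp
qed

subsection \<open>Gaussian integrals and the Plancherel theorem\<close>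

lemma
  fixes f :: "'a::euclidean_space \<Rightarrow> real \<Rightarrow> complex"
  assumes f: "\<And>b. b \<in> Basis \<Longrightarrow> integrable lborel (f b)"
  shows integral_lborel_prod: "(\<integral>x. (\<Prod>b\<in>Basis. f b (x \<bullet> b)) \<partial>lborel) = (\<Prod>b\<in>Basis. \<integral>x. f b x \<partial>lborel)"
    and integrable_lborel_prod: "integrable lborel (\<lambda>x. \<Prod>b\<in>Basis. f b (x \<bullet> b))"
proof -
  interpret product_sigma_finite "\<lambda>_::'a. lborel :: real measure" ..
  have m [measurable]: "b \<in> Basis \<Longrightarrow> f b \<in> borel_measurable borel" for b using f[of b] by auto
  have m': "(\<lambda>x. \<Prod>b\<in>Basis. f b (x \<bullet> b)) \<in> borel_measurable borel" by measurable
  have e: "(\<Prod>b\<in>Basis. f b ((\<Sum>i\<in>Basis. x i *\<^sub>R i) \<bullet> b)) = (\<Prod>b\<in>Basis. f b (x b))" for x :: "'a \<Rightarrow> real"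
    by (intro prod.cong) (auto simp: inner_sum_left inner_Basis if_distrib cong: if_cong)
  have T: "(\<lambda>x. \<Sum>b\<in>Basis. x b *\<^sub>R b) \<in> (\<Pi>\<^sub>M b\<in>Basis. lborel) \<rightarrow>\<^sub>M (borel :: 'a measure)"
    by measurable
  show "(\<integral>x. (\<Prod>b\<in>Basis. f b (x \<bullet> b)) \<partial>lborel) = (\<Prod>b\<in>Basis. \<integral>x. f b x \<partial>lborel)"
    by (subst (1) lborel_eq, subst integral_distr[OF T m'], subst e, rule product_integral_prod) (auto simp: f)
  show "integrable lborel (\<lambda>x. \<Prod>b\<in>Basis. f b (x \<bullet> b))"
    by (subst (1) lborel_eq, subst integrable_distr_eq[OF T m'], subst e, rule product_integrable_prod) (auto simp: f)
qed

lemma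
  fixes \<alpha> :: real and z :: complex
  assumes \<alpha>: "\<alpha> > 0"
  shows gaussian_integrable_real: "integrable lborel (\<lambda>x::real. exp (of_real x * z - of_real (\<alpha> * x\<^sup>2)))" (is ?A)
    and gaussian_integral_real: "(\<integral>x. exp (of_real x * z - of_real (\<alpha> * x\<^sup>2)) \<partial>lborel)
      = of_real (sqrt (pi / \<alpha>)) * exp (z\<^sup>2 / of_real (4 * \<alpha>))" (is ?B)
proof -
  define r s where "r = Re z" and "s = Im z"
  have z: "z = of_real r + \<i> * of_real s" by (simp add: r_def s_def complex_eq)
  \<comment> \<open>\<open>a\<close> completes the square in the real part of the exponent and
    \<open>c\<close> rescales to unit variance; what remains is the characteristic function of the
    standard normal law.\<close>
  define c a where "c = 1 / sqrt (2 * \<alpha>)" and "a = r / (2 * \<alpha>)"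
  have c: "c > 0" "c\<^sup>2 = 1 / (2 * \<alpha>)" using \<alpha> by (auto simp: c_def power_divide)
  define f where "f x = exp (of_real x * z - of_real (\<alpha> * x\<^sup>2))" for x :: real
  define K where "K = exp (of_real (r\<^sup>2 / (4 * \<alpha>)) + \<i> * of_real (s * a)) * of_real (sqrt (2 * pi))"
  define g where "g y = K * (of_real (std_normal_density y) * iexp (s * c * y))" for y :: real
  have fg: "f (a + c * y) = g y" for y
  proof -
    have "\<alpha> * (a + c * y)\<^sup>2 = \<alpha> * a\<^sup>2 + 2 * \<alpha> * a * c * y + \<alpha> * c\<^sup>2 * y\<^sup>2"
      by (simp add: power2_eq_square algebra_simps)
    also have "\<dots> = \<alpha> * a\<^sup>2 + r * c * y + y\<^sup>2 / 2" using \<alpha> c by (simp add: a_def field_simps)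
    also have "\<alpha> * a\<^sup>2 = r * a - r\<^sup>2 / (4 * \<alpha>)" using \<alpha> by (simp add: a_def field_simps power2_eq_square)
    finally have "of_real (a + c * y) * z - of_real (\<alpha> * (a + c * y)\<^sup>2)
      = (of_real (r\<^sup>2 / (4 * \<alpha>)) + \<i> * of_real (s * a)) + of_real (- y\<^sup>2 / 2) + \<i> * of_real (s * c * y)"
      by (simp add: z complex_eq_iff algebra_simps)
    then have "f (a + c * y) = exp (of_real (r\<^sup>2 / (4 * \<alpha>)) + \<i> * of_real (s * a))
        * (exp (of_real (- y\<^sup>2 / 2)) * iexp (s * c * y))"
      unfolding f_def by (simp only: exp_add mult.assoc)
    also have "exp (of_real (- y\<^sup>2 / 2)) = of_real (sqrt (2 * pi)) * (of_real (std_normal_density y) :: complex)"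
      by (simp add: std_normal_density_def exp_of_real[symmetric])
    finally show ?thesis by (simp add: g_def K_def mult_ac)
  qed
  have n: "integrable lborel (\<lambda>y. of_real (std_normal_density y) * iexp (s * c * y))"
  proof (rule Bochner_Integration.integrable_bound)
    show "integrable lborel (\<lambda>y. std_normal_density y)" by simp
  qed (auto simp: norm_mult)
  then have "integrable lborel g" unfolding g_def[abs_def] by (intro integrable_mult_right)
  then have gi: "integrable lborel (\<lambda>y. f (a + c * y))" by (simp add: fg)
  have fm: "f \<in> borel_measurable borel" unfolding f_def[abs_def] by measurable
  show ?A
    using gi lborel_integrable_real_affine_iff[of c f a] c unfolding f_def by simp
  have "(\<integral>x. f x \<partial>lborel) = c *\<^sub>R (\<integral>y. g y \<partial>lborel)"
    using lborel_integral_real_affine[of c f a] c by (simp add: fg)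
  also have "(\<integral>y. g y \<partial>lborel) = K * (\<integral>y. of_real (std_normal_density y) * iexp (s * c * y) \<partial>lborel)"
    unfolding g_def by simp
  also have "(\<integral>y. of_real (std_normal_density y) * iexp (s * c * y) \<partial>lborel) = char std_normal_distribution (s * c)"
    unfolding char_def by (subst integral_density) (auto simp: scaleR_conv_of_real)
  also have "\<dots> = of_real (exp (- (s\<^sup>2 / (4 * \<alpha>))))"
    by (simp add: char_std_normal_distribution power_mult_distrib c)
  finally have "(\<integral>x. f x \<partial>lborel) = of_real (c * sqrt (2 * pi)) *
      (exp (of_real (r\<^sup>2 / (4 * \<alpha>)) + \<i> * of_real (s * a)) * exp (of_real (- (s\<^sup>2 / (4 * \<alpha>)))))"
    by (simp only: K_def scaleR_conv_of_real exp_of_real of_real_mult mult_ac)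
  also have "exp (of_real (r\<^sup>2 / (4 * \<alpha>)) + \<i> * of_real (s * a)) * exp (of_real (- (s\<^sup>2 / (4 * \<alpha>)))) = exp (z\<^sup>2 / of_real (4 * \<alpha>))"
  proof -
    have "of_real (r\<^sup>2 / (4 * \<alpha>)) + \<i> * of_real (s * a) + of_real (- (s\<^sup>2 / (4 * \<alpha>))) = z\<^sup>2 / of_real (4 * \<alpha>)"
      using \<alpha> by (simp add: complex_eq_iff z a_def power2_eq_square Re_divide_of_real Im_divide_of_real del: of_real_mult)
        (simp add: field_simps)
    then show ?thesis by (simp only: exp_add[symmetric])
  qed
  also have "c * sqrt (2 * pi) = sqrt (pi / \<alpha>)"
    using \<alpha> by (simp add: c_def real_sqrt_divide[symmetric] real_sqrt_mult[symmetric])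
  finally show ?B unfolding f_def .
qed

text \<open>The pair \<open>(\<xi>, \<eta>)\<close> stands for the point \<open>\<xi> + i\<eta>\<close> of the complexification.\<close>

definition cinner :: "'a::euclidean_space \<Rightarrow> 'a \<times> 'a \<Rightarrow> complex" where
  "cinner q \<zeta> = Complex (q \<bullet> fst \<zeta>) (q \<bullet> snd \<zeta>)"

text \<open>The integrand factors over the coordinates into one-variable Gaussians with a complex
  linear term. The exponent on the right is the bilinear square of \<xi> + i\<eta>, later called
  \<open>csq\<close>, divided by \<open>4 * \<alpha>\<close>.\<close>

lemma
  fixes \<alpha> :: real and \<zeta> :: "'a::euclidean_space \<times> 'a"
  assumes \<alpha>: "\<alpha> > 0"
  shows gaussian_integrable: "integrable lborel (\<lambda>q. exp (cinner q \<zeta> - of_real (\<alpha> * (norm q)\<^sup>2)))" (is ?A)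
    and gaussian_integral: "(\<integral>q. exp (cinner q \<zeta> - of_real (\<alpha> * (norm q)\<^sup>2)) \<partial>lborel)
      = of_real (sqrt (pi / \<alpha>) ^ DIM('a))
        * exp (Complex ((norm (fst \<zeta>))\<^sup>2 - (norm (snd \<zeta>))\<^sup>2) (2 * (fst \<zeta> \<bullet> snd \<zeta>)) / of_real (4 * \<alpha>))" (is ?B)
proof -
  define Z where "Z b = Complex (fst \<zeta> \<bullet> b) (snd \<zeta> \<bullet> b)" for b
  define f where "f b x = exp (of_real x * Z b - of_real (\<alpha> * x\<^sup>2))" for b and x :: real
  have f: "integrable lborel (f b)" for b unfolding f_def by (rule gaussian_integrable_real[OF \<alpha>])
  have e: "exp (cinner q \<zeta> - of_real (\<alpha> * (norm q)\<^sup>2)) = (\<Prod>b\<in>Basis. f b (q \<bullet> b))" for q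
  proof -
    have "cinner q \<zeta> - of_real (\<alpha> * (norm q)\<^sup>2) = (\<Sum>b\<in>Basis. of_real (q \<bullet> b) * Z b - of_real (\<alpha> * (q \<bullet> b)\<^sup>2))"
      unfolding cinner_def Z_def power2_norm_eq_inner
      by (simp add: complex_eq_iff sum_subtractf sum_distrib_left power2_eq_square
          euclidean_inner[of q q] euclidean_inner[of q "fst \<zeta>"] euclidean_inner[of q "snd \<zeta>"])
    then show ?thesis unfolding f_def by (simp add: exp_sum)
  qed
  show ?A unfolding e by (rule integrable_lborel_prod[OF f])
  have "(\<integral>q. exp (cinner q \<zeta> - of_real (\<alpha> * (norm q)\<^sup>2)) \<partial>lborel) = (\<Prod>b\<in>(Basis::'a set). \<integral>x. f b x \<partial>lborel)"
    unfolding e by (rule integral_lborel_prod[OF f])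
  also have "\<dots> = (\<Prod>b\<in>(Basis::'a set). of_real (sqrt (pi / \<alpha>)) * exp ((Z b)\<^sup>2 / of_real (4 * \<alpha>)))"
    unfolding f_def gaussian_integral_real[OF \<alpha>] ..
  also have "\<dots> = of_real (sqrt (pi / \<alpha>) ^ DIM('a)) * exp ((\<Sum>b\<in>(Basis::'a set). (Z b)\<^sup>2) / of_real (4 * \<alpha>))"
    by (simp add: prod.distrib exp_sum sum_divide_distrib)
  also have "(\<Sum>b\<in>Basis. (Z b)\<^sup>2) = Complex ((norm (fst \<zeta>))\<^sup>2 - (norm (snd \<zeta>))\<^sup>2) (2 * (fst \<zeta> \<bullet> snd \<zeta>))"
    unfolding Z_def power2_norm_eq_inner
    by (simp add: complex_eq_iff sum_subtractf sum_distrib_left power2_eq_square sum.distrib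
          euclidean_inner[of "fst \<zeta>" "fst \<zeta>"] euclidean_inner[of "snd \<zeta>" "snd \<zeta>"] euclidean_inner[of "fst \<zeta>" "snd \<zeta>"])
  finally show ?B .
qed

lemma
  fixes \<alpha> :: real
  assumes \<alpha>: "\<alpha> > 0"
  shows gaussian_abs_integrable: "integrable lborel (\<lambda>q::'a::euclidean_space. exp (q \<bullet> \<xi> - \<alpha> * (norm q)\<^sup>2))" (is ?A)
    and gaussian_abs_integral: "(\<integral>q. exp (q \<bullet> \<xi> - \<alpha> * (norm q)\<^sup>2) \<partial>(lborel :: 'a measure))
        = sqrt (pi / \<alpha>) ^ DIM('a) * exp ((norm \<xi>)\<^sup>2 / (4 * \<alpha>))" (is ?B)
proof -
  have e: "exp (cinner q (\<xi>, 0) - of_real (\<alpha> * (norm q)\<^sup>2)) = of_real (exp (q \<bullet> \<xi> - \<alpha> * (norm q)\<^sup>2))" for q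
    by (simp add: cinner_def exp_of_real[symmetric] Complex_eq)
  show ?A
    using gaussian_integrable[OF \<alpha>, of "(\<xi>, 0)"] unfolding e by (simp add: complex_of_real_integrable_eq)
  have "of_real (\<integral>q. exp (q \<bullet> \<xi> - \<alpha> * (norm q)\<^sup>2) \<partial>lborel)
      = (of_real (sqrt (pi / \<alpha>) ^ DIM('a) * exp ((norm \<xi>)\<^sup>2 / (4 * \<alpha>))) :: complex)"
  proof -
    have "Complex ((norm \<xi>)\<^sup>2 - (norm (0::'a))\<^sup>2) (2 * (\<xi> \<bullet> 0)) / of_real (4 * \<alpha>) = of_real ((norm \<xi>)\<^sup>2 / (4 * \<alpha>))"
      by (simp add: Complex_eq)
    then show ?thesis
      using gaussian_integral[OF \<alpha>, of "(\<xi>, 0)"]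
      unfolding e integral_complex_of_real fst_conv snd_conv by (simp only: exp_of_real of_real_mult)
  qed
  then show ?B by (simp only: of_real_eq_iff)
qed

text \<open>Positive sign and no normalizing factor, which makes it the restriction of a Laplace
  transform to imaginary arguments; the price is the factor \<open>(2 * pi) ^ DIM('a)\<close> in
  Plancherel's identity.\<close>

definition fourier :: "('a::euclidean_space \<Rightarrow> complex) \<Rightarrow> 'a \<Rightarrow> complex" where
  "fourier g \<eta> = (\<integral>q. g q * cis (q \<bullet> \<eta>) \<partial>lborel)"

lemma borel_measurable_cis [measurable (raw)]:
  assumes "f \<in> borel_measurable M"
  shows "(\<lambda>x. cis (f x)) \<in> borel_measurable M"
  using measurable_compose[OF assms borel_measurable_continuous_onI[of cis]]
  by (simp add: continuous_on_cis)

lemma borel_measurable_fourier [measurable]: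
  fixes g :: "'a::euclidean_space \<Rightarrow> complex"
  assumes [measurable]: "g \<in> borel_measurable borel"
  shows "fourier g \<in> borel_measurable borel"
  unfolding fourier_def[abs_def] by measurable

lemma fubini_bounded_kernel:
  fixes a :: "'a::euclidean_space \<Rightarrow> complex" and b :: "'b::euclidean_space \<Rightarrow> complex"
  assumes a: "integrable lborel a" and b: "integrable lborel b"
    and k [measurable]: "(\<lambda>(x, y). k x y) \<in> borel_measurable (lborel \<Otimes>\<^sub>M lborel)"
    and kb: "\<And>x y. cmod (k x y) \<le> 1"
  shows "(\<integral>x. a x * (\<integral>y. b y * k x y \<partial>lborel) \<partial>lborel) = (\<integral>y. b y * (\<integral>x. a x * k x y \<partial>lborel) \<partial>lborel)"
proof -
  have [measurable]: "a \<in> borel_measurable borel" "b \<in> borel_measurable borel" using a b by auto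
  have "integrable (lborel \<Otimes>\<^sub>M lborel) (\<lambda>(x, y). a x * (b y * k x y))"
  proof (rule lborel_pair.Fubini_integrable)
    have bk: "integrable lborel (\<lambda>y. b y * k x y)" for x
      using kb by (intro Bochner_Integration.integrable_bound[OF b])
        (auto simp: norm_mult intro!: mult_left_le)
    show "AE x in lborel. integrable lborel (\<lambda>y. case (x, y) of (x, y) \<Rightarrow> a x * (b y * k x y))"
      using bk by auto
    show "integrable lborel (\<lambda>x. \<integral>y. norm (case (x, y) of (x, y) \<Rightarrow> a x * (b y * k x y)) \<partial>lborel)"
    proof (rule Bochner_Integration.integrable_bound)
      show "integrable lborel (\<lambda>x. norm (a x) * (\<integral>y. norm (b y) \<partial>lborel))" using a by auto
      have "(\<integral>y. norm (b y * k x y) \<partial>lborel) \<le> (\<integral>y. norm (b y) \<partial>lborel)" for x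
        by (intro integral_mono integrable_norm bk b) (simp add: norm_mult mult_left_le kb)
      then show "AE x in lborel. norm (\<integral>y. norm (case (x, y) of (x, y) \<Rightarrow> a x * (b y * k x y)) \<partial>lborel)
          \<le> norm (norm (a x) * (\<integral>y. norm (b y) \<partial>lborel))"
        by (auto simp: norm_mult[of "a _"] intro!: mult_left_mono)
    qed measurable
  qed measurable
  from lborel_pair.Fubini_integral[OF this]
  have "(\<integral>y. (\<integral>x. a x * (b y * k x y) \<partial>lborel) \<partial>lborel) = (\<integral>x. a x * (\<integral>y. b y * k x y \<partial>lborel) \<partial>lborel)"
    by simp
  moreover have "(\<integral>x. a x * (b y * k x y) \<partial>lborel) = b y * (\<integral>x. a x * k x y \<partial>lborel)" for y
    by (subst integral_mult_right_zero[symmetric]) (simp add: mult_ac)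
  ultimately show ?thesis by simp
qed

text \<open>Gaussian regularization. Against a wide Gaussian, the integral of
  \<open>(cmod (fourier g \<eta>))\<^sup>2\<close> becomes an average of the autocorrelation
  \<open>B\<close> near 0, which tends to \<open>B 0\<close> by L2 continuity of translations. The
  left side converges monotonically, so its finiteness comes out as a result.\<close>

lemma plancherel:
  fixes g :: "'a::euclidean_space \<Rightarrow> complex"
  assumes g: "integrable lborel g" and g2: "sq_integrable lborel g"
  shows "(\<integral>\<^sup>+\<eta>. ennreal ((cmod (fourier g \<eta>))\<^sup>2) \<partial>lborel) = ennreal ((2 * pi) ^ DIM('a) * l2_normsq lborel g)"
proof -
  have gm [measurable]: "g \<in> borel_measurable borel" using g by auto
  define B where "B h = (\<integral>q. g (h + q) * cnj (g q) \<partial>lborel)" for h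
  have Bm [measurable]: "B \<in> borel_measurable borel" unfolding B_def[abs_def] by measurable
  have gh: "sq_integrable lborel (\<lambda>q. g (h + q))" for h
    using g2 integrable_lborel_shift[of "\<lambda>x. (cmod (g x))\<^sup>2" h] by (auto simp: sq_integrable_def)
  have gh_norm: "l2_normsq lborel (\<lambda>q. g (h + q)) = l2_normsq lborel g" for h
    unfolding l2_normsq_def by (rule integral_lborel_shift[where f = "\<lambda>x. (cmod (g x))\<^sup>2"]) measurable
  have B_ip: "B h = l2_inner lborel (\<lambda>q. g (h + q)) g" for h
    by (simp add: B_def l2_inner_def)
  have Bb: "cmod (B h) \<le> l2_normsq lborel g" for h
    using l2_cauchy_schwarz[OF gh g2, of h] unfolding B_ip gh_norm power2_eq_square[symmetric]
    by (rule power2_le_imp_le) simp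
  have B0: "B 0 = of_real (l2_normsq lborel g)"
    unfolding B_def l2_normsq_def add_0 complex_norm_square[symmetric] by (rule integral_complex_of_real)
  have B_cont: "(\<lambda>k. B (h k)) \<longlonglongrightarrow> B 0" if h: "h \<longlonglongrightarrow> 0" for h :: "nat \<Rightarrow> 'a"
    unfolding B_ip by (intro l2_inner_tendsto gh g2) (use l2_translation[OF g2 h] in simp_all)
  have fb: "cmod (fourier g \<eta>) \<le> (\<integral>q. norm (g q) \<partial>lborel)" for \<eta>
    unfolding fourier_def by (rule order_trans[OF integral_norm_bound]) (simp add: norm_mult)
  \<comment> \<open>The regularizing family: it increases to 1 as \<open>\<epsilon>\<close>
    decreases to 0, and up to a constant its Fourier transform is the member with parameter
    \<open>1 / \<epsilon>\<close>.\<close>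
  define w where "w \<epsilon> \<eta> = exp (- (\<epsilon> / 2 * (norm \<eta>)\<^sup>2))" for \<epsilon> :: real and \<eta> :: 'a
  have wi: "integrable lborel (w \<epsilon>)" if "\<epsilon> > 0" for \<epsilon>
    using gaussian_abs_integrable[of "\<epsilon>/2" "0::'a"] that by (simp add: w_def[abs_def])
  have w_hat: "(\<integral>\<eta>. of_real (w \<epsilon> \<eta>) * cis (h \<bullet> \<eta>) \<partial>lborel) = of_real (sqrt (2 * pi / \<epsilon>) ^ DIM('a) * w (1 / \<epsilon>) h)"
    if e: "\<epsilon> > 0" for \<epsilon> h
  proof -
    have "exp (cinner q (0, h) - of_real (\<epsilon> / 2 * (norm q)\<^sup>2)) = of_real (w \<epsilon> q) * cis (h \<bullet> q)" for q
    proof -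
      have "cinner q (0, h) - of_real (\<epsilon> / 2 * (norm q)\<^sup>2) = of_real (- (\<epsilon> / 2 * (norm q)\<^sup>2)) + \<i> * of_real (h \<bullet> q)"
        by (simp add: cinner_def complex_eq_iff inner_commute)
      then show ?thesis by (simp only: w_def exp_of_real[symmetric] cis_conv_exp exp_add)
    qed
    moreover have "Complex ((norm (0::'a))\<^sup>2 - (norm h)\<^sup>2) (2 * (0 \<bullet> h)) / of_real (4 * (\<epsilon> / 2)) = of_real (- (1 / \<epsilon> / 2 * (norm h)\<^sup>2))"
      by (simp add: Complex_eq)
    moreover have "pi / (\<epsilon> / 2) = 2 * pi / \<epsilon>" by simp
    ultimately show ?thesis
      using gaussian_integral[of "\<epsilon>/2" "(0, h)"] e unfolding fst_conv snd_conv
      by (simp only: w_def exp_of_real of_real_mult half_gt_zero)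
  qed
  have reg: "(\<integral>\<eta>. (cmod (fourier g \<eta>))\<^sup>2 * w \<epsilon> \<eta> \<partial>lborel)
      = Re (of_real (sqrt (2 * pi) ^ DIM('a)) * (\<integral>s. B (sqrt \<epsilon> *\<^sub>R s) * of_real (w 1 s) \<partial>lborel))"
    (is "?L = Re ?R") if e: "\<epsilon> > 0" for \<epsilon>
  proof -
    let ?c = "sqrt (2 * pi / \<epsilon>) ^ DIM('a)"
    have wc: "integrable lborel (\<lambda>\<eta>. complex_of_real (w \<epsilon> \<eta>))" using wi[OF e] by simp
    have fw: "integrable lborel (\<lambda>\<eta>. of_real (w \<epsilon> \<eta>) * fourier g \<eta>)"
    proof (rule Bochner_Integration.integrable_bound)
      show "integrable lborel (\<lambda>\<eta>. w \<epsilon> \<eta> * (\<integral>q. norm (g q) \<partial>lborel))" using wi[OF e] by simp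
      show "(\<lambda>\<eta>. of_real (w \<epsilon> \<eta>) * fourier g \<eta>) \<in> borel_measurable lborel"
        using wc by auto
    qed (auto simp: norm_mult w_def intro!: mult_left_mono fb)
    have cg: "integrable lborel (\<lambda>q. cnj (g q))" using g by simp
    have "of_real ?L = (\<integral>\<eta>. (of_real (w \<epsilon> \<eta>) * fourier g \<eta>) * cnj (fourier g \<eta>) \<partial>lborel)"
      unfolding integral_complex_of_real[symmetric] of_real_mult complex_norm_square
      by (simp add: mult_ac)
    also have "\<dots> = (\<integral>\<eta>. (of_real (w \<epsilon> \<eta>) * fourier g \<eta>) * (\<integral>q. cnj (g q) * cis (- (q \<bullet> \<eta>)) \<partial>lborel) \<partial>lborel)"
    proof -
      have "cnj (fourier g \<eta>) = (\<integral>q. cnj (g q) * cis (- (q \<bullet> \<eta>)) \<partial>lborel)" for \<eta>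
        unfolding fourier_def by (subst Bochner_Integration.integral_cnj[symmetric]) (simp add: cis_cnj)
      then show ?thesis by simp
    qed
    also have "\<dots> = (\<integral>q. cnj (g q) * (\<integral>\<eta>. (of_real (w \<epsilon> \<eta>) * fourier g \<eta>) * cis (- (q \<bullet> \<eta>)) \<partial>lborel) \<partial>lborel)"
      by (rule fubini_bounded_kernel[OF fw cg]) auto
    also have "\<dots> = (\<integral>q. cnj (g q) * (\<integral>h. g (h + q) * of_real (?c * w (1/\<epsilon>) h) \<partial>lborel) \<partial>lborel)"
    proof (rule Bochner_Integration.integral_cong[OF refl], rule arg_cong[where f = "(*) _"])
      fix q
      have "(\<integral>\<eta>. (of_real (w \<epsilon> \<eta>) * fourier g \<eta>) * cis (- (q \<bullet> \<eta>)) \<partial>lborel)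
         = (\<integral>\<eta>. of_real (w \<epsilon> \<eta>) * (\<integral>q'. g q' * cis ((q' - q) \<bullet> \<eta>) \<partial>lborel) \<partial>lborel)"
        unfolding fourier_def mult.assoc
        by (subst integral_mult_left_zero[symmetric]) (simp add: mult.assoc cis_mult inner_diff_left)
      also have "\<dots> = (\<integral>q'. g q' * (\<integral>\<eta>. of_real (w \<epsilon> \<eta>) * cis ((q' - q) \<bullet> \<eta>) \<partial>lborel) \<partial>lborel)"
        by (rule fubini_bounded_kernel[OF wc g]) auto
      also have "\<dots> = (\<integral>q'. g q' * of_real (?c * w (1/\<epsilon>) (q' - q)) \<partial>lborel)"
        by (simp only: w_hat[OF e])
      also have "\<dots> = (\<integral>h. g (q + h) * of_real (?c * w (1/\<epsilon>) (q + h - q)) \<partial>lborel)"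
        by (rule integral_lborel_shift[symmetric]) (auto simp: w_def)
      finally show "(\<integral>\<eta>. (of_real (w \<epsilon> \<eta>) * fourier g \<eta>) * cis (- (q \<bullet> \<eta>)) \<partial>lborel)
          = (\<integral>h. g (h + q) * of_real (?c * w (1/\<epsilon>) h) \<partial>lborel)"
        by (simp add: add.commute)
    qed
    also have "\<dots> = (\<integral>h. (\<integral>q. cnj (g q) * (g (h + q) * of_real (?c * w (1/\<epsilon>) h)) \<partial>lborel) \<partial>lborel)"
    proof -
      have "integrable (lborel \<Otimes>\<^sub>M lborel) (\<lambda>(q, h). cnj (g q) * (g (h + q) * of_real (?c * w (1/\<epsilon>) h)))"
      proof (rule lborel_pair.Fubini_integrable)
        have gq: "integrable lborel (\<lambda>h. g (h + q))" for q
          using integrable_lborel_shift[OF g, of q] by (simp add: add.commute)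
        have gw: "integrable lborel (\<lambda>h. g (h + q) * of_real (?c * w (1/\<epsilon>) h))" for q
        proof (rule Bochner_Integration.integrable_bound)
          show "integrable lborel (\<lambda>h. g (h + q) * of_real ?c)" using gq by auto
        qed (use e in \<open>auto simp: norm_mult w_def intro!: mult_left_mono mult_left_le\<close>)
        show "AE q in lborel. integrable lborel (\<lambda>h. case (q, h) of (q, h) \<Rightarrow> cnj (g q) * (g (h + q) * of_real (?c * w (1/\<epsilon>) h)))"
          using gw by auto
        show "integrable lborel (\<lambda>q. \<integral>h. norm (case (q, h) of (q, h) \<Rightarrow> cnj (g q) * (g (h + q) * of_real (?c * w (1/\<epsilon>) h))) \<partial>lborel)"
        proof (rule Bochner_Integration.integrable_bound)
          show "integrable lborel (\<lambda>q. norm (g q) * ((\<integral>h. norm (g h) \<partial>lborel) * ?c))" using g by auto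
          have *: "(\<integral>h. norm (g (h + q) * of_real (?c * w (1/\<epsilon>) h)) \<partial>lborel) \<le> (\<integral>h. norm (g h) \<partial>lborel) * ?c" for q
          proof -
            have "(\<integral>h. norm (g (h + q) * of_real (?c * w (1/\<epsilon>) h)) \<partial>lborel) \<le> (\<integral>h. norm (g (h + q)) * ?c \<partial>lborel)"
            proof (rule integral_mono)
              fix h
              have "\<bar>?c * w (1/\<epsilon>) h\<bar> \<le> ?c"
                using e by (auto simp: w_def abs_mult intro!: mult_left_le)
              then show "norm (g (h + q) * of_real (?c * w (1/\<epsilon>) h)) \<le> norm (g (h + q)) * ?c"
                unfolding norm_mult[of "g _"] norm_of_real by (rule mult_left_mono) simp
            qed (use gq gw[THEN integrable_norm] in auto)
            also have "\<dots> = (\<integral>h. norm (g (q + h)) \<partial>lborel) * ?c"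
              by (simp add: add.commute)
            also have "(\<integral>h. norm (g (q + h)) \<partial>lborel) = (\<integral>h. norm (g h) \<partial>lborel)"
              by (rule integral_lborel_shift[where f = "\<lambda>x. norm (g x)"]) measurable
            finally show ?thesis .
          qed
          have "(\<integral>h. norm (cnj (g q) * (g (h + q) * of_real (?c * w (1/\<epsilon>) h))) \<partial>lborel)
              = norm (g q) * (\<integral>h. norm (g (h + q) * of_real (?c * w (1/\<epsilon>) h)) \<partial>lborel)" for q
            by (simp only: norm_mult[of "cnj _"] complex_mod_cnj integral_mult_right_zero)
          then show "AE q in lborel. norm (\<integral>h. norm (case (q, h) of (q, h) \<Rightarrow> cnj (g q) * (g (h + q) * of_real (?c * w (1/\<epsilon>) h))) \<partial>lborel)
              \<le> norm (norm (g q) * ((\<integral>h. norm (g h) \<partial>lborel) * ?c))"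
            using * e by (intro AE_I2) (simp add: abs_mult mult_left_mono)
        qed (unfold w_def, measurable)
      qed (unfold w_def, measurable)
      from lborel_pair.Fubini_integral[OF this] show ?thesis by simp
    qed
    also have "\<dots> = (\<integral>h. B h * of_real (?c * w (1/\<epsilon>) h) \<partial>lborel)"
      unfolding B_def by (intro Bochner_Integration.integral_cong refl, subst integral_mult_left_zero[symmetric]) (simp add: mult_ac)
    \<comment> \<open>Rescaling by \<open>sqrt \<epsilon>\<close> frees the Gaussian from
      \<open>\<epsilon>\<close> and moves the dependence into the argument of \<open>B\<close>,
      ready for dominated convergence.\<close>
    also have "\<dots> = (\<bar>sqrt \<epsilon>\<bar> ^ DIM('a)) *\<^sub>R (\<integral>s. B (0 + sqrt \<epsilon> *\<^sub>R s) * of_real (?c * w (1/\<epsilon>) (0 + sqrt \<epsilon> *\<^sub>R s)) \<partial>lborel)"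
      by (rule integral_lborel_affine) (use e in \<open>auto simp: w_def\<close>)
    also have "\<dots> = of_real (sqrt \<epsilon> ^ DIM('a)) * (\<integral>s. of_real ?c * (B (sqrt \<epsilon> *\<^sub>R s) * of_real (w 1 s)) \<partial>lborel)"
    proof -
      have "w (1/\<epsilon>) (sqrt \<epsilon> *\<^sub>R s) = w 1 s" for s
        using e by (simp add: w_def power_mult_distrib)
      then show ?thesis using e by (simp add: scaleR_conv_of_real mult_ac)
    qed
    also have "\<dots> = of_real (sqrt \<epsilon> ^ DIM('a) * ?c) * (\<integral>s. B (sqrt \<epsilon> *\<^sub>R s) * of_real (w 1 s) \<partial>lborel)"
      by simp
    also have "sqrt \<epsilon> ^ DIM('a) * ?c = sqrt (2 * pi) ^ DIM('a)"
      using e by (simp add: power_mult_distrib[symmetric] real_sqrt_mult[symmetric])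
    finally show ?thesis by (metis Re_complex_of_real)
  qed
  define e where "e k = inverse (real (Suc k))" for k
  have e: "e k > 0" for k by (simp add: e_def)
  have e0: "e \<longlonglongrightarrow> 0" unfolding e_def[abs_def] by (rule LIMSEQ_inverse_real_of_nat)
  have lim1: "(\<lambda>k. \<integral>\<eta>. (cmod (fourier g \<eta>))\<^sup>2 * w (e k) \<eta> \<partial>lborel) \<longlonglongrightarrow> (2 * pi) ^ DIM('a) * l2_normsq lborel g"
  proof -
    have "(\<lambda>k. \<integral>s. B (sqrt (e k) *\<^sub>R s) * of_real (w 1 s) \<partial>lborel) \<longlonglongrightarrow> (\<integral>s. B 0 * of_real (w 1 s) \<partial>lborel)"
    proof (rule integral_dominated_convergence)
      show "integrable lborel (\<lambda>s. l2_normsq lborel g * w 1 s)" using wi[of 1] by simp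
      show "AE s in lborel. (\<lambda>k. B (sqrt (e k) *\<^sub>R s) * of_real (w 1 s)) \<longlonglongrightarrow> B 0 * of_real (w 1 s)"
      proof (rule AE_I2)
        fix s :: 'a
        have "(\<lambda>k. sqrt (e k) *\<^sub>R s) \<longlonglongrightarrow> sqrt 0 *\<^sub>R s" by (intro tendsto_intros e0)
        then have "(\<lambda>k. sqrt (e k) *\<^sub>R s) \<longlonglongrightarrow> 0" by simp
        then show "(\<lambda>k. B (sqrt (e k) *\<^sub>R s) * of_real (w 1 s)) \<longlonglongrightarrow> B 0 * of_real (w 1 s)"
          by (intro tendsto_mult B_cont tendsto_const)
      qed
    qed (auto simp: w_def norm_mult intro!: mult_right_mono Bb)
    also have "(\<integral>s. B 0 * of_real (w 1 s) \<partial>lborel) = of_real (l2_normsq lborel g * sqrt (2 * pi) ^ DIM('a))"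
    proof -
      have "(\<integral>s. w 1 s \<partial>lborel) = sqrt (2 * pi) ^ DIM('a)"
        using gaussian_abs_integral[of "1/2" "0::'a"] by (simp add: w_def mult.commute)
      then show ?thesis by (simp add: B0)
    qed
    finally have "(\<lambda>k. Re (of_real (sqrt (2 * pi) ^ DIM('a)) * (\<integral>s. B (sqrt (e k) *\<^sub>R s) * of_real (w 1 s) \<partial>lborel)))
       \<longlonglongrightarrow> Re (of_real (sqrt (2 * pi) ^ DIM('a)) * of_real (l2_normsq lborel g * sqrt (2 * pi) ^ DIM('a)))"
      by (intro tendsto_intros)
    moreover have sq: "sqrt (2 * pi) ^ DIM('a) * sqrt (2 * pi) ^ DIM('a) = (2 * pi) ^ DIM('a)"
      unfolding power_mult_distrib[symmetric] by simp
    have "Re (of_real (sqrt (2 * pi) ^ DIM('a)) * of_real (l2_normsq lborel g * sqrt (2 * pi) ^ DIM('a)))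
       = (2 * pi) ^ DIM('a) * l2_normsq lborel g"
      unfolding of_real_mult[symmetric] Re_complex_of_real sq[symmetric] by (simp only: mult_ac)
    ultimately show ?thesis by (simp only: reg[OF e])
  qed
  have limA: "(\<lambda>k. \<integral>\<^sup>+\<eta>. ennreal ((cmod (fourier g \<eta>))\<^sup>2 * w (e k) \<eta>) \<partial>lborel)
      \<longlonglongrightarrow> (\<integral>\<^sup>+\<eta>. ennreal ((cmod (fourier g \<eta>))\<^sup>2) \<partial>lborel)"
  proof (rule nn_integral_LIMSEQ)
    show "incseq (\<lambda>k \<eta>. ennreal ((cmod (fourier g \<eta>))\<^sup>2 * w (e k) \<eta>))"
    proof (intro monoI le_funI ennreal_leI mult_left_mono)
      fix k l :: nat and \<eta> :: 'a assume "k \<le> l"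
      then have "e l \<le> e k" by (simp add: e_def)
      then show "w (e k) \<eta> \<le> w (e l) \<eta>" by (simp add: w_def mult_right_mono)
    qed simp
    show "(\<lambda>k. ennreal ((cmod (fourier g \<eta>))\<^sup>2 * w (e k) \<eta>)) \<longlonglongrightarrow> ennreal ((cmod (fourier g \<eta>))\<^sup>2)" for \<eta>
    proof (rule tendsto_ennrealI)
      have "(\<lambda>k. (cmod (fourier g \<eta>))\<^sup>2 * exp (- (e k / 2 * (norm \<eta>)\<^sup>2)))
          \<longlonglongrightarrow> (cmod (fourier g \<eta>))\<^sup>2 * exp (- (0 / 2 * (norm \<eta>)\<^sup>2))"
        by (intro tendsto_intros e0) auto
      then show "(\<lambda>k. (cmod (fourier g \<eta>))\<^sup>2 * w (e k) \<eta>) \<longlonglongrightarrow> (cmod (fourier g \<eta>))\<^sup>2"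
        by (simp add: w_def)
    qed
  qed (auto simp: w_def)
  have eqk: "(\<integral>\<^sup>+\<eta>. ennreal ((cmod (fourier g \<eta>))\<^sup>2 * w (e k) \<eta>) \<partial>lborel)
      = ennreal (\<integral>\<eta>. (cmod (fourier g \<eta>))\<^sup>2 * w (e k) \<eta> \<partial>lborel)" for k
  proof (rule nn_integral_eq_integral)
    show "integrable lborel (\<lambda>\<eta>. (cmod (fourier g \<eta>))\<^sup>2 * w (e k) \<eta>)"
    proof (rule Bochner_Integration.integrable_bound)
      show "integrable lborel (\<lambda>\<eta>. (\<integral>q. norm (g q) \<partial>lborel)\<^sup>2 * w (e k) \<eta>)" using wi[OF e] by simp
    qed (auto simp: w_def intro!: mult_right_mono power_mono fb)
  qed (simp add: w_def)
  show ?thesis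
    by (rule LIMSEQ_unique[OF limA[unfolded eqk] tendsto_ennrealI[OF lim1]])
qed

subsection \<open>Complexification and entire functions\<close>

text \<open>Lebesgue measure is determined by its values on boxes, and a linear bijection between
  the bases pulls a box back to a box with the same side lengths in another order.\<close>

lemma lborel_distr_basis_bij:
  fixes J :: "'a::euclidean_space \<Rightarrow> 'b::euclidean_space"
  assumes J: "linear J" and bij: "bij_betw J Basis Basis"
  shows "distr lborel borel J = lborel"
proof (rule sym, rule lborel_eqI)
  have [measurable]: "J \<in> borel \<rightarrow>\<^sub>M borel"
    using linear_continuous_on[OF linear_conv_bounded_linear[THEN iffD1, OF J]]
    by (intro borel_measurable_continuous_onI)
  have inn: "J x \<bullet> J b = x \<bullet> b" if b: "b \<in> Basis" for x b
  proof -
    have "J x = (\<Sum>i\<in>Basis. (x \<bullet> i) *\<^sub>R J i)"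
      by (subst euclidean_representation[of x, symmetric])
        (simp only: linear_sum[OF J] linear_cmul[OF J])
    then have "J x \<bullet> J b = (\<Sum>i\<in>Basis. (x \<bullet> i) * (J i \<bullet> J b))"
      by (simp add: inner_sum_left)
    also have "\<dots> = (\<Sum>i\<in>Basis. if i = b then x \<bullet> b else 0)"
    proof (rule sum.cong[OF refl])
      fix i :: 'a assume i: "i \<in> Basis"
      then have "J i \<in> Basis" "J b \<in> Basis" "J i = J b \<longleftrightarrow> i = b"
        using bij b by (auto simp: bij_betw_def inj_on_def)
      then show "(x \<bullet> i) * (J i \<bullet> J b) = (if i = b then x \<bullet> b else 0)"
        by (simp add: inner_Basis)
    qed
    finally show ?thesis using b by simp
  qed
  fix l u :: 'b assume lu: "\<And>b. b \<in> Basis \<Longrightarrow> l \<bullet> b \<le> u \<bullet> b"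
  \<comment> \<open>The coordinates of a corner read through \<open>J\<close>; they are the corners
    of the pulled back box.\<close>
  define pull where "pull y = (\<Sum>i\<in>Basis. (y \<bullet> J i) *\<^sub>R i)" for y
  have pull: "pull y \<bullet> b = y \<bullet> J b" if "b \<in> Basis" for y b
    using that by (simp add: pull_def inner_sum_left inner_Basis if_distrib cong: if_cong)
  have img: "J ` Basis = Basis" using bij by (simp add: bij_betw_def)
  have "J -` box l u = box (pull l) (pull u)"
    unfolding box_def vimage_def img[symmetric] by (auto simp: inn pull)
  then have "emeasure (distr lborel borel J) (box l u) = emeasure lborel (box (pull l) (pull u))"
    by (simp add: emeasure_distr)
  also have "\<dots> = ennreal (\<Prod>b\<in>Basis. (pull u - pull l) \<bullet> b)"
    using lu img by (intro emeasure_lborel_box) (auto simp: pull)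
  also have "(\<Prod>b\<in>Basis. (pull u - pull l) \<bullet> b) = (\<Prod>b\<in>Basis. (u - l) \<bullet> J b)"
    by (intro prod.cong) (auto simp: inner_diff_left pull)
  also have "\<dots> = (\<Prod>b\<in>Basis. (u - l) \<bullet> b)"
    by (rule prod.reindex_bij_betw[OF bij])
  finally show "emeasure (distr lborel borel J) (box l u) = ennreal (\<Prod>b\<in>Basis. (u - l) \<bullet> b)" .
qed simp

definition cv :: "real^'n \<Rightarrow> real^'n \<Rightarrow> complex^'n" where
  "cv x y = (\<chi> j. Complex (x $ j) (y $ j))"

text \<open>The pair consists of a = (x, u) and b = (y, v) with a + ib = (z, w): real parts are
  grouped before imaginary parts. Multiplication by i then becomes \<open>rot\<close>, and most
  arguments about complex points can be carried out over an arbitrary Euclidean space.\<close>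

definition cplx :: "((real^'n) \<times> (real^'n)) \<times> ((real^'n) \<times> (real^'n)) \<Rightarrow> (complex^'n) \<times> (complex^'n)" where
  "cplx p = (cv (fst (fst p)) (fst (snd p)), cv (snd (fst p)) (snd (snd p)))"

definition uncplx :: "(complex^'n) \<times> (complex^'n) \<Rightarrow> ((real^'n) \<times> (real^'n)) \<times> ((real^'n) \<times> (real^'n))" where
  "uncplx p = ((Re_vec (fst p), Re_vec (snd p)), (Im_vec (fst p), Im_vec (snd p)))"

lemma cplx_uncplx [simp]: "cplx (uncplx p) = p"
  by (simp add: cplx_def uncplx_def cv_def Re_vec_def Im_vec_def prod_eq_iff vec_eq_iff)

lemma uncplx_cplx [simp]: "uncplx (cplx p) = p"
  by (simp add: cplx_def uncplx_def cv_def Re_vec_def Im_vec_def prod_eq_iff vec_eq_iff)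

lemma linear_cplx: "linear cplx"
  by (rule linearI) (auto simp: cplx_def cv_def vec_eq_iff complex_eq_iff)

lemma linear_uncplx: "linear uncplx"
  by (rule linearI) (auto simp: uncplx_def Re_vec_def Im_vec_def vec_eq_iff)

lemma measurable_cplx [measurable]: "cplx \<in> borel \<rightarrow>\<^sub>M borel"
  using linear_continuous_on[OF linear_conv_bounded_linear[THEN iffD1, OF linear_cplx]]
  by (intro borel_measurable_continuous_onI)

lemma lborel_distr_cplx: "distr lborel borel (cplx :: _ \<Rightarrow> (complex^'n) \<times> (complex^'n)) = lborel"
proof (rule lborel_distr_basis_bij[OF linear_cplx])
  let ?J = "cplx :: _ \<Rightarrow> (complex^'n) \<times> (complex^'n)"
  have inj: "inj_on ?J Basis"
    by (metis inj_on_inverseI uncplx_cplx)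
  have a: "cv (axis i 1) 0 = axis i 1" "cv 0 (axis i 1) = axis i \<i>" "cv 0 0 = 0" for i :: 'n
    by (auto simp: cv_def vec_eq_iff axis_def complex_eq_iff)
  have "?J ` Basis \<subseteq> Basis"
    by (auto simp: Basis_prod_def Basis_vec_def cplx_def a Basis_complex_def)
  moreover have "card (?J ` Basis) = card (Basis :: ((complex^'n) \<times> (complex^'n)) set)"
    by (simp add: card_image[OF inj])
  ultimately have "?J ` Basis = Basis"
    by (intro card_subset_eq) auto
  with inj show "bij_betw ?J Basis Basis" by (simp add: bij_betw_def)
qed

lemma nn_integral_cplx:
  assumes [measurable]: "f \<in> borel_measurable borel"
  shows "(\<integral>\<^sup>+p. f p \<partial>lborel) = (\<integral>\<^sup>+p. f (cplx p) \<partial>lborel)"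
  by (subst lborel_distr_cplx[symmetric]) (simp add: nn_integral_distr)

lemma integral_cplx:
  fixes f :: "_ \<Rightarrow> 'b::{banach,second_countable_topology}"
  assumes [measurable]: "f \<in> borel_measurable borel"
  shows "(\<integral>p. f p \<partial>lborel) = (\<integral>p. f (cplx p) \<partial>lborel)"
  by (subst lborel_distr_cplx[symmetric]) (simp add: integral_distr)

section \<open>Complex structure and holomorphy on pairs of real vectors\<close>

definition rot :: "'a::real_vector \<times> 'a \<Rightarrow> 'a \<times> 'a" where
  "rot p = (- snd p, fst p)"

lemma cplx_rot: "cplx (rot p) = cmul \<i> (cplx p)"
  by (simp add: cplx_def rot_def cmul_def cv_def vec_eq_iff complex_eq_iff)

definition holo :: "('a::euclidean_space \<times> 'a \<Rightarrow> complex) \<Rightarrow> bool" where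
  "holo F \<longleftrightarrow> (\<forall>p. \<exists>D. (F has_derivative D) (at p) \<and> (\<forall>v. D (rot v) = \<i> * D v))"

text \<open>A linear change of coordinates that carries \<open>rot\<close> to multiplication by i
  preserves complex linearity of derivatives; from here on holomorphy is treated in the real
  picture.\<close>

lemma entire_fun_iff_holo: "entire_fun F \<longleftrightarrow> holo (F \<circ> cplx)"
proof
  assume F: "entire_fun F"
  show "holo (F \<circ> cplx)"
    unfolding holo_def
  proof
    fix p
    obtain D where D: "(F has_derivative D) (at (cplx p))" "\<And>v. D (cmul \<i> v) = \<i> * D v"
      using F unfolding entire_fun_def by blast
    have "(F \<circ> cplx has_derivative D \<circ> cplx) (at p)"
      using D(1) by (intro diff_chain_at linear_imp_has_derivative linear_cplx)
    moreover have "(D \<circ> cplx) (rot v) = \<i> * (D \<circ> cplx) v" for v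
      by (simp add: cplx_rot D)
    ultimately show "\<exists>D. (F \<circ> cplx has_derivative D) (at p) \<and> (\<forall>v. D (rot v) = \<i> * D v)"
      by blast
  qed
next
  assume F: "holo (F \<circ> cplx)"
  show "entire_fun F"
    unfolding entire_fun_def
  proof
    fix p
    obtain D where D: "(F \<circ> cplx has_derivative D) (at (uncplx p))" "\<And>v. D (rot v) = \<i> * D v"
      using F unfolding holo_def by blast
    have "(F \<circ> cplx \<circ> uncplx has_derivative D \<circ> uncplx) (at p)"
      using D(1) by (intro diff_chain_at linear_imp_has_derivative linear_uncplx)
    moreover have "F \<circ> cplx \<circ> uncplx = F" by (auto simp: fun_eq_iff)
    moreover have "(D \<circ> uncplx) (cmul \<i> v) = \<i> * (D \<circ> uncplx) v" for v
    proof -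
      have "uncplx (cmul \<i> v) = rot (uncplx v)"
        by (metis cplx_rot cplx_uncplx uncplx_cplx)
      then show ?thesis by (simp add: D)
    qed
    ultimately show "\<exists>D. (F has_derivative D) (at p) \<and> (\<forall>v. D (cmul \<i> v) = \<i> * D v)"
      by auto
  qed
qed

lemma holo_const: "holo (\<lambda>_. c)"
  unfolding holo_def by (auto intro!: exI[of _ "\<lambda>_. 0"] derivative_eq_intros)

lemma holo_mult:
  assumes "holo F" "holo G" shows "holo (\<lambda>p. F p * G p)"
  unfolding holo_def
proof
  fix p
  obtain D E where D: "(F has_derivative D) (at p)" "\<And>v. D (rot v) = \<i> * D v"
    and E: "(G has_derivative E) (at p)" "\<And>v. E (rot v) = \<i> * E v"
    using assms unfolding holo_def by metis
  show "\<exists>D. ((\<lambda>p. F p * G p) has_derivative D) (at p) \<and> (\<forall>v. D (rot v) = \<i> * D v)"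
    by (rule exI, rule conjI, rule has_derivative_mult[OF D(1) E(1)]) (simp add: algebra_simps D(2) E(2))
qed

lemma holo_diff:
  assumes "holo F" "holo G" shows "holo (\<lambda>p. F p - G p)"
  unfolding holo_def
proof
  fix p
  obtain D E where D: "(F has_derivative D) (at p)" "\<And>v. D (rot v) = \<i> * D v"
    and E: "(G has_derivative E) (at p)" "\<And>v. E (rot v) = \<i> * E v"
    using assms unfolding holo_def by metis
  show "\<exists>D. ((\<lambda>p. F p - G p) has_derivative D) (at p) \<and> (\<forall>v. D (rot v) = \<i> * D v)"
    by (rule exI, rule conjI, rule has_derivative_diff[OF D(1) E(1)]) (simp add: algebra_simps D(2) E(2))
qed

lemma holo_exp:
  assumes "holo F" shows "holo (\<lambda>p. exp (F p))"
  unfolding holo_def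
proof
  fix p
  obtain D where D: "(F has_derivative D) (at p)" "\<And>v. D (rot v) = \<i> * D v"
    using assms unfolding holo_def by metis
  have "(exp has_derivative (*) (exp (F p))) (at (F p))"
    using DERIV_exp[of "F p"] by (simp add: has_field_derivative_def)
  from diff_chain_at[OF D(1) this]
  show "\<exists>D. ((\<lambda>p. exp (F p)) has_derivative D) (at p) \<and> (\<forall>v. D (rot v) = \<i> * D v)"
    by (intro exI[of _ "(*) (exp (F p)) \<circ> D"]) (auto simp: o_def D)
qed

lemma holo_compose_linear:
  assumes F: "holo F" and L: "linear L" and rot: "\<And>p. L (rot p) = rot (L p)"
  shows "holo (\<lambda>p. F (a + L p))"
  unfolding holo_def
proof
  fix p
  obtain D where D: "(F has_derivative D) (at (a + L p))" "\<And>v. D (rot v) = \<i> * D v"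
    using F unfolding holo_def by metis
  have "((\<lambda>p. a + L p) has_derivative L) (at p)"
    using has_derivative_add[OF has_derivative_const linear_imp_has_derivative[OF L], of a "at p"] by simp
  from diff_chain_at[OF this D(1)]
  show "\<exists>D. ((\<lambda>p. F (a + L p)) has_derivative D) (at p) \<and> (\<forall>v. D (rot v) = \<i> * D v)"
    by (intro exI[of _ "D \<circ> L"]) (auto simp: o_def D rot)
qed

lemma linear_cinner: "linear (cinner q)"
  by (rule linearI) (auto simp: cinner_def complex_eq_iff inner_add_right)

lemma cinner_rot: "cinner q (rot p) = \<i> * cinner q p"
  by (simp add: cinner_def rot_def complex_eq_iff)

lemma holo_cinner: "holo (cinner q)"
  unfolding holo_def using linear_imp_has_derivative[OF linear_cinner] cinner_rot by blast

text \<open>The bilinear square p . p of p = a + ib, which is z . z + w . w in the original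
  coordinates; unlike the squared norm it is holomorphic.\<close>

definition csq :: "'a::euclidean_space \<times> 'a \<Rightarrow> complex" where
  "csq p = Complex ((norm (fst p))\<^sup>2 - (norm (snd p))\<^sup>2) (2 * (fst p \<bullet> snd p))"

lemma csq_eq_sum: "csq p = (\<Sum>b\<in>Basis. cinner b p * cinner b p)"
  unfolding csq_def cinner_def power2_norm_eq_inner
  by (simp add: complex_eq_iff sum_subtractf sum_distrib_left inner_commute sum.distrib mult.commute
          euclidean_inner[of "fst p" "fst p"] euclidean_inner[of "snd p" "snd p"] euclidean_inner[of "fst p" "snd p"])

lemma holo_csq: "holo csq"
proof -
  have "holo (\<lambda>p. \<Sum>b\<in>A. cinner b p * cinner b p)" for A :: "'a set"
  proof (induction A rule: infinite_finite_induct)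
    case (insert x A)
    \<comment> \<open>A sum, spelled with differences and factors -1 so that
      \<open>holo_diff\<close> and \<open>holo_mult\<close> apply.\<close>
    have "holo (\<lambda>p. (0 - (-1) * (\<Sum>b\<in>A. cinner b p * cinner b p)) - (-1) * (cinner x p * cinner x p))"
      by (intro holo_diff holo_mult holo_const holo_cinner insert.IH)
    then show ?case using insert.hyps by (simp add: add.commute)
  qed (auto simp: holo_const)
  then show ?thesis by (simp add: csq_eq_sum[abs_def])
qed

lemma holo_continuous: "holo F \<Longrightarrow> continuous_on UNIV F"
  unfolding holo_def by (metis continuous_at_imp_continuous_on has_derivative_continuous)

lemma holo_measurable: "holo F \<Longrightarrow> F \<in> borel_measurable borel"
  by (intro borel_measurable_continuous_onI holo_continuous)

lemma entire_fun_measurable: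
  assumes "entire_fun F" shows "F \<in> borel_measurable borel"
proof -
  have "continuous_on UNIV F"
    using assms unfolding entire_fun_def
    by (metis continuous_at_imp_continuous_on has_derivative_continuous)
  then show ?thesis by (rule borel_measurable_continuous_onI)
qed

definition cscale :: "complex \<Rightarrow> 'a::real_vector \<times> 'a \<Rightarrow> 'a \<times> 'a" where
  "cscale \<tau> p = Re \<tau> *\<^sub>R p + Im \<tau> *\<^sub>R rot p"

text \<open>Reduces several complex variables to one: Cauchy's formula and the identity theorem are
  only ever applied along such lines.\<close>

lemma holo_complex_line:
  assumes F: "holo F"
  shows "(\<lambda>\<tau>. F (a + cscale \<tau> p)) holomorphic_on UNIV"
proof -
  have "\<exists>f'. ((\<lambda>\<tau>. F (a + cscale \<tau> p)) has_field_derivative f') (at \<tau>)" for \<tau>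
  proof -
    obtain D where D: "(F has_derivative D) (at (a + cscale \<tau> p))" "\<And>v. D (rot v) = \<i> * D v"
      using F unfolding holo_def by metis
    have lin: "linear (\<lambda>\<tau>. cscale \<tau> p)"
      by (rule linearI) (auto simp: cscale_def algebra_simps)
    have "((\<lambda>\<tau>. a + cscale \<tau> p) has_derivative (\<lambda>\<tau>. cscale \<tau> p)) (at \<tau>)"
      using has_derivative_add[OF has_derivative_const linear_imp_has_derivative[OF lin], of a "at \<tau>"] by simp
    from diff_chain_at[OF this D(1)]
    have "((\<lambda>\<tau>. F (a + cscale \<tau> p)) has_derivative (\<lambda>\<tau>. D (cscale \<tau> p))) (at \<tau>)"
      by (simp add: o_def)
    moreover have "D (cscale s p) = D p * s" for s
    proof -
      interpret D: linear D using has_derivative_linear[OF D(1)] .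
      show ?thesis
        by (simp add: cscale_def D.add D.scale D(2) scaleR_conv_of_real) (simp add: complex_eq_iff)
    qed
    ultimately show ?thesis
      unfolding has_field_derivative_def by (intro exI[of _ "D p"]) simp
  qed
  then show ?thesis
    by (simp add: holomorphic_on_open field_differentiable_def)
qed

lemma norm_cinner_le: "cmod (cinner q h) \<le> norm q * norm h"
proof -
  have "(cmod (cinner q h))\<^sup>2 = \<bar>q \<bullet> fst h\<bar>\<^sup>2 + \<bar>q \<bullet> snd h\<bar>\<^sup>2"
    by (simp add: cinner_def cmod_power2)
  also have "\<dots> \<le> (norm q * norm (fst h))\<^sup>2 + (norm q * norm (snd h))\<^sup>2"
    by (intro add_mono power_mono Cauchy_Schwarz_ineq2) auto
  also have "\<dots> = (norm q * norm h)\<^sup>2"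
    by (simp add: norm_prod_def power_mult_distrib distrib_left)
  finally show ?thesis by (rule power2_le_imp_le) simp
qed

section \<open>Laplace transforms with a Gaussian factor\<close>

definition gauss_laplace :: "real \<Rightarrow> ('a::euclidean_space \<Rightarrow> complex) \<Rightarrow> 'a \<times> 'a \<Rightarrow> complex" where
  "gauss_laplace c g \<zeta> = (\<integral>q. g q * exp (cinner q \<zeta> - of_real (c * (norm q)\<^sup>2)) \<partial>lborel)"

text \<open>The Gaussian beats every exponential of \<open>norm q\<close>, so a single integrable
  majorant serves all arguments of norm at most \<open>R\<close>. It controls convergence,
  differentiation under the integral and, later, the exponential series.\<close>

lemma gauss_laplace_dominator:
  fixes g :: "'a::euclidean_space \<Rightarrow> complex"
  assumes c: "c > 0" and g: "sq_integrable lborel g"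
  shows "integrable lborel (\<lambda>q. cmod (g q) * exp (R * norm q - c * (norm q)\<^sup>2))"
proof -
  have "sq_integrable lborel (\<lambda>q::'a. complex_of_real (exp (R * norm q - c * (norm q)\<^sup>2)))"
  proof (rule sq_integrableI_bound)
    show "integrable lborel (\<lambda>q::'a. exp (R\<^sup>2 / c) * exp (- (c * (norm q)\<^sup>2)))"
      using gaussian_abs_integrable[OF c, of "0::'a"] by simp
    fix q :: 'a
    \<comment> \<open>Half of the Gaussian decay pays for the linear term.\<close>
    have "0 \<le> (c * norm q - R)\<^sup>2 / c" using c by simp
    also have "\<dots> = c * (norm q)\<^sup>2 - 2 * R * norm q + R\<^sup>2 / c"
      using c by (simp add: power2_eq_square field_simps)
    finally have "2 * (R * norm q - c * (norm q)\<^sup>2) \<le> R\<^sup>2 / c + - (c * (norm q)\<^sup>2)" by simp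
    then have "exp (2 * (R * norm q - c * (norm q)\<^sup>2)) \<le> exp (R\<^sup>2 / c + - (c * (norm q)\<^sup>2))" by simp
    then show "(cmod (complex_of_real (exp (R * norm q - c * (norm q)\<^sup>2))))\<^sup>2 \<le> exp (R\<^sup>2 / c) * exp (- (c * (norm q)\<^sup>2))"
      by (simp only: norm_of_real abs_exp_cancel exp_double exp_add)
  qed measurable
  from integrable_norm[OF integrable_mult_sq_integrable[OF g this]] show ?thesis
    by (simp add: norm_mult)
qed

lemma norm_exp_cinner: "cmod (exp (cinner q \<zeta> - of_real (c * (norm q)\<^sup>2))) = exp (q \<bullet> fst \<zeta> - c * (norm q)\<^sup>2)"
  by (simp add: cinner_def)

lemma norm_exp_cinner_le: "cmod (exp (cinner q \<zeta> - of_real (c * (norm q)\<^sup>2))) \<le> exp (norm \<zeta> * norm q - c * (norm q)\<^sup>2)"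
proof -
  have "q \<bullet> fst \<zeta> = Re (cinner q \<zeta>)" by (simp add: cinner_def)
  also have "\<dots> \<le> norm q * norm \<zeta>"
    using complex_Re_le_cmod norm_cinner_le by (rule order_trans)
  finally show ?thesis by (simp only: norm_exp_cinner exp_le_cancel_iff) (simp add: mult.commute)
qed

lemma measurable_cinner [measurable (raw)]:
  assumes [measurable]: "f \<in> borel_measurable M"
  shows "(\<lambda>x. cinner (f x) \<zeta>) \<in> borel_measurable M"
  unfolding cinner_def Complex_eq by measurable

lemma gauss_laplace_integrable:
  fixes g :: "'a::euclidean_space \<Rightarrow> complex"
  assumes c: "c > 0" and g: "sq_integrable lborel g"
  shows "integrable lborel (\<lambda>q. g q * exp (cinner q \<zeta> - of_real (c * (norm q)\<^sup>2)))"
proof (rule Bochner_Integration.integrable_bound[OF gauss_laplace_dominator[OF c g]])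
  have [measurable]: "g \<in> borel_measurable borel" using g by (auto simp: sq_integrable_def)
  show "(\<lambda>q. g q * exp (cinner q \<zeta> - of_real (c * (norm q)\<^sup>2))) \<in> borel_measurable lborel" by measurable
  show "AE q in lborel. norm (g q * exp (cinner q \<zeta> - of_real (c * (norm q)\<^sup>2)))
      \<le> norm (cmod (g q) * exp (norm \<zeta> * norm q - c * (norm q)\<^sup>2))"
    using norm_exp_cinner_le[of _ \<zeta> c] by (auto simp: norm_mult simp del: norm_exp_eq_Re intro!: mult_left_mono)
qed

text \<open>Differentiation under the integral sign, with the quadratic Taylor remainder of the
  exponential; complex linearity of the derivative is inherited from \<open>cinner\<close>.\<close>

lemma holo_gauss_laplace:
  fixes g :: "'a::euclidean_space \<Rightarrow> complex"
  assumes c: "c > 0" and g: "sq_integrable lborel g"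
  shows "holo (gauss_laplace c g)"
  unfolding holo_def
proof
  fix \<zeta> :: "'a \<times> 'a"
  have [measurable]: "g \<in> borel_measurable borel" using g by (auto simp: sq_integrable_def)
  define k where "k \<zeta> q = g q * exp (cinner q \<zeta> - of_real (c * (norm q)\<^sup>2))" for \<zeta> q
  have km [measurable]: "k \<zeta> \<in> borel_measurable borel" for \<zeta> unfolding k_def[abs_def] by measurable
  have ki: "integrable lborel (k \<zeta>)" for \<zeta> unfolding k_def by (rule gauss_laplace_integrable[OF c g])
  have kb: "cmod (k \<zeta> q) \<le> cmod (g q) * exp (norm \<zeta> * norm q - c * (norm q)\<^sup>2)" for q
    unfolding k_def norm_mult by (intro mult_left_mono norm_exp_cinner_le) simp
  \<comment> \<open>A majorant for both the derivative and the remainder. The extra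
    \<open>2 * norm q\<close> in the exponent absorbs one factor \<open>exp (norm q)\<close> from
    Taylor's bound and another that dominates \<open>(norm q)\<^sup>2\<close>.\<close>
  define m where "m q = 2 * (cmod (g q) * exp ((norm \<zeta> + 2) * norm q - c * (norm q)\<^sup>2))" for q
  have mi: "integrable lborel m"
    unfolding m_def[abs_def] by (intro integrable_mult_right gauss_laplace_dominator[OF c g])
  have m_eq: "cmod (g q) * exp (norm \<zeta> * norm q - c * (norm q)\<^sup>2) * exp (2 * norm q) * 2 = m q" for q
    by (simp add: m_def exp_add[symmetric] algebra_simps)
  define D where "D h = (\<integral>q. k \<zeta> q * cinner q h \<partial>lborel)" for h
  have kq: "integrable lborel (\<lambda>q. k \<zeta> q * cinner q h)" for h
  proof (rule Bochner_Integration.integrable_bound)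
    show "integrable lborel (\<lambda>q. norm h * m q)" using mi by simp
    have "cmod (k \<zeta> q) * cmod (cinner q h) \<le> norm h * m q" for q
    proof -
      have "norm q \<le> exp (2 * norm q) * 2"
        using exp_ge_add_one_self[of "2 * norm q"] norm_ge_zero[of q] by linarith
      then have "norm q * norm h \<le> exp (2 * norm q) * 2 * norm h"
        by (rule mult_right_mono) simp
      with norm_cinner_le have "cmod (cinner q h) \<le> exp (2 * norm q) * 2 * norm h"
        by (rule order_trans)
      with kb have "cmod (k \<zeta> q) * cmod (cinner q h) \<le> (cmod (g q) * exp (norm \<zeta> * norm q - c * (norm q)\<^sup>2)) * (exp (2 * norm q) * 2 * norm h)"
        by (rule mult_mono) auto
      also have "\<dots> = norm h * m q" by (simp add: m_eq[symmetric])
      finally show ?thesis .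
    qed
    then show "AE q in lborel. norm (k \<zeta> q * cinner q h) \<le> norm (norm h * m q)"
      by (intro AE_I2) (auto simp: norm_mult intro: order_trans[OF _ abs_ge_self])
  qed measurable
  have lin: "linear D"
  proof (rule linearI)
    fix x y :: "'a \<times> 'a" and r :: real
    show "D (x + y) = D x + D y"
      unfolding D_def linear_add[OF linear_cinner] distrib_left
      by (rule Bochner_Integration.integral_add[OF kq kq])
    show "D (r *\<^sub>R x) = r *\<^sub>R D x"
      unfolding D_def linear_cmul[OF linear_cinner] by simp
  qed
  have "(gauss_laplace c g has_derivative D) (at \<zeta>)"
  proof (rule has_derivativeI_sandwich[of 1])
    show "bounded_linear D" using lin by (simp add: linear_conv_bounded_linear)
    show "((\<lambda>y. (\<integral>q. m q \<partial>lborel) * norm (y - \<zeta>)) \<longlongrightarrow> 0) (at \<zeta>)"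
    proof -
      have "((\<lambda>y. (\<integral>q. m q \<partial>lborel) * norm (y - \<zeta>)) \<longlongrightarrow> (\<integral>q. m q \<partial>lborel) * norm (\<zeta> - \<zeta>)) (at \<zeta>)"
        by (intro tendsto_intros)
      then show ?thesis by simp
    qed
    fix y assume y: "y \<noteq> \<zeta>" "dist y \<zeta> < 1"
    define h where "h = y - \<zeta>"
    have h: "norm h < 1" "norm h > 0" using y by (auto simp: h_def dist_norm)
    have e: "k y q - k \<zeta> q - k \<zeta> q * cinner q h = k \<zeta> q * (exp (cinner q h) - 1 - cinner q h)" for q
    proof -
      have "cinner q y = cinner q \<zeta> + cinner q h"
        unfolding h_def by (simp add: linear_add[OF linear_cinner, symmetric])
      then have "k y q = k \<zeta> q * exp (cinner q h)"
        unfolding k_def by (simp add: exp_add exp_diff)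
      then show ?thesis by (simp add: algebra_simps)
    qed
    have b: "cmod (k \<zeta> q * (exp (cinner q h) - 1 - cinner q h)) \<le> (norm h)\<^sup>2 * m q" for q
    proof -
      have s: "cmod (cinner q h) \<le> norm q"
        using norm_cinner_le[of q h] h mult_left_le[of "norm h" "norm q"] by simp
      have "cmod (exp (cinner q h) - 1 - cinner q h) \<le> exp (cmod (cinner q h)) * (cmod (cinner q h))\<^sup>2"
        using Taylor_exp_field[of "cinner q h" 1] by (simp add: diff_diff_eq power2_eq_square)
      also have "\<dots> \<le> exp (norm q) * (norm q * norm h)\<^sup>2"
        using s norm_cinner_le[of q h] by (intro mult_mono power_mono) auto
      also have "\<dots> = exp (norm q) * (norm h)\<^sup>2 * (norm q)\<^sup>2" by (simp add: power_mult_distrib)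
      also have "\<dots> \<le> exp (norm q) * (norm h)\<^sup>2 * (2 * exp (norm q))"
      proof -
        have "(norm q)\<^sup>2 \<le> 2 * exp (norm q)"
          using exp_lower_Taylor_quadratic[OF norm_ge_zero[of q]] norm_ge_zero[of q] by linarith
        then show ?thesis by (intro mult_left_mono) auto
      qed
      also have "\<dots> = (norm h)\<^sup>2 * (exp (2 * norm q) * 2)" by (simp add: exp_double power2_eq_square)
      finally have "cmod (k \<zeta> q * (exp (cinner q h) - 1 - cinner q h))
         \<le> (cmod (g q) * exp (norm \<zeta> * norm q - c * (norm q)\<^sup>2)) * ((norm h)\<^sup>2 * (exp (2 * norm q) * 2))"
        unfolding norm_mult[of "k _ _"] by (intro mult_mono kb) auto
      also have "\<dots> = (norm h)\<^sup>2 * m q" by (simp add: m_eq[symmetric])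
      finally show ?thesis .
    qed
    have int: "integrable lborel (\<lambda>q. k \<zeta> q * (exp (cinner q h) - 1 - cinner q h))"
      unfolding e[symmetric] by (intro Bochner_Integration.integrable_diff ki kq)
    have "gauss_laplace c g y - gauss_laplace c g \<zeta> - D (y - \<zeta>)
        = (\<integral>q. k \<zeta> q * (exp (cinner q h) - 1 - cinner q h) \<partial>lborel)"
      unfolding e[symmetric] gauss_laplace_def D_def h_def[symmetric] k_def[symmetric]
      using ki kq by simp
    also have "cmod \<dots> \<le> (\<integral>q. (norm h)\<^sup>2 * m q \<partial>lborel)"
      using b by (intro order_trans[OF integral_norm_bound] integral_mono) (use mi int[THEN integrable_norm] in auto)
    finally have "cmod (gauss_laplace c g y - gauss_laplace c g \<zeta> - D (y - \<zeta>)) \<le> (norm h)\<^sup>2 * (\<integral>q. m q \<partial>lborel)"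
      by simp
    then show "cmod (gauss_laplace c g y - gauss_laplace c g \<zeta> - D (y - \<zeta>)) / norm (y - \<zeta>)
        \<le> (\<integral>q. m q \<partial>lborel) * norm (y - \<zeta>)"
      using h unfolding h_def[symmetric] by (simp add: divide_le_eq power2_eq_square mult_ac)
  qed simp
  moreover have "D (rot v) = \<i> * D v" for v
    unfolding D_def cinner_rot by (subst integral_mult_right_zero[symmetric]) (simp add: mult_ac)
  ultimately show "\<exists>D. (gauss_laplace c g has_derivative D) (at \<zeta>) \<and> (\<forall>v. D (rot v) = \<i> * D v)"
    by blast
qed

subsection \<open>The twisted heat transform as a Gaussian Laplace transform\<close>

lemma measurable_fst_euclidean [measurable]:
  "(fst :: 'a::euclidean_space \<times> 'b::euclidean_space \<Rightarrow> 'a) \<in> borel \<rightarrow>\<^sub>M borel"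
  by (intro borel_measurable_continuous_onI continuous_intros)

lemma measurable_snd_euclidean [measurable]:
  "(snd :: 'a::euclidean_space \<times> 'b::euclidean_space \<Rightarrow> 'b) \<in> borel \<rightarrow>\<^sub>M borel"
  by (intro borel_measurable_continuous_onI continuous_intros)

lemma
  fixes f :: "'a::euclidean_space \<times> 'b::euclidean_space \<Rightarrow> ennreal"
  assumes "f \<in> borel_measurable borel"
  shows nn_integral_lborel_fst: "(\<integral>\<^sup>+p. f p \<partial>lborel) = (\<integral>\<^sup>+x. \<integral>\<^sup>+y. f (x, y) \<partial>lborel \<partial>lborel)"
    and nn_integral_lborel_snd: "(\<integral>\<^sup>+p. f p \<partial>lborel) = (\<integral>\<^sup>+y. \<integral>\<^sup>+x. f (x, y) \<partial>lborel \<partial>lborel)"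
proof -
  have [measurable]: "f \<in> borel_measurable (lborel \<Otimes>\<^sub>M lborel)" using assms by (simp add: lborel_prod)
  show "(\<integral>\<^sup>+p. f p \<partial>lborel) = (\<integral>\<^sup>+x. \<integral>\<^sup>+y. f (x, y) \<partial>lborel \<partial>lborel)"
    unfolding lborel_prod[symmetric] by (rule lborel.nn_integral_fst[symmetric]) measurable
  show "(\<integral>\<^sup>+p. f p \<partial>lborel) = (\<integral>\<^sup>+y. \<integral>\<^sup>+x. f (x, y) \<partial>lborel \<partial>lborel)"
    unfolding lborel_prod[symmetric] by (rule lborel_pair.nn_integral_snd[symmetric]) measurable
qed

text \<open>The standard symplectic map J with J J = -1 on real phase space. It acts inside each
  component of a complexified point, whereas \<open>rot\<close> exchanges the components up to sign;
  the twisting phase of the transform is a pairing with J.\<close>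

definition sympl :: "'a::real_vector \<times> 'a \<Rightarrow> 'a \<times> 'a" where
  "sympl a = (snd a, - fst a)"

lemma linear_sympl: "linear sympl"
  by (rule linearI) (auto simp: sympl_def)

lemma sympl_sympl [simp]: "sympl (sympl a) = - a"
  by (simp add: sympl_def prod_eq_iff)

lemma norm_sympl [simp]: "norm (sympl a) = norm a"
  by (simp add: sympl_def norm_prod_def add.commute)

lemma measurable_sympl [measurable]:
  "(sympl :: 'a::euclidean_space \<times> 'a \<Rightarrow> _) \<in> borel \<rightarrow>\<^sub>M borel"
  using linear_continuous_on[OF linear_conv_bounded_linear[THEN iffD1, OF linear_sympl]]
  by (intro borel_measurable_continuous_onI)

section \<open>The heat kernel constants, and kernel and weight in real coordinates\<close>

definition heat_const :: "real \<Rightarrow> real \<Rightarrow> nat \<Rightarrow> real" where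
  "heat_const lam s n = (4 * pi) powr (- real n) * (lam / sinh (s * lam)) ^ n"

definition heat_rate :: "real \<Rightarrow> real \<Rightarrow> real" where
  "heat_rate lam s = lam / 4 * (cosh (s * lam) / sinh (s * lam))"

lemma lam_div_sinh_pos:
  assumes "s > 0" "lam \<noteq> 0" shows "lam / sinh (s * lam) > (0::real)"
  using assms by (auto simp: zero_less_divide_iff zero_less_mult_iff mult_less_0_iff)

lemma heat_const_pos: "s > 0 \<Longrightarrow> lam \<noteq> 0 \<Longrightarrow> heat_const lam s n > 0"
  unfolding heat_const_def by (intro mult_pos_pos zero_less_power lam_div_sinh_pos) auto

lemma heat_rate_pos:
  assumes "s > 0" "lam \<noteq> 0" shows "heat_rate lam s > 0"
proof -
  have "heat_rate lam s = (lam / sinh (s * lam)) * (cosh (s * lam) / 4)" by (simp add: heat_rate_def)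
  moreover have "0 < cosh (s * lam) / 4" by simp
  ultimately show ?thesis using mult_pos_pos[OF lam_div_sinh_pos[OF assms]] by metis
qed

text \<open>This is cosh^2 - sinh^2 = 1. The right-hand side is positive, which makes
  \<open>twist\<close> invertible, and a power of it is the Jacobian of
  \<open>twist\<close>.\<close>

lemma heat_rate_sq:
  assumes "s > 0" "lam \<noteq> 0"
  shows "4 * (heat_rate lam s)\<^sup>2 - lam\<^sup>2 / 4 = (lam / (2 * sinh (s * lam)))\<^sup>2"
proof -
  have "sinh (s * lam) \<noteq> 0" using assms by simp
  then show ?thesis
    by (simp add: heat_rate_def field_simps power2_eq_square)
      (simp add: cosh_square_eq flip: power2_eq_square, simp add: algebra_simps power2_eq_square)
qed

text \<open>The duplication formula 2 coth 2x = coth x + tanh x. It turns the exponent of the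
  weighted transform into a perfect square.\<close>

lemma heat_rate_double:
  assumes "s > 0" "lam \<noteq> 0"
  shows "4 * heat_rate lam (2 * s) = 2 * heat_rate lam s + lam\<^sup>2 / (8 * heat_rate lam s)"
proof -
  have sc: "sinh (s * lam) \<noteq> 0" "cosh (s * lam) \<noteq> 0" using assms cosh_real_pos[of "s * lam"] by auto
  have "2 * s * lam = 2 * (s * lam)" by simp
  then have "heat_rate lam (2 * s) = lam / 4 * (((cosh (s * lam))\<^sup>2 + (sinh (s * lam))\<^sup>2) / (2 * sinh (s * lam) * cosh (s * lam)))"
    unfolding heat_rate_def by (simp only: sinh_double cosh_double)
  moreover have "2 * heat_rate lam s + lam\<^sup>2 / (8 * heat_rate lam s)
     = lam * (((cosh (s * lam))\<^sup>2 + (sinh (s * lam))\<^sup>2) / (2 * sinh (s * lam) * cosh (s * lam)))"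
    using sc assms unfolding heat_rate_def by (simp add: field_simps power2_eq_square)
  ultimately show ?thesis by simp
qed

lemma cdot_cv: "cdot (cv x y) (cv x' y') = Complex (x \<bullet> x' - y \<bullet> y') (x \<bullet> y' + y \<bullet> x')"
  by (simp add: cdot_def cv_def inner_vec_def complex_eq_iff sum_subtractf sum.distrib)

lemma cvec_eq_cv: "cvec x = cv x 0"
  by (simp add: cvec_def cv_def vec_eq_iff complex_eq_iff)

lemma cv_diff: "cv x y - cv x' y' = cv (x - x') (y - y')"
  by (simp add: cv_def vec_eq_iff complex_eq_iff)

lemma Re_vec_cv [simp]: "Re_vec (cv x y) = x" and Im_vec_cv [simp]: "Im_vec (cv x y) = y"
  by (simp_all add: Re_vec_def Im_vec_def cv_def vec_eq_iff)

lemma heat_p_eq: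
  fixes z w :: "complex^'n"
  shows "heat_p lam s z w = of_real (heat_const lam s CARD('n)) * exp (- of_real (heat_rate lam s) * (cdot z z + cdot w w))"
  by (simp add: heat_p_def heat_const_def heat_rate_def)

text \<open>On real vectors \<open>a = (x, u)\<close>, \<open>b = (y, v)\<close> this is the complex linear map
  \<open>(z, w) \<mapsto> (2cz - i(\<lambda>/2)w, 2cw + i(\<lambda>/2)z)\<close>.\<close>

definition twist :: "real \<Rightarrow> real \<Rightarrow> ('a::real_vector \<times> 'a) \<times> ('a \<times> 'a) \<Rightarrow> ('a \<times> 'a) \<times> ('a \<times> 'a)" where
  "twist lam c p = ((2 * c) *\<^sub>R fst p + (lam / 2) *\<^sub>R sympl (snd p), (2 * c) *\<^sub>R snd p - (lam / 2) *\<^sub>R sympl (fst p))"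

lemma linear_twist: "linear (twist lam c)"
  by (rule linearI) (auto simp: twist_def linear_add[OF linear_sympl] linear_cmul[OF linear_sympl] algebra_simps)

lemma twist_rot: "twist lam c (rot p) = rot (twist lam c p)"
  by (simp add: twist_def rot_def sympl_def prod_eq_iff)

text \<open>When the quadratic form is expanded, the terms free of the integration variable make up
  \<open>csq\<close>, while the mixed terms and the twisting phase are both linear in that variable
  and merge into \<open>twist\<close>.\<close>

lemma twisted_heat_cplx:
  fixes f :: "(real^'n) \<times> (real^'n) \<Rightarrow> complex"
  shows "twisted_heat lam t f (cplx p) = of_real (heat_const lam t CARD('n))
     * exp (- of_real (heat_rate lam t) * csq p) * gauss_laplace (heat_rate lam t) f (twist lam (heat_rate lam t) p)"
proof -
  obtain x u y v where p: "p = ((x, u), (y, v))" by (metis prod.exhaust)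
  let ?C = "complex_of_real (heat_const lam t CARD('n))" and ?c = "heat_rate lam t"
  have e: "f (x', u') * heat_p lam t (cv x y - cvec x') (cv u v - cvec u') *
      exp (- \<i> * complex_of_real lam / 2 * (cdot (cvec x') (cv u v) - cdot (cvec u') (cv x y)))
    = ?C * exp (- of_real ?c * csq p) * (f (x', u') * exp (cinner (x', u') (twist lam ?c p) - of_real (?c * (norm (x', u'))\<^sup>2)))"
    for x' u'
  proof -
    have "- of_real ?c * (cdot (cv x y - cvec x') (cv x y - cvec x') + cdot (cv u v - cvec u') (cv u v - cvec u'))
        + - \<i> * complex_of_real lam / 2 * (cdot (cvec x') (cv u v) - cdot (cvec u') (cv x y))
      = - of_real ?c * csq p + (cinner (x', u') (twist lam ?c p) - of_real (?c * (norm (x', u'))\<^sup>2))"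
      unfolding cvec_eq_cv cv_diff cdot_cv csq_def cinner_def twist_def sympl_def p power2_norm_eq_inner
      by (simp add: complex_eq_iff inner_diff inner_add inner_commute algebra_simps)
    from arg_cong[OF this, of exp] show ?thesis
      unfolding heat_p_eq exp_add by (simp add: mult_ac)
  qed
  have cp: "cplx p = (cv x y, cv u v)" by (simp add: cplx_def p)
  show ?thesis
    unfolding twisted_heat_def cp prod.case e gauss_laplace_def integral_mult_right_zero[symmetric]
    by (simp only: case_prod_unfold prod.collapse)
qed

lemma bergman_weight_cplx:
  fixes p :: "((real^'n) \<times> (real^'n)) \<times> ((real^'n) \<times> (real^'n))"
  shows "bergman_weight lam t (cplx p) = 4 ^ CARD('n) * heat_const lam (2 * t) CARD('n)
     * exp (- lam * (fst p \<bullet> sympl (snd p)) - 4 * heat_rate lam (2 * t) * (norm (snd p))\<^sup>2)"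
proof -
  obtain x u y v where p: "p = ((x, u), (y, v))" by (metis prod.exhaust)
  let ?c = "heat_rate lam (2 * t)"
  have "- of_real ?c * (cdot (cv (2 *\<^sub>R y) 0) (cv (2 *\<^sub>R y) 0) + cdot (cv (2 *\<^sub>R v) 0) (cv (2 *\<^sub>R v) 0))
      = complex_of_real (- 4 * ?c * (norm (y, v))\<^sup>2)"
    unfolding cdot_cv power2_norm_eq_inner by (simp add: complex_eq_iff)
  then have "Re (heat_p lam (2 * t) (cvec (2 *\<^sub>R y)) (cvec (2 *\<^sub>R v))) = heat_const lam (2 * t) CARD('n) * exp (- 4 * ?c * (norm (y, v))\<^sup>2)"
    unfolding heat_p_eq cvec_eq_cv by (simp only: exp_of_real of_real_mult[symmetric] Re_complex_of_real)
  then have "bergman_weight lam t (cplx p) = 4 ^ CARD('n) * exp (lam * (u \<bullet> y - v \<bullet> x)) * (heat_const lam (2 * t) CARD('n) * exp (- 4 * ?c * (norm (y, v))\<^sup>2))"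
    by (simp add: bergman_weight_def cplx_def p)
  also have "\<dots> = 4 ^ CARD('n) * heat_const lam (2 * t) CARD('n) * exp (lam * (u \<bullet> y - v \<bullet> x) + - 4 * ?c * (norm (y, v))\<^sup>2)"
    unfolding exp_add by (simp only: mult_ac)
  also have "lam * (u \<bullet> y - v \<bullet> x) + - 4 * ?c * (norm (y, v))\<^sup>2 = - lam * (fst p \<bullet> sympl (snd p)) - 4 * ?c * (norm (snd p))\<^sup>2"
    by (simp add: p sympl_def inner_commute algebra_simps)
  finally show ?thesis .
qed

lemma entire_twisted_heat:
  fixes f :: "(real^'n) \<times> (real^'n) \<Rightarrow> complex"
  assumes "t > 0" "lam \<noteq> 0" and f: "sq_integrable lborel f"
  shows "entire_fun (twisted_heat lam t f)"
proof -
  have c: "heat_rate lam t > 0" by (rule heat_rate_pos) fact+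
  have "holo (\<lambda>p. gauss_laplace (heat_rate lam t) f (0 + twist lam (heat_rate lam t) p))"
    by (intro holo_compose_linear holo_gauss_laplace[OF c f] linear_twist twist_rot)
  then show ?thesis
    unfolding entire_fun_iff_holo o_def twisted_heat_cplx add_0
    by (intro holo_mult holo_const holo_exp holo_csq)
qed

text \<open>For fixed real part \<xi>, the dependence on \<eta> is a Fourier transform of
  \<open>f\<close> times a real exponential and a Gaussian, a product that lies in both L1 and
  L2.\<close>

lemma gauss_laplace_plancherel:
  fixes f :: "'a::euclidean_space \<Rightarrow> complex"
  assumes c: "c > 0" and f: "sq_integrable lborel f"
  shows "(\<integral>\<^sup>+\<eta>. ennreal ((cmod (gauss_laplace c f (\<xi>, \<eta>)))\<^sup>2) \<partial>lborel)
    = ennreal ((2 * pi) ^ DIM('a)) * (\<integral>\<^sup>+q. ennreal ((cmod (f q))\<^sup>2 * exp (2 * (q \<bullet> \<xi> - c * (norm q)\<^sup>2))) \<partial>lborel)"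
proof -
  have [measurable]: "f \<in> borel_measurable borel" using f by (auto simp: sq_integrable_def)
  define g where "g q = f q * of_real (exp (q \<bullet> \<xi> - c * (norm q)\<^sup>2))" for q
  have e: "exp (cinner q (\<xi>, \<eta>) - of_real (c * (norm q)\<^sup>2)) = of_real (exp (q \<bullet> \<xi> - c * (norm q)\<^sup>2)) * cis (q \<bullet> \<eta>)" for q \<eta>
  proof -
    have "cinner q (\<xi>, \<eta>) - of_real (c * (norm q)\<^sup>2) = of_real (q \<bullet> \<xi> - c * (norm q)\<^sup>2) + \<i> * of_real (q \<bullet> \<eta>)"
      by (simp add: cinner_def complex_eq_iff)
    then show ?thesis by (simp only: exp_of_real[symmetric] cis_conv_exp exp_add)
  qed
  have "integrable lborel g"
    using gauss_laplace_integrable[OF c f, of "(\<xi>, 0)"] unfolding e g_def by simp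
  moreover have g2: "sq_integrable lborel g"
  proof (rule sq_integrableI_bound)
    show "g \<in> borel_measurable lborel" unfolding g_def[abs_def] by measurable
    show "integrable lborel (\<lambda>q. (cmod (f q))\<^sup>2 * exp ((norm \<xi>)\<^sup>2 / (2 * c)))"
      using f by (auto simp: sq_integrable_def)
    fix q
    have "q \<bullet> \<xi> \<le> norm q * norm \<xi>" by (rule norm_cauchy_schwarz)
    \<comment> \<open>Completing the square bounds the exponential factor uniformly in
      \<open>q\<close>.\<close>
    moreover have "0 \<le> (2 * c * norm q - norm \<xi>)\<^sup>2 / (2 * c)" using c by simp
    then have "0 \<le> 2 * c * (norm q)\<^sup>2 - 2 * (norm q * norm \<xi>) + (norm \<xi>)\<^sup>2 / (2 * c)"
      using c by (simp add: power2_eq_square field_simps)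
    ultimately have "2 * (q \<bullet> \<xi> - c * (norm q)\<^sup>2) \<le> (norm \<xi>)\<^sup>2 / (2 * c)"
      unfolding right_diff_distrib by linarith
    then have "exp (2 * (q \<bullet> \<xi> - c * (norm q)\<^sup>2)) \<le> exp ((norm \<xi>)\<^sup>2 / (2 * c))" by simp
    then show "(cmod (g q))\<^sup>2 \<le> (cmod (f q))\<^sup>2 * exp ((norm \<xi>)\<^sup>2 / (2 * c))"
      unfolding g_def norm_mult power_mult_distrib norm_of_real abs_exp_cancel exp_double[symmetric]
      by (rule mult_left_mono) simp
  qed
  moreover have "fourier g \<eta> = gauss_laplace c f (\<xi>, \<eta>)" for \<eta>
    unfolding fourier_def gauss_laplace_def e g_def by (simp add: mult_ac)
  ultimately have "(\<integral>\<^sup>+\<eta>. ennreal ((cmod (gauss_laplace c f (\<xi>, \<eta>)))\<^sup>2) \<partial>lborel) = ennreal ((2 * pi) ^ DIM('a) * l2_normsq lborel g)"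
    using plancherel[of g] by simp
  also have "\<dots> = ennreal ((2 * pi) ^ DIM('a)) * (\<integral>\<^sup>+q. ennreal ((cmod (g q))\<^sup>2) \<partial>lborel)"
    unfolding nn_integral_eq_l2_normsq[OF g2] by (rule ennreal_mult) auto
  finally show ?thesis
    unfolding g_def norm_mult power_mult_distrib norm_of_real abs_exp_cancel exp_double[symmetric] .
qed

text \<open>The weight in \<xi> is matched to the Gaussian: integrating
  \<open>exp (2 * (q \<bullet> \<xi> - c * (norm q)\<^sup>2))\<close> against it over \<xi> gives a
  constant independent of \<open>q\<close>, so the norm of \<open>f\<close> comes out
  unweighted.\<close>

lemma gauss_laplace_isometry:
  fixes f :: "'a::euclidean_space \<Rightarrow> complex"
  assumes c: "c > 0" and f: "sq_integrable lborel f"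
  shows "(\<integral>\<^sup>+\<zeta>. ennreal ((cmod (gauss_laplace c f \<zeta>))\<^sup>2 * exp (- (norm (fst \<zeta>))\<^sup>2 / (2 * c))) \<partial>lborel)
    = ennreal ((2 * pi) ^ DIM('a) * sqrt (2 * pi * c) ^ DIM('a)) * (\<integral>\<^sup>+q. ennreal ((cmod (f q))\<^sup>2) \<partial>lborel)"
proof -
  have [measurable]: "f \<in> borel_measurable borel" using f by (auto simp: sq_integrable_def)
  have Tm: "gauss_laplace c f \<in> borel_measurable borel"
    by (rule holo_measurable[OF holo_gauss_laplace[OF c f]])
  then have [measurable]: "gauss_laplace c f \<in> borel_measurable (borel \<Otimes>\<^sub>M borel)" by (simp add: borel_prod)
  let ?w = "\<lambda>\<xi>::'a. exp (- (norm \<xi>)\<^sup>2 / (2 * c))"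
  have "(\<integral>\<^sup>+\<zeta>. ennreal ((cmod (gauss_laplace c f \<zeta>))\<^sup>2 * ?w (fst \<zeta>)) \<partial>lborel)
     = (\<integral>\<^sup>+\<xi>. \<integral>\<^sup>+\<eta>. ennreal ((cmod (gauss_laplace c f (\<xi>, \<eta>)))\<^sup>2 * ?w \<xi>) \<partial>lborel \<partial>lborel)"
    using Tm by (subst nn_integral_lborel_fst) simp_all
  also have "\<dots> = (\<integral>\<^sup>+\<xi>. (\<integral>\<^sup>+\<eta>. ennreal ((cmod (gauss_laplace c f (\<xi>, \<eta>)))\<^sup>2) \<partial>lborel) * ennreal (?w \<xi>) \<partial>lborel)"
    by (intro nn_integral_cong, subst nn_integral_multc[symmetric]) (auto simp: ennreal_mult)
  also have "\<dots> = (\<integral>\<^sup>+\<xi>. ennreal ((2 * pi) ^ DIM('a)) * (\<integral>\<^sup>+q. ennreal ((cmod (f q))\<^sup>2) * ennreal (exp (2 * (q \<bullet> \<xi> - c * (norm q)\<^sup>2)) * ?w \<xi>) \<partial>lborel) \<partial>lborel)"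
    unfolding gauss_laplace_plancherel[OF c f] mult.assoc
    by (intro nn_integral_cong arg_cong[where f = "(*) _"], subst nn_integral_multc[symmetric])
      (auto simp: ennreal_mult mult.assoc)
  also have "\<dots> = ennreal ((2 * pi) ^ DIM('a)) * (\<integral>\<^sup>+\<xi>. (\<integral>\<^sup>+q. ennreal ((cmod (f q))\<^sup>2) * ennreal (exp (2 * (q \<bullet> \<xi> - c * (norm q)\<^sup>2)) * ?w \<xi>) \<partial>lborel) \<partial>lborel)"
    by (rule nn_integral_cmult) measurable
  also have "(\<integral>\<^sup>+\<xi>. (\<integral>\<^sup>+q. ennreal ((cmod (f q))\<^sup>2) * ennreal (exp (2 * (q \<bullet> \<xi> - c * (norm q)\<^sup>2)) * ?w \<xi>) \<partial>lborel) \<partial>lborel)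
     = (\<integral>\<^sup>+q. (\<integral>\<^sup>+\<xi>. ennreal ((cmod (f q))\<^sup>2) * ennreal (exp (2 * (q \<bullet> \<xi> - c * (norm q)\<^sup>2)) * ?w \<xi>) \<partial>lborel) \<partial>lborel)"
    by (rule lborel_pair.Fubini') measurable
  also have "\<dots> = (\<integral>\<^sup>+q. ennreal (sqrt (2 * pi * c) ^ DIM('a)) * ennreal ((cmod (f q))\<^sup>2) \<partial>lborel)"
  proof (rule nn_integral_cong)
    fix q :: 'a
    have \<alpha>: "1 / (2 * c) > 0" using c by simp
    have e: "exp (2 * (q \<bullet> \<xi> - c * (norm q)\<^sup>2)) * ?w \<xi> = exp (- 2 * c * (norm q)\<^sup>2) * exp (\<xi> \<bullet> (2 *\<^sub>R q) - 1 / (2 * c) * (norm \<xi>)\<^sup>2)" for \<xi>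
      unfolding exp_add[symmetric] by (simp add: inner_commute algebra_simps)
    have "(\<integral>\<^sup>+\<xi>. ennreal (exp (2 * (q \<bullet> \<xi> - c * (norm q)\<^sup>2)) * ?w \<xi>) \<partial>lborel)
       = ennreal (\<integral>\<xi>. exp (2 * (q \<bullet> \<xi> - c * (norm q)\<^sup>2)) * ?w \<xi> \<partial>lborel)"
      unfolding e using gaussian_abs_integrable[OF \<alpha>, of "2 *\<^sub>R q"]
      by (intro nn_integral_eq_integral integrable_mult_right) auto
    also have "(\<integral>\<xi>. exp (2 * (q \<bullet> \<xi> - c * (norm q)\<^sup>2)) * ?w \<xi> \<partial>lborel)
      = exp (- 2 * c * (norm q)\<^sup>2) * (sqrt (pi / (1 / (2 * c))) ^ DIM('a) * exp ((norm (2 *\<^sub>R q))\<^sup>2 / (4 * (1 / (2 * c)))))"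
      unfolding e gaussian_abs_integral[OF \<alpha>, symmetric] by simp
    also have "(norm (2 *\<^sub>R q))\<^sup>2 / (4 * (1 / (2 * c))) = 2 * c * (norm q)\<^sup>2"
      using c by (simp add: power_mult_distrib)
    also have "exp (- 2 * c * (norm q)\<^sup>2) * (sqrt (pi / (1 / (2 * c))) ^ DIM('a) * exp (2 * c * (norm q)\<^sup>2)) = sqrt (2 * pi * c) ^ DIM('a)"
      by (simp add: exp_minus field_simps)
    finally show "(\<integral>\<^sup>+\<xi>. ennreal ((cmod (f q))\<^sup>2) * ennreal (exp (2 * (q \<bullet> \<xi> - c * (norm q)\<^sup>2)) * ?w \<xi>) \<partial>lborel)
       = ennreal (sqrt (2 * pi * c) ^ DIM('a)) * ennreal ((cmod (f q))\<^sup>2)"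
      by (subst nn_integral_cmult) (auto simp: mult.commute)
  qed
  also have "\<dots> = ennreal (sqrt (2 * pi * c) ^ DIM('a)) * (\<integral>\<^sup>+q. ennreal ((cmod (f q))\<^sup>2) \<partial>lborel)"
    by (rule nn_integral_cmult) measurable
  finally show ?thesis
    using c by (simp add: ennreal_mult mult.assoc)
qed

text \<open>Block elimination in place of a determinant: once \<open>a\<close> is expressed through
  the first component \<xi>, the second component of \<open>twist\<close> is a multiple of
  \<open>sympl \<xi>\<close> plus a multiple of \<open>b\<close>, so two affine substitutions, one
  in each variable, suffice.\<close>

lemma nn_integral_twist:
  fixes M :: "('b::euclidean_space \<times> 'b) \<times> ('b \<times> 'b) \<Rightarrow> ennreal"
  assumes M [measurable]: "M \<in> borel_measurable borel" and c: "c > 0" and \<mu>: "2 * c - lam\<^sup>2 / (8 * c) > 0"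
  shows "(\<integral>\<^sup>+\<zeta>. M \<zeta> \<partial>lborel) = ennreal ((4 * c\<^sup>2 - lam\<^sup>2 / 4) ^ DIM('b \<times> 'b)) * (\<integral>\<^sup>+p. M (twist lam c p) \<partial>lborel)"
proof -
  \<comment> \<open>The coefficient of \<open>b\<close> that is left after the elimination of
    \<open>a\<close>, a Schur complement; its product with \<open>2 * c\<close> is
    \<open>4 * c\<^sup>2 - lam\<^sup>2 / 4\<close>.\<close>
  define \<mu> where "\<mu> = 2 * c - lam\<^sup>2 / (8 * c)"
  let ?d = "DIM('b \<times> 'b)"
  have \<mu>0: "\<mu> > 0" using \<mu> by (simp add: \<mu>_def)
  have [measurable]: "M \<in> borel_measurable (borel \<Otimes>\<^sub>M borel)" using M by (simp add: borel_prod)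
  have tw [measurable]: "twist lam c \<in> borel \<rightarrow>\<^sub>M (borel :: (('b \<times> 'b) \<times> ('b \<times> 'b)) measure)"
    using linear_continuous_on[OF linear_conv_bounded_linear[THEN iffD1, OF linear_twist]]
    by (intro borel_measurable_continuous_onI)
  have "(\<lambda>p. M (twist lam c p)) \<in> borel_measurable borel" by measurable
  then have [measurable]: "(\<lambda>p. M (twist lam c p)) \<in> borel_measurable (borel \<Otimes>\<^sub>M borel)" by (simp add: borel_prod)
  have "(\<integral>\<^sup>+\<zeta>. M \<zeta> \<partial>lborel) = (\<integral>\<^sup>+\<xi>. \<integral>\<^sup>+\<eta>. M (\<xi>, \<eta>) \<partial>lborel \<partial>lborel)"
    by (rule nn_integral_lborel_fst[OF M])
  also have "\<dots> = (\<integral>\<^sup>+\<xi>. ennreal (\<bar>\<mu>\<bar> ^ ?d) * (\<integral>\<^sup>+b. M (\<xi>, - (lam / (4 * c)) *\<^sub>R sympl \<xi> + \<mu> *\<^sub>R b) \<partial>lborel) \<partial>lborel)"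
    by (intro nn_integral_cong nn_integral_lborel_affine) (use \<mu>0 in auto)
  also have "\<dots> = ennreal (\<mu> ^ ?d) * (\<integral>\<^sup>+\<xi>. (\<integral>\<^sup>+b. M (\<xi>, - (lam / (4 * c)) *\<^sub>R sympl \<xi> + \<mu> *\<^sub>R b) \<partial>lborel) \<partial>lborel)"
    using \<mu>0 by (subst nn_integral_cmult) auto
  also have "(\<integral>\<^sup>+\<xi>. (\<integral>\<^sup>+b. M (\<xi>, - (lam / (4 * c)) *\<^sub>R sympl \<xi> + \<mu> *\<^sub>R b) \<partial>lborel) \<partial>lborel)
     = (\<integral>\<^sup>+b. (\<integral>\<^sup>+\<xi>. M (\<xi>, - (lam / (4 * c)) *\<^sub>R sympl \<xi> + \<mu> *\<^sub>R b) \<partial>lborel) \<partial>lborel)"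
    by (rule lborel_pair.Fubini') measurable
  also have "\<dots> = (\<integral>\<^sup>+b. ennreal ((2 * c) ^ ?d) * (\<integral>\<^sup>+a. M (twist lam c (a, b)) \<partial>lborel) \<partial>lborel)"
  proof (rule nn_integral_cong)
    fix b :: "'b \<times> 'b"
    have "(\<integral>\<^sup>+\<xi>. M (\<xi>, - (lam / (4 * c)) *\<^sub>R sympl \<xi> + \<mu> *\<^sub>R b) \<partial>lborel)
      = ennreal (\<bar>2 * c\<bar> ^ ?d) * (\<integral>\<^sup>+a. M ((lam / 2) *\<^sub>R sympl b + (2 * c) *\<^sub>R a,
          - (lam / (4 * c)) *\<^sub>R sympl ((lam / 2) *\<^sub>R sympl b + (2 * c) *\<^sub>R a) + \<mu> *\<^sub>R b) \<partial>lborel)"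
      by (rule nn_integral_lborel_affine) (use c in auto)
    moreover have "- (lam / (4 * c)) *\<^sub>R sympl ((lam / 2) *\<^sub>R sympl b + (2 * c) *\<^sub>R a) + \<mu> *\<^sub>R b
        = (2 * c) *\<^sub>R b - (lam / 2) *\<^sub>R sympl a" for a
    proof -
      have "- (lam / (4 * c)) *\<^sub>R sympl ((lam / 2) *\<^sub>R sympl b + (2 * c) *\<^sub>R a) + \<mu> *\<^sub>R b
        = (lam / (4 * c) * (lam / 2) + \<mu>) *\<^sub>R b - (lam / (4 * c) * (2 * c)) *\<^sub>R sympl a"
        by (simp add: linear_add[OF linear_sympl] linear_cmul[OF linear_sympl] algebra_simps)
      moreover have "lam / (4 * c) * (lam / 2) + \<mu> = 2 * c" "lam / (4 * c) * (2 * c) = lam / 2"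
        using c by (auto simp: \<mu>_def power2_eq_square)
      ultimately show ?thesis by simp
    qed
    ultimately show "(\<integral>\<^sup>+\<xi>. M (\<xi>, - (lam / (4 * c)) *\<^sub>R sympl \<xi> + \<mu> *\<^sub>R b) \<partial>lborel)
      = ennreal ((2 * c) ^ ?d) * (\<integral>\<^sup>+a. M (twist lam c (a, b)) \<partial>lborel)"
      using c by (simp add: twist_def add.commute)
  qed
  also have "\<dots> = ennreal ((2 * c) ^ ?d) * (\<integral>\<^sup>+b. (\<integral>\<^sup>+a. M (twist lam c (a, b)) \<partial>lborel) \<partial>lborel)"
    by (rule nn_integral_cmult) measurable
  also have "(\<integral>\<^sup>+b. (\<integral>\<^sup>+a. M (twist lam c (a, b)) \<partial>lborel) \<partial>lborel) = (\<integral>\<^sup>+p. M (twist lam c p) \<partial>lborel)"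
    by (rule nn_integral_lborel_snd[symmetric]) measurable
  also have "ennreal (\<mu> ^ ?d) * (ennreal ((2 * c) ^ ?d) * (\<integral>\<^sup>+p. M (twist lam c p) \<partial>lborel))
      = ennreal ((\<mu> * (2 * c)) ^ ?d) * (\<integral>\<^sup>+p. M (twist lam c p) \<partial>lborel)"
    unfolding power_mult_distrib using \<mu>0 c by (subst ennreal_mult) (auto simp: mult.assoc)
  also have "\<mu> * (2 * c) = 4 * c\<^sup>2 - lam\<^sup>2 / 4"
    using c by (simp add: \<mu>_def field_simps power2_eq_square)
  finally show ?thesis .
qed

lemma measurable_uncplx [measurable]: "uncplx \<in> borel \<rightarrow>\<^sub>M borel"
  using linear_continuous_on[OF linear_conv_bounded_linear[THEN iffD1, OF linear_uncplx]]
  by (intro borel_measurable_continuous_onI)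

lemma measurable_bergman_weight [measurable]: "bergman_weight lam t \<in> borel_measurable borel"
proof -
  have e: "bergman_weight lam t = (\<lambda>p. bergman_weight lam t (cplx (uncplx p)))" by simp
  show ?thesis
    by (subst e, unfold bergman_weight_cplx) measurable
qed

lemma bergman_weight_pos:
  assumes "t > 0" "lam \<noteq> 0" shows "bergman_weight lam t p > 0"
  using assms bergman_weight_cplx[of lam t "uncplx p"] heat_const_pos[of "2 * t" lam] by simp

text \<open>The constants cancel: the prefactors of the transform and of the weight, times the
  constant of the Laplace isometry, give the Jacobian of \<open>twist\<close>.\<close>

lemma heat_const_identity:
  assumes "t > 0" "lam \<noteq> 0"
  shows "(heat_const lam t n)\<^sup>2 * (4 ^ n * heat_const lam (2 * t) n)
      * ((2 * pi) ^ (2 * n) * sqrt (2 * pi * heat_rate lam t) ^ (2 * n))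
    = (4 * (heat_rate lam t)\<^sup>2 - lam\<^sup>2 / 4) ^ (2 * n)"
proof -
  let ?s = "sinh (t * lam)" and ?h = "cosh (t * lam)"
  have sc: "?s \<noteq> 0" "?h \<noteq> 0" using assms cosh_real_pos[of "t * lam"] by auto
  have d: "sinh (2 * t * lam) = 2 * ?s * ?h"
    using sinh_double[of "t * lam"] by (simp add: mult.assoc)
  have hc: "heat_const lam s n = (lam / (4 * pi * sinh (s * lam))) ^ n" for s
    by (simp add: heat_const_def powr_minus powr_realpow power_divide power_mult_distrib field_simps)
  have r: "sqrt (2 * pi * heat_rate lam t) ^ (2 * n) = (2 * pi * heat_rate lam t) ^ n"
    using heat_rate_pos[OF assms] by (simp add: power_mult)
  have "(heat_const lam t n)\<^sup>2 * (4 ^ n * heat_const lam (2 * t) n)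
      * ((2 * pi) ^ (2 * n) * sqrt (2 * pi * heat_rate lam t) ^ (2 * n))
    = ((lam / (4 * pi * ?s))\<^sup>2 * (4 * (lam / (4 * pi * (2 * ?s * ?h)))) * ((2 * pi)\<^sup>2 * (2 * pi * heat_rate lam t))) ^ n"
    unfolding r unfolding hc d power_mult power_mult_distrib power2_eq_square ..
  also have "(lam / (4 * pi * ?s))\<^sup>2 * (4 * (lam / (4 * pi * (2 * ?s * ?h)))) * ((2 * pi)\<^sup>2 * (2 * pi * heat_rate lam t))
      = ((lam / (2 * ?s))\<^sup>2)\<^sup>2"
    unfolding heat_rate_def using sc by (simp add: field_simps power2_eq_square)
  finally show ?thesis
    unfolding heat_rate_sq[OF assms] power_mult[of _ 2 n] .
qed

lemma twisted_heat_weighted: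
  fixes f :: "(real^'n) \<times> (real^'n) \<Rightarrow> complex"
  assumes "t > 0" "lam \<noteq> 0"
  shows "(cmod (twisted_heat lam t f (cplx p)))\<^sup>2 * bergman_weight lam t (cplx p)
    = (heat_const lam t CARD('n))\<^sup>2 * (4 ^ CARD('n) * heat_const lam (2 * t) CARD('n))
      * ((cmod (gauss_laplace (heat_rate lam t) f (twist lam (heat_rate lam t) p)))\<^sup>2
         * exp (- (norm (fst (twist lam (heat_rate lam t) p)))\<^sup>2 / (2 * heat_rate lam t)))"
proof -
  define c where "c = heat_rate lam t"
  have c: "c > 0" unfolding c_def by (rule heat_rate_pos) fact+
  obtain a b where p: "p = (a, b)" by (cases p)
  have "(cmod (exp (- of_real c * csq p)))\<^sup>2 = exp (2 * (- c * ((norm a)\<^sup>2 - (norm b)\<^sup>2)))"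
    unfolding exp_double by (simp add: csq_def p)
  \<comment> \<open>Both sides are quadratic in \<open>(a, b)\<close>. On the right the coefficient
    of \<open>(norm b)\<^sup>2\<close> is \<open>- lam\<^sup>2 / (8 * c)\<close>; on the left it is
    \<open>2 * c - 4 * heat_rate lam (2 * t)\<close>, and \<open>heat_rate_double\<close> makes the
    two agree.\<close>
  moreover have "2 * (- c * ((norm a)\<^sup>2 - (norm b)\<^sup>2)) + (- lam * (a \<bullet> sympl b) - 4 * heat_rate lam (2 * t) * (norm b)\<^sup>2)
      = - (norm (fst (twist lam c p)))\<^sup>2 / (2 * c)"
  proof -
    have nf: "(norm (fst (twist lam c p)))\<^sup>2 = (2 * c)\<^sup>2 * (norm a)\<^sup>2 + 2 * c * lam * (a \<bullet> sympl b) + (lam / 2)\<^sup>2 * (norm b)\<^sup>2"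
    proof -
      have "(norm b)\<^sup>2 = sympl b \<bullet> sympl b" by (metis norm_sympl power2_norm_eq_inner)
      then show ?thesis
        unfolding twist_def p power2_norm_eq_inner[of "fst _"] power2_norm_eq_inner[of a]
        by (simp add: inner_add inner_commute power2_eq_square algebra_simps)
    qed
    show ?thesis
      unfolding nf heat_rate_double[OF assms] c_def[symmetric]
      using c by (simp add: field_simps power2_eq_square)
  qed
  ultimately have e: "(cmod (exp (- of_real c * csq p)))\<^sup>2 * exp (- lam * (a \<bullet> sympl b) - 4 * heat_rate lam (2 * t) * (norm b)\<^sup>2)
      = exp (- (norm (fst (twist lam c p)))\<^sup>2 / (2 * c))"
    by (simp only: exp_add[symmetric])
  show ?thesis
    unfolding twisted_heat_cplx bergman_weight_cplx c_def[symmetric] norm_mult power_mult_distrib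
      e[symmetric] norm_of_real power2_abs
    by (simp add: p mult_ac)
qed

text \<open>An identity of extended nonnegative integrals, so it also yields finiteness of the
  weighted norm of every transform.\<close>

lemma twisted_heat_isometry:
  fixes f :: "(real^'n) \<times> (real^'n) \<Rightarrow> complex"
  assumes t: "t > 0" "lam \<noteq> 0" and f: "sq_integrable lborel f"
  shows "(\<integral>\<^sup>+p. ennreal ((cmod (twisted_heat lam t f p))\<^sup>2 * bergman_weight lam t p) \<partial>lborel)
    = (\<integral>\<^sup>+x. ennreal ((cmod (f x))\<^sup>2) \<partial>lborel)"
proof -
  let ?n = "CARD('n)"
  define c where "c = heat_rate lam t"
  define A where "A = (heat_const lam t ?n)\<^sup>2 * (4 ^ ?n * heat_const lam (2 * t) ?n)"
  define E where "E = (2 * pi) ^ (2 * ?n) * sqrt (2 * pi * c) ^ (2 * ?n)"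
  define M where "M \<zeta> = ennreal ((cmod (gauss_laplace c f \<zeta>))\<^sup>2 * exp (- (norm (fst \<zeta>))\<^sup>2 / (2 * c)))" for \<zeta>
  have c: "c > 0" unfolding c_def by (rule heat_rate_pos) fact+
  have A: "A > 0" unfolding A_def using t by (intro mult_pos_pos zero_less_power heat_const_pos) auto
  have E: "E > 0" unfolding E_def using c by simp
  have Tm: "gauss_laplace c f \<in> borel_measurable borel"
    by (rule holo_measurable[OF holo_gauss_laplace[OF c f]])
  have Mm: "M \<in> borel_measurable borel"
    unfolding M_def[abs_def] using Tm by measurable
  have Hm: "twisted_heat lam t f \<in> borel_measurable borel"
    by (intro entire_fun_measurable entire_twisted_heat t f)
  have dim: "DIM((real^'n) \<times> (real^'n)) = 2 * ?n" by simp
  have \<mu>: "2 * c - lam\<^sup>2 / (8 * c) > 0"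
  proof -
    have "4 * c\<^sup>2 - lam\<^sup>2 / 4 > 0"
      unfolding c_def heat_rate_sq[OF t] using t by simp
    then have "(4 * c\<^sup>2 - lam\<^sup>2 / 4) / (2 * c) > 0" using c by simp
    also have "(4 * c\<^sup>2 - lam\<^sup>2 / 4) / (2 * c) = 2 * c - lam\<^sup>2 / (8 * c)"
      using c by (simp add: field_simps power2_eq_square)
    finally show ?thesis .
  qed
  have "(\<integral>\<^sup>+p. ennreal ((cmod (twisted_heat lam t f p))\<^sup>2 * bergman_weight lam t p) \<partial>lborel)
     = (\<integral>\<^sup>+p. ennreal ((cmod (twisted_heat lam t f (cplx p)))\<^sup>2 * bergman_weight lam t (cplx p)) \<partial>lborel)"
    using Hm measurable_bergman_weight[of lam t, where ?'a = 'n]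
    by (intro nn_integral_cplx measurable_compose[OF _ measurable_ennreal] borel_measurable_times) auto
  also have "\<dots> = (\<integral>\<^sup>+p. ennreal A * M (twist lam c p) \<partial>lborel)"
    unfolding twisted_heat_weighted[OF t] c_def[symmetric] A_def[symmetric] M_def
    using A by (simp add: ennreal_mult)
  also have "\<dots> = ennreal A * (\<integral>\<^sup>+p. M (twist lam c p) \<partial>lborel)"
  proof (rule nn_integral_cmult)
    have "twist lam c \<in> borel \<rightarrow>\<^sub>M (borel :: (((real^'n) \<times> (real^'n)) \<times> ((real^'n) \<times> (real^'n))) measure)"
      using linear_continuous_on[OF linear_conv_bounded_linear[THEN iffD1, OF linear_twist]]
      by (intro borel_measurable_continuous_onI)
    then show "(\<lambda>p. M (twist lam c p)) \<in> borel_measurable lborel" using Mm by measurable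
  qed
  finally have 1: "(\<integral>\<^sup>+p. ennreal ((cmod (twisted_heat lam t f p))\<^sup>2 * bergman_weight lam t p) \<partial>lborel)
     = ennreal A * (\<integral>\<^sup>+p. M (twist lam c p) \<partial>lborel)" .
  \<comment> \<open>\<open>A * E\<close> is the Jacobian of \<open>twist\<close>, so the integral
    over \<open>p\<close> becomes one over \<zeta>; the remaining positive factor \<open>E\<close>
    then cancels.\<close>
  have "ennreal (A * E) * (\<integral>\<^sup>+p. M (twist lam c p) \<partial>lborel) = (\<integral>\<^sup>+\<zeta>. M \<zeta> \<partial>lborel)"
    unfolding nn_integral_twist[OF Mm c \<mu>] dim A_def E_def c_def heat_const_identity[OF t] ..
  also have "\<dots> = ennreal E * (\<integral>\<^sup>+x. ennreal ((cmod (f x))\<^sup>2) \<partial>lborel)"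
    unfolding M_def gauss_laplace_isometry[OF c f] dim E_def ..
  finally have "ennreal E * (ennreal A * (\<integral>\<^sup>+p. M (twist lam c p) \<partial>lborel)) = ennreal E * (\<integral>\<^sup>+x. ennreal ((cmod (f x))\<^sup>2) \<partial>lborel)"
    using A E by (simp add: ennreal_mult mult_ac)
  with E show ?thesis
    unfolding 1 by (simp add: ennreal_mult_cancel_left)
qed

subsection \<open>Mean values over circles\<close>

lemma cscale_eq: "cscale w (a, b) = (Re w *\<^sub>R a - Im w *\<^sub>R b, Im w *\<^sub>R a + Re w *\<^sub>R b)"
  by (simp add: cscale_def rot_def algebra_simps)

lemma measurable_cscale [measurable]:
  "(cscale w :: 'a::euclidean_space \<times> 'a \<Rightarrow> _) \<in> borel \<rightarrow>\<^sub>M borel"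
proof -
  have "linear (cscale w :: 'a \<times> 'a \<Rightarrow> _)"
    by (rule linearI) (auto simp: cscale_def rot_def algebra_simps)
  from linear_continuous_on[OF linear_conv_bounded_linear[THEN iffD1, OF this]] show ?thesis
    by (intro borel_measurable_continuous_onI)
qed

text \<open>A rotation by an angle other than \<open>\<pi>\<close> is a product of three shears.\<close>

lemma nn_integral_cscale:
  fixes f :: "'a::euclidean_space \<times> 'a \<Rightarrow> ennreal"
  assumes f: "f \<in> borel_measurable borel" and w: "cmod w = 1" "w \<noteq> -1"
  shows "(\<integral>\<^sup>+p. f (cscale w p) \<partial>lborel) = (\<integral>\<^sup>+p. f p \<partial>lborel)"
proof -
  \<comment> \<open>Minus the tangent of half the angle. The outer two shears have this slope and
    the middle one has slope \<open>Im w\<close>; the denominator vanishes only for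
    \<open>w = -1\<close>.\<close>
  define \<tau> where "\<tau> = - (Im w / (1 + Re w))"
  have sq: "(Re w)\<^sup>2 + (Im w)\<^sup>2 = 1" using w by (simp add: cmod_power2[symmetric])
  have "1 + Re w \<noteq> 0"
  proof
    assume "1 + Re w = 0"
    then have "Re w = -1" by simp
    with sq have "Im w = 0" by simp
    with \<open>Re w = -1\<close> w show False by (simp add: complex_eq_iff)
  qed
  then have 1: "1 + \<tau> * Im w = Re w" "2 * \<tau> + Im w * \<tau>\<^sup>2 = - Im w"
  proof -
    assume n: "1 + Re w \<noteq> 0"
    have "(Im w)\<^sup>2 = (1 - Re w) * (1 + Re w)" using sq by (simp add: power2_eq_square algebra_simps)
    then show "1 + \<tau> * Im w = Re w" using n by (simp add: \<tau>_def field_simps power2_eq_square)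
    then have "\<tau> * (2 + \<tau> * Im w) = \<tau> * (1 + Re w)" by simp
    also have "\<dots> = - Im w" using n by (simp add: \<tau>_def)
    finally show "2 * \<tau> + Im w * \<tau>\<^sup>2 = - Im w" by (simp add: power2_eq_square algebra_simps)
  qed
  have shear1: "(\<integral>\<^sup>+p. g (fst p + s *\<^sub>R snd p, snd p) \<partial>lborel) = (\<integral>\<^sup>+p. g p \<partial>lborel)"
    if g: "g \<in> borel_measurable borel" for s and g :: "'a \<times> 'a \<Rightarrow> ennreal"
  proof -
    have [measurable]: "g \<in> borel_measurable (borel \<Otimes>\<^sub>M borel)" using g by (simp add: borel_prod)
    have m: "(\<lambda>p. g (fst p + s *\<^sub>R snd p, snd p)) \<in> borel_measurable borel" by measurable
    have "(\<integral>\<^sup>+p. g (fst p + s *\<^sub>R snd p, snd p) \<partial>lborel) = (\<integral>\<^sup>+b. \<integral>\<^sup>+a. g (s *\<^sub>R b + a, b) \<partial>lborel \<partial>lborel)"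
      by (subst nn_integral_lborel_snd[OF m]) (simp add: add.commute)
    also have "\<dots> = (\<integral>\<^sup>+b. \<integral>\<^sup>+a. g (a, b) \<partial>lborel \<partial>lborel)"
      by (intro nn_integral_cong nn_integral_lborel_shift) measurable
    finally show ?thesis by (simp add: nn_integral_lborel_snd[OF g])
  qed
  have shear2: "(\<integral>\<^sup>+p. g (fst p, snd p + s *\<^sub>R fst p) \<partial>lborel) = (\<integral>\<^sup>+p. g p \<partial>lborel)"
    if g: "g \<in> borel_measurable borel" for s and g :: "'a \<times> 'a \<Rightarrow> ennreal"
  proof -
    have [measurable]: "g \<in> borel_measurable (borel \<Otimes>\<^sub>M borel)" using g by (simp add: borel_prod)
    have m: "(\<lambda>p. g (fst p, snd p + s *\<^sub>R fst p)) \<in> borel_measurable borel" by measurable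
    have "(\<integral>\<^sup>+p. g (fst p, snd p + s *\<^sub>R fst p) \<partial>lborel) = (\<integral>\<^sup>+a. \<integral>\<^sup>+b. g (a, s *\<^sub>R a + b) \<partial>lborel \<partial>lborel)"
      by (subst nn_integral_lborel_fst[OF m]) (simp add: add.commute)
    also have "\<dots> = (\<integral>\<^sup>+a. \<integral>\<^sup>+b. g (a, b) \<partial>lborel \<partial>lborel)"
      by (intro nn_integral_cong nn_integral_lborel_shift) measurable
    finally show ?thesis by (simp add: nn_integral_lborel_fst[OF g])
  qed
  have fm [measurable]: "f \<in> borel_measurable (borel \<Otimes>\<^sub>M borel)" using f by (simp add: borel_prod)
  define f1 where "f1 p = f (fst p + \<tau> *\<^sub>R snd p, snd p)" for p
  define f2 where "f2 p = f1 (fst p, snd p + Im w *\<^sub>R fst p)" for p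
  have m1: "f1 \<in> borel_measurable borel" unfolding f1_def[abs_def] by measurable
  then have [measurable]: "f1 \<in> borel_measurable (borel \<Otimes>\<^sub>M borel)" by (simp add: borel_prod)
  have m2: "f2 \<in> borel_measurable borel" unfolding f2_def[abs_def] by measurable
  have "f (cscale w p) = f2 (fst p + \<tau> *\<^sub>R snd p, snd p)" for p
  proof -
    obtain a b where p: "p = (a, b)" by (cases p)
    have "Re w *\<^sub>R a - Im w *\<^sub>R b = (1 + \<tau> * Im w) *\<^sub>R a + (\<tau> + \<tau> + Im w * \<tau>\<^sup>2) *\<^sub>R b"
      using 1(1) unfolding mult_2[symmetric] 1(2) by simp
    also have "\<dots> = (a + \<tau> *\<^sub>R b) + \<tau> *\<^sub>R (b + Im w *\<^sub>R (a + \<tau> *\<^sub>R b))"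
      by (simp only: scaleR_add_left scaleR_add_right scaleR_scaleR scaleR_one power2_eq_square ac_simps)
    finally have "Re w *\<^sub>R a - Im w *\<^sub>R b = (a + \<tau> *\<^sub>R b) + \<tau> *\<^sub>R (b + Im w *\<^sub>R (a + \<tau> *\<^sub>R b))" .
    moreover have "Im w *\<^sub>R a + Re w *\<^sub>R b = b + Im w *\<^sub>R (a + \<tau> *\<^sub>R b)"
      unfolding 1(1)[symmetric] by (simp add: algebra_simps)
    ultimately show ?thesis by (simp add: cscale_eq p f1_def f2_def)
  qed
  then have "(\<integral>\<^sup>+p. f (cscale w p) \<partial>lborel) = (\<integral>\<^sup>+p. f2 p \<partial>lborel)"
    using shear1[OF m2, of \<tau>] by simp
  also have "\<dots> = (\<integral>\<^sup>+p. f1 p \<partial>lborel)"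
    unfolding f2_def by (rule shear2[OF m1])
  also have "\<dots> = (\<integral>\<^sup>+p. f p \<partial>lborel)"
    unfolding f1_def by (rule shear1[OF f])
  finally show ?thesis .
qed

lemma lborel_distr_cscale:
  assumes w: "cmod w = 1" "w \<noteq> -1"
  shows "distr lborel borel (cscale w :: 'a::euclidean_space \<times> 'a \<Rightarrow> _) = lborel"
proof (rule measure_eqI)
  fix A :: "('a \<times> 'a) set" assume "A \<in> sets (distr lborel borel (cscale w))"
  then have [measurable]: "A \<in> sets borel" by simp
  have "emeasure (distr lborel borel (cscale w)) A = (\<integral>\<^sup>+p. indicator A p \<partial>distr lborel borel (cscale w))"
    by simp
  also have "\<dots> = (\<integral>\<^sup>+p. indicator A (cscale w p) \<partial>lborel)" by (rule nn_integral_distr) auto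
  also have "\<dots> = (\<integral>\<^sup>+p. indicator A p \<partial>lborel)" by (rule nn_integral_cscale[OF _ w]) measurable
  finally show "emeasure (distr lborel borel (cscale w)) A = emeasure lborel A" by simp
qed simp

lemma integral_cscale:
  fixes f :: "'a::euclidean_space \<times> 'a \<Rightarrow> 'b::{banach,second_countable_topology}"
  assumes "f \<in> borel_measurable borel" "cmod w = 1" "w \<noteq> -1"
  shows "(\<integral>p. f (cscale w p) \<partial>lborel) = (\<integral>p. f p \<partial>lborel)"
  by (subst (2) lborel_distr_cscale[OF assms(2,3), symmetric]) (simp add: integral_distr assms(1))

lemma integrable_cscale:
  fixes f :: "'a::euclidean_space \<times> 'a \<Rightarrow> 'b::{banach,second_countable_topology}"
  assumes f: "integrable lborel f" and w: "cmod w = 1" "w \<noteq> -1"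
  shows "integrable lborel (\<lambda>p. f (cscale w p))"
proof -
  have [measurable]: "f \<in> borel_measurable borel" using f by auto
  show ?thesis using f
    by (subst (asm) lborel_distr_cscale[OF w, symmetric]) (simp add: integrable_distr_eq)
qed

text \<open>Cauchy's formula on the unit circle of the complex line through 0 and \<open>p\<close>,
  with the circle parametrized by [0, 1].\<close>

lemma holo_mean_value:
  assumes E: "holo E"
  shows "set_integrable lborel {0..1} (\<lambda>x. E (cscale (cis (2 * pi * x)) p))"
    and "(LINT x:{0..1}|lborel. E (cscale (cis (2 * pi * x)) p)) = E 0"
proof -
  define \<phi> where "\<phi> \<tau> = E (0 + cscale \<tau> p)" for \<tau>
  have hol: "\<phi> holomorphic_on UNIV" unfolding \<phi>_def by (rule holo_complex_line[OF E])
  have \<phi>0: "\<phi> 0 = E 0" by (simp add: \<phi>_def cscale_def)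
  have cont: "continuous_on UNIV \<phi>" by (rule holomorphic_on_imp_continuous_on[OF hol])
  have cont': "continuous_on {0..1} (\<lambda>x. \<phi> (cis (2 * pi * x)))"
    by (intro continuous_on_compose2[OF cont] continuous_intros) auto
  have si: "set_integrable lborel {0..1} (\<lambda>x. \<phi> (cis (2 * pi * x)))"
    by (rule borel_integrable_atLeastAtMost') (rule cont')
  then show "set_integrable lborel {0..1} (\<lambda>x. E (cscale (cis (2 * pi * x)) p))" by (simp add: \<phi>_def)
  have "((\<lambda>u. \<phi> u / (u - 0)) has_contour_integral (2 * of_real pi * \<i> * \<phi> 0)) (circlepath 0 1)"
    by (rule Cauchy_integral_circlepath_simple) (auto intro: holomorphic_on_subset[OF hol])
  then have "((\<lambda>x. \<phi> (circlepath 0 1 x) / circlepath 0 1 x * vector_derivative (circlepath 0 1) (at x))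
      has_integral (2 * of_real pi * \<i> * \<phi> 0)) {0..1}"
    by (simp add: has_contour_integral)
  moreover have "\<phi> (circlepath 0 1 x) / circlepath 0 1 x * vector_derivative (circlepath 0 1) (at x)
     = (2 * of_real pi * \<i>) * \<phi> (cis (2 * pi * x))" if "x \<in> {0..1}" for x
  proof -
    have "vector_derivative (circlepath 0 1) (at x) = 2 * pi * \<i> * exp (2 * of_real pi * \<i> * x)"
      by (simp add: vector_derivative_circlepath)
    moreover have "circlepath 0 1 x = exp (2 * of_real pi * \<i> * x)" by (simp add: circlepath)
    moreover have "exp (2 * of_real pi * \<i> * x) = cis (2 * pi * x)" by (simp add: cis_conv_exp mult_ac)
    ultimately show ?thesis by simp
  qed
  ultimately have "((\<lambda>x. (2 * of_real pi * \<i>) * \<phi> (cis (2 * pi * x))) has_integral (2 * of_real pi * \<i> * \<phi> 0)) {0..1}"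
    by (rule has_integral_eq[rotated])
  from has_integral_mult_right[OF this, of "1 / (2 * of_real pi * \<i>)"]
  have "((\<lambda>x. \<phi> (cis (2 * pi * x))) has_integral \<phi> 0) {0..1}" by simp
  then show "(LINT x:{0..1}|lborel. E (cscale (cis (2 * pi * x)) p)) = E 0"
    using set_borel_integral_eq_integral(2)[OF si] by (simp add: integral_unique \<phi>0) (simp add: \<phi>_def)
qed

text \<open>Averaging over rotations replaces \<open>E p\<close> by \<open>E 0\<close> without
  changing the integral, so \<open>E 0\<close> times the total mass of \<open>m\<close> is zero.
  That this mass is finite has to be derived, and it is the assumption \<open>E 0 \<noteq> 0\<close>
  that provides it; hence the argument by contradiction.\<close>

lemma circle_invariant_weight_mean:
  fixes E :: "'a::euclidean_space \<times> 'a \<Rightarrow> complex" and m :: "'a \<times> 'a \<Rightarrow> real"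
  assumes E: "holo E" and m [measurable]: "m \<in> borel_measurable borel" and pos: "\<And>p. m p > 0"
    and inv: "\<And>w p. cmod w = 1 \<Longrightarrow> m (cscale w p) = m p"
    and int: "integrable lborel (\<lambda>p. E p * of_real (m p))"
    and zero: "(\<integral>p. E p * of_real (m p) \<partial>lborel) = 0"
  shows "E 0 = 0"
proof (rule ccontr)
  assume E0: "E 0 \<noteq> 0"
  let ?w = "\<lambda>x::real. cis (2 * pi * x)"
  \<comment> \<open>Rotated copies of the integrand, indexed by the circle parameter: the integral
    over \<open>x\<close> is a mean value, the integral over \<open>p\<close> is invariant, and
    Fubini compares them.\<close>
  define F where "F x p = indicator {0..1} x *\<^sub>R (E (cscale (?w x) p) * of_real (m p))" for x :: real and p
  have Em [measurable]: "E \<in> borel_measurable borel" by (rule holo_measurable[OF E])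
  have w: "cmod (?w x) = 1" for x by simp
  \<comment> \<open>Invariance of the integral under rotation is available for
    \<open>w \<noteq> -1\<close>; on the circle this excludes the single parameter 1/2.\<close>
  have AEx: "AE x in lborel. x \<in> {0..1} \<longrightarrow> ?w x \<noteq> -1"
  proof -
    have "?w x \<noteq> -1" if "x \<in> {0..1}" "x \<noteq> 1/2" for x
    proof
      assume "?w x = -1"
      then have "cis (2 * pi * x) = cis pi" by (simp add: cis_pi)
      then have "cos (2 * pi * x) = -1" by (simp add: complex_eq_iff)
      then obtain k :: int where k: "2 * pi * x = (2 * k + 1) * pi"
        unfolding cos_eq_minus1 by (auto simp: algebra_simps)
      then have "2 * x = 2 * k + 1" by simp
      moreover have "k = 0"
      proof -
        have "2 * real_of_int k + 1 \<le> 2" "2 * real_of_int k + 1 \<ge> 0" using calculation that by auto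
        then show ?thesis by linarith
      qed
      ultimately show False using that by simp
    qed
    then show ?thesis using AE_lborel_singleton[of "1/2::real"] by (auto elim!: eventually_mono)
  qed
  have eq: "E (cscale (?w x) p) * of_real (m p) = (\<lambda>p. E p * of_real (m p)) (cscale (?w x) p)" for x p
    by (simp add: inv)
  have FI: "integrable lborel (F x)" and FN: "(\<integral>p. norm (F x p) \<partial>lborel) = indicator {0..1} x * (\<integral>p. norm (E p * of_real (m p)) \<partial>lborel)"
    and FZ: "(\<integral>p. F x p \<partial>lborel) = 0" if "x \<in> {0..1} \<longrightarrow> ?w x \<noteq> -1" for x
  proof -
    have "integrable lborel (F x) \<and> (\<integral>p. norm (F x p) \<partial>lborel) = indicator {0..1} x * (\<integral>p. norm (E p * of_real (m p)) \<partial>lborel)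
      \<and> (\<integral>p. F x p \<partial>lborel) = 0"
    proof (cases "x \<in> {0..1}")
      case True
      then have w1: "?w x \<noteq> -1" using that by blast
      have Fx: "F x p = (\<lambda>p. E p * of_real (m p)) (cscale (?w x) p)" for p
        using True unfolding F_def eq by simp
      have "integrable lborel (F x)"
        unfolding Fx[abs_def] by (rule integrable_cscale[OF int w w1])
      moreover have "(\<integral>p. norm (F x p) \<partial>lborel) = (\<integral>p. norm (E p * of_real (m p)) \<partial>lborel)"
        unfolding Fx by (rule integral_cscale[where f = "\<lambda>p. norm (E p * of_real (m p))", OF _ w w1]) measurable
      moreover have "(\<integral>p. F x p \<partial>lborel) = (\<integral>p. E p * of_real (m p) \<partial>lborel)"
        unfolding Fx by (rule integral_cscale[where f = "\<lambda>p. E p * of_real (m p)", OF _ w w1]) measurable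
      ultimately show ?thesis using True zero by simp
    qed (auto simp: F_def[abs_def])
    then show "integrable lborel (F x)" "(\<integral>p. norm (F x p) \<partial>lborel) = indicator {0..1} x * (\<integral>p. norm (E p * of_real (m p)) \<partial>lborel)"
      "(\<integral>p. F x p \<partial>lborel) = 0" by auto
  qed
  have Fm [measurable]: "(\<lambda>(x, p). F x p) \<in> borel_measurable (lborel \<Otimes>\<^sub>M lborel)"
  proof -
    have "continuous_on UNIV (\<lambda>z::real \<times> ('a \<times> 'a). E (cscale (?w (fst z)) (snd z)))"
      unfolding cscale_def rot_def
      by (intro continuous_on_compose2[OF holo_continuous[OF E]] continuous_intros) auto
    then have "(\<lambda>z::real \<times> ('a \<times> 'a). E (cscale (?w (fst z)) (snd z))) \<in> borel_measurable borel"
      by (rule borel_measurable_continuous_onI)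
    then have [measurable]: "(\<lambda>z::real \<times> ('a \<times> 'a). E (cscale (?w (fst z)) (snd z))) \<in> borel_measurable (lborel \<Otimes>\<^sub>M lborel)"
      by (simp add: lborel_prod)
    show ?thesis unfolding F_def case_prod_unfold by measurable
  qed
  have FF: "integrable (lborel \<Otimes>\<^sub>M lborel) (\<lambda>(x, p). F x p)"
  proof (rule lborel_pair.Fubini_integrable[OF Fm])
    show "AE x in lborel. integrable lborel (\<lambda>p. case (x, p) of (x, p) \<Rightarrow> F x p)"
      using AEx by eventually_elim (simp add: FI)
    have "integrable lborel (\<lambda>x::real. indicator {0..1} x * (\<integral>p. norm (E p * of_real (m p)) \<partial>lborel))"
      by simp
    moreover have "AE x in lborel. (\<integral>p. norm (F x p) \<partial>lborel) = indicator {0..1} x * (\<integral>p. norm (E p * of_real (m p)) \<partial>lborel)"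
      using AEx by eventually_elim (rule FN)
    ultimately show "integrable lborel (\<lambda>x. \<integral>p. norm (case (x, p) of (x, p) \<Rightarrow> F x p) \<partial>lborel)"
      by (subst integrable_cong_AE[where g = "\<lambda>x. indicator {0..1} x * (\<integral>p. norm (E p * of_real (m p)) \<partial>lborel)"]) auto
  qed
  have Fx: "(\<integral>x. F x p \<partial>lborel) = of_real (m p) * E 0" for p
  proof -
    have "(\<integral>x. F x p \<partial>lborel) = (LINT x:{0..1}|lborel. of_real (m p) * E (cscale (?w x) p))"
      unfolding F_def set_lebesgue_integral_def by (simp add: mult.commute)
    also have "\<dots> = of_real (m p) * E 0"
      by (simp add: holo_mean_value(2)[OF E])
    finally show ?thesis .
  qed
  have "integrable lborel (\<lambda>p. \<integral>x. F x p \<partial>lborel)"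
    using lborel_pair.integrable_snd[OF FF] by simp
  \<comment> \<open>Partial integrals of an integrable function are integrable; division by
    \<open>E 0\<close> leaves \<open>m\<close> itself.\<close>
  then have "integrable lborel (\<lambda>p. of_real (m p) * E 0)" by (simp only: Fx)
  from integrable_mult_left[OF this, of "1 / E 0"] have mi: "integrable lborel m"
    using E0 by (simp add: complex_of_real_integrable_eq)
  have "(\<integral>p. (\<integral>x. F x p \<partial>lborel) \<partial>lborel) = (\<integral>x. (\<integral>p. F x p \<partial>lborel) \<partial>lborel)"
    by (rule lborel_pair.Fubini_integral[OF FF])
  also have "\<dots> = (\<integral>x. 0 \<partial>(lborel :: real measure))"
  proof (rule integral_cong_AE)
    show "AE x in lborel. (\<integral>p. F x p \<partial>lborel) = 0"
      using AEx by eventually_elim (rule FZ)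
  qed auto
  finally have "(\<integral>p. m p \<partial>lborel) = 0"
    using E0 by (simp add: Fx)
  then have "AE p in lborel. m p = 0"
    using integral_nonneg_eq_0_iff_AE[OF mi] pos by (simp add: less_imp_le)
  then have "AE p in (lborel :: ('a \<times> 'a) measure). False"
    using pos by (auto elim!: eventually_mono simp: less_imp_neq[symmetric]) 
  then have "emeasure (lborel :: ('a \<times> 'a) measure) UNIV = 0"
    by (simp add: AE_iff_measurable[OF _ refl])
  then show False by simp
qed

subsection \<open>The orthogonal complement of the image\<close>

text \<open>With the weight packed into the measure, the general L2 lemmas apply to the Bergman
  space.\<close>

definition bergman_measure :: "real \<Rightarrow> real \<Rightarrow> ((complex^'n) \<times> (complex^'n)) measure" where
  "bergman_measure lam t = density lborel (\<lambda>p. ennreal (bergman_weight lam t p))"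

lemma measurable_bergman_measure [simp]:
  "borel_measurable (bergman_measure lam t) = borel_measurable borel"
  by (rule measurable_cong_sets) (simp_all add: bergman_measure_def)

lemma nn_integral_bergman_measure:
  assumes t: "t > 0" "lam \<noteq> 0" and [measurable]: "F \<in> borel_measurable borel"
  shows "(\<integral>\<^sup>+p. ennreal ((cmod (F p))\<^sup>2) \<partial>bergman_measure lam t)
    = (\<integral>\<^sup>+p. ennreal ((cmod (F p))\<^sup>2 * bergman_weight lam t p) \<partial>lborel)"
  unfolding bergman_measure_def using measurable_bergman_weight[of lam t]
  by (subst nn_integral_density) (auto simp: ennreal_mult' mult.commute less_imp_le[OF bergman_weight_pos[OF t]])

lemma bergman_space_iff:
  assumes "t > 0" "lam \<noteq> 0"
  shows "F \<in> bergman_space lam t \<longleftrightarrow> entire_fun F \<and> sq_integrable (bergman_measure lam t) F"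
proof (cases "entire_fun F")
  case True
  then have m: "F \<in> borel_measurable borel" by (rule entire_fun_measurable)
  then show ?thesis
    by (simp add: bergman_space_def sq_integrable_iff_nn_integral nn_integral_bergman_measure[OF assms])
qed (simp add: bergman_space_def)

lemma l2_inner_bergman:
  assumes t: "t > 0" "lam \<noteq> 0" and m: "F \<in> borel_measurable borel" "G \<in> borel_measurable borel"
  shows "l2_inner (bergman_measure lam t) F G = bergman_inner lam t F G"
  unfolding l2_inner_def bergman_inner_def bergman_measure_def
  using m measurable_bergman_weight[of lam t]
  by (subst integral_density) (auto simp: scaleR_conv_of_real mult.commute less_imp_le[OF bergman_weight_pos[OF t]])

lemma l2_normsq_bergman:
  assumes t: "t > 0" "lam \<noteq> 0" and m: "F \<in> borel_measurable borel"
  shows "l2_normsq (bergman_measure lam t) F = (bergman_norm lam t F)\<^sup>2"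
proof -
  have "l2_normsq (bergman_measure lam t) F = (\<integral>p. (cmod (F p))\<^sup>2 * bergman_weight lam t p \<partial>lborel)"
    unfolding l2_normsq_def bergman_measure_def
    using m measurable_bergman_weight[of lam t]
    by (subst integral_density) (auto simp: mult.commute less_imp_le[OF bergman_weight_pos[OF t]])
  moreover have "(\<integral>p. (cmod (F p))\<^sup>2 * bergman_weight lam t p \<partial>lborel) \<ge> 0"
    by (intro integral_nonneg_AE AE_I2 mult_nonneg_nonneg) (auto simp: less_imp_le[OF bergman_weight_pos[OF t]])
  ultimately show ?thesis by (simp add: bergman_norm_def)
qed

lemma inner_sympl: "a \<bullet> sympl b = - (sympl a \<bullet> b)"
  by (simp add: sympl_def inner_prod_def)

lemma inner_sympl_self [simp]: "a \<bullet> sympl a = 0" "sympl a \<bullet> a = 0"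
  by (simp_all add: sympl_def inner_prod_def inner_commute)

lemma inner_sympl_sympl [simp]: "sympl a \<bullet> sympl b = a \<bullet> b"
  by (simp add: sympl_def inner_prod_def)

text \<open>\<open>twist\<close> is conformal for the bilinear square, because the cross terms
  cancel by antisymmetry of \<open>sympl\<close>. Hence Gaussians in \<open>csq\<close> remain
  Gaussians in \<open>csq\<close> after the change of variable.\<close>

lemma csq_twist: "csq (twist lam c p) = of_real (4 * c\<^sup>2 - lam\<^sup>2 / 4) * csq p"
proof -
  obtain a b where p: "p = (a, b)" by (cases p)
  have 1: "sympl b \<bullet> a = - (b \<bullet> sympl a)" "a \<bullet> sympl b = - (b \<bullet> sympl a)" "sympl a \<bullet> b = b \<bullet> sympl a"
    using inner_sympl[of a b] inner_sympl[of b a] by (auto simp: inner_commute)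
  show ?thesis
    unfolding csq_def twist_def p power2_norm_eq_inner
    by (simp add: complex_eq_iff inner_add inner_diff 1 inner_commute[of b a])
      (simp add: field_simps power2_eq_square)
qed

text \<open>The transform intertwines twisted translations by real vectors with ordinary
  translations, up to an exponential holomorphic in \<open>p\<close>. The phase under the transform
  supplies the imaginary part of \<open>twist lam c (r, 0)\<close>.\<close>

lemma twisted_heat_translate:
  fixes f :: "(real^'n) \<times> (real^'n) \<Rightarrow> complex"
  assumes [measurable]: "f \<in> borel_measurable borel"
  shows "twisted_heat lam t (\<lambda>q. exp (- \<i> * of_real (lam / 2 * (r \<bullet> sympl q))) * f (q - r)) (cplx p)
    = exp (- \<i> * of_real (lam / 2) * cinner r (sympl (fst p), sympl (snd p))) * twisted_heat lam t f (cplx (p - (r, 0)))"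
proof -
  define c where "c = heat_rate lam t"
  obtain a b where p: "p = (a, b)" by (cases p)
  let ?k = "\<lambda>q. exp (- \<i> * of_real (lam / 2 * (r \<bullet> sympl q))) * f (q - r)"
  let ?\<zeta> = "twist lam c p" and ?\<zeta>' = "twist lam c (p - (r, 0))"
  have "gauss_laplace c ?k ?\<zeta> = (\<integral>s. ?k (r + s) * exp (cinner (r + s) ?\<zeta> - of_real (c * (norm (r + s))\<^sup>2)) \<partial>lborel)"
    unfolding gauss_laplace_def by (rule integral_lborel_shift[symmetric]) measurable
  also have "\<dots> = (\<integral>s. exp (cinner r ?\<zeta> - of_real (c * (norm r)\<^sup>2)) * (f s * exp (cinner s ?\<zeta>' - of_real (c * (norm s)\<^sup>2))) \<partial>lborel)"
  proof (rule Bochner_Integration.integral_cong[OF refl])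
    fix s
    have "- \<i> * of_real (lam / 2 * (r \<bullet> sympl (r + s))) + (cinner (r + s) ?\<zeta> - of_real (c * (norm (r + s))\<^sup>2))
      = (cinner r ?\<zeta> - of_real (c * (norm r)\<^sup>2)) + (cinner s ?\<zeta>' - of_real (c * (norm s)\<^sup>2))"
      unfolding cinner_def twist_def p power2_norm_eq_inner
      by (simp add: complex_eq_iff inner_add inner_diff linear_add[OF linear_sympl] linear_diff[OF linear_sympl]
          inner_sympl[of r] inner_commute[of r s] inner_commute[of "sympl r" s])
        (simp add: field_simps)
    from arg_cong[OF this, of exp] show "?k (r + s) * exp (cinner (r + s) ?\<zeta> - of_real (c * (norm (r + s))\<^sup>2))
      = exp (cinner r ?\<zeta> - of_real (c * (norm r)\<^sup>2)) * (f s * exp (cinner s ?\<zeta>' - of_real (c * (norm s)\<^sup>2)))"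
      unfolding exp_add by (simp add: mult_ac)
  qed
  also have "\<dots> = exp (cinner r ?\<zeta> - of_real (c * (norm r)\<^sup>2)) * gauss_laplace c f ?\<zeta>'"
    by (simp add: gauss_laplace_def)
  finally have g: "gauss_laplace c ?k ?\<zeta> = exp (cinner r ?\<zeta> - of_real (c * (norm r)\<^sup>2)) * gauss_laplace c f ?\<zeta>'" .
  have "- of_real c * csq p + (cinner r ?\<zeta> - of_real (c * (norm r)\<^sup>2))
     = - \<i> * of_real (lam / 2) * cinner r (sympl (fst p), sympl (snd p)) + - of_real c * csq (p - (r, 0))"
    unfolding cinner_def twist_def p power2_norm_eq_inner csq_def
    by (simp add: complex_eq_iff inner_add inner_diff inner_commute[of a r] inner_commute[of b r])
      (simp add: algebra_simps)
  from arg_cong[OF this, of exp] show ?thesis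
    unfolding twisted_heat_cplx c_def[symmetric] g exp_add by (simp add: mult_ac)
qed

text \<open>The input is a multiple of the heat kernel at time \<open>t\<close>, so the semigroup
  law predicts the rate of time \<open>2 * t\<close>; \<open>csq_twist\<close> and
  \<open>heat_rate_double\<close> confirm it.\<close>

lemma twisted_heat_gauss:
  assumes t: "t > 0" "lam \<noteq> 0"
  obtains K where "K > 0" "\<And>p. twisted_heat lam t
    (\<lambda>q::(real^'n) \<times> (real^'n). of_real (exp (- (heat_rate lam t * (norm q)\<^sup>2)))) (cplx p)
      = of_real K * exp (- of_real (heat_rate lam (2 * t)) * csq p)"
proof
  define c where "c = heat_rate lam t"
  have c: "c > 0" unfolding c_def by (rule heat_rate_pos[OF t])
  let ?d = "DIM((real^'n) \<times> (real^'n))"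
  show "heat_const lam t CARD('n) * sqrt (pi / (2 * c)) ^ ?d > 0"
    using heat_const_pos[OF t] c by simp
  fix p :: "((real^'n) \<times> (real^'n)) \<times> ((real^'n) \<times> (real^'n))"
  have "of_real (exp (- (c * (norm q)\<^sup>2))) * exp (cinner q \<zeta> - of_real (c * (norm q)\<^sup>2)) = exp (cinner q \<zeta> - of_real ((2 * c) * (norm q)\<^sup>2))"
    for q :: "(real^'n) \<times> (real^'n)" and \<zeta>
    unfolding exp_of_real[symmetric] exp_add[symmetric] by (simp add: algebra_simps)
  then have "gauss_laplace c (\<lambda>q. of_real (exp (- (c * (norm q)\<^sup>2)))) (twist lam c p)
     = of_real (sqrt (pi / (2 * c)) ^ ?d) * exp (csq (twist lam c p) / of_real (4 * (2 * c)))"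
    using gaussian_integral[of "2 * c" "twist lam c p"] c unfolding gauss_laplace_def csq_def by simp
  moreover have "- of_real c * csq p + csq (twist lam c p) / of_real (4 * (2 * c)) = - of_real (heat_rate lam (2 * t)) * csq p"
  proof -
    have "heat_rate lam (2 * t) = c - (4 * c\<^sup>2 - lam\<^sup>2 / 4) / (4 * (2 * c))"
      using heat_rate_double[OF t] c unfolding c_def[symmetric] by (simp add: field_simps power2_eq_square)
    then have h: "complex_of_real (heat_rate lam (2 * t)) = of_real c - of_real (4 * c\<^sup>2 - lam\<^sup>2 / 4) / of_real (4 * (2 * c))"
      by (simp only: of_real_diff of_real_divide)
    show ?thesis unfolding csq_twist h by (simp only: left_diff_distrib minus_diff_eq times_divide_eq_left) simp
  qed
  ultimately show "twisted_heat lam t (\<lambda>q. of_real (exp (- (heat_rate lam t * (norm q)\<^sup>2)))) (cplx p)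
     = of_real (heat_const lam t CARD('n) * sqrt (pi / (2 * c)) ^ ?d) * exp (- of_real (heat_rate lam (2 * t)) * csq p)"
    unfolding twisted_heat_cplx c_def[symmetric] by (simp only: exp_add[symmetric] of_real_mult mult_ac)
qed

lemma sq_integrable_gauss:
  fixes r :: "'a::euclidean_space"
  assumes c: "c > 0"
  shows "sq_integrable lborel (\<lambda>q::'a. complex_of_real (exp (- (c * (norm (q - r))\<^sup>2))))"
proof -
  have "integrable lborel (\<lambda>q::'a. exp (- ((2 * c) * (norm q)\<^sup>2)))"
    using gaussian_abs_integrable[of "2 * c" "0::'a"] c by simp
  from integrable_lborel_shift[OF this, of "- r"]
  have "integrable lborel (\<lambda>q::'a. exp (2 * - (c * (norm (q - r))\<^sup>2)))" by (simp add: mult.assoc)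
  then show ?thesis
    unfolding sq_integrable_def exp_double by simp
qed

lemma cscale_norm:
  fixes p :: "'a::euclidean_space \<times> 'a"
  assumes "cmod w = 1"
  shows "norm (cscale w p) = norm p"
proof -
  have sq: "(Re w)\<^sup>2 + (Im w)\<^sup>2 = 1" using assms by (simp add: cmod_power2[symmetric])
  obtain a b where p: "p = (a, b)" by (cases p)
  have "(norm (cscale w p))\<^sup>2 = ((Re w)\<^sup>2 + (Im w)\<^sup>2) * (norm p)\<^sup>2"
    unfolding p cscale_eq power2_norm_eq_inner
    by (simp add: inner_add inner_diff inner_commute[of b a]) (simp add: algebra_simps power2_eq_square)
  then show ?thesis using sq by simp
qed

text \<open>By antisymmetry the form is multiplied by the determinant of the rotation, which is
  1.\<close>

lemma cscale_sympl:
  assumes "cmod w = 1"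
  shows "fst (cscale w p) \<bullet> sympl (snd (cscale w p)) = fst p \<bullet> sympl (snd p)"
proof -
  have sq: "(Re w)\<^sup>2 + (Im w)\<^sup>2 = 1" using assms by (simp add: cmod_power2[symmetric])
  obtain a b where p: "p = (a, b)" by (cases p)
  have "b \<bullet> sympl a = - (a \<bullet> sympl b)" by (simp add: inner_sympl[of b a] inner_commute)
  then have "fst (cscale w p) \<bullet> sympl (snd (cscale w p)) = ((Re w)\<^sup>2 + (Im w)\<^sup>2) * (a \<bullet> sympl b)"
    unfolding p cscale_eq
    by (simp add: inner_add inner_diff linear_add[OF linear_sympl] linear_cmul[OF linear_sympl])
      (simp add: algebra_simps power2_eq_square)
  then show ?thesis using sq by (simp add: p)
qed

lemma bergman_orthogonal_zero:
  fixes G :: "(complex^'n) \<times> (complex^'n) \<Rightarrow> complex"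
  assumes t: "t > 0" "lam \<noteq> 0" and G: "G \<in> bergman_space lam t"
    and orth: "\<And>f. sq_integrable lborel f \<Longrightarrow> bergman_inner lam t G (twisted_heat lam t f) = 0"
  shows "G = (\<lambda>p. 0)"
proof -
  define c c2 where "c = heat_rate lam t" and "c2 = heat_rate lam (2 * t)"
  have c: "c > 0" unfolding c_def by (rule heat_rate_pos[OF t])
  define g where "g p = G (cplx p)" for p
  have Ge: "entire_fun G" and Gs: "sq_integrable (bergman_measure lam t) G"
    using G by (auto simp: bergman_space_iff[OF t])
  have g: "holo g" using Ge by (simp add: entire_fun_iff_holo g_def[abs_def] o_def)
  define k where "k q = complex_of_real (exp (- (c * (norm q)\<^sup>2)))" for q :: "(real^'n) \<times> (real^'n)"
  obtain K where K: "K > 0" and Hk: "\<And>p. twisted_heat lam t k (cplx p) = of_real K * exp (- of_real c2 * csq p)"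
    using twisted_heat_gauss[OF t, where ?'n = 'n] unfolding k_def[abs_def] c_def c2_def by blast
  have km: "k \<in> borel_measurable borel" unfolding k_def[abs_def] by measurable
  define w where "w p = exp (- lam * (fst p \<bullet> sympl (snd p)) - 4 * c2 * (norm (snd p))\<^sup>2)"
    for p :: "((real^'n) \<times> (real^'n)) \<times> ((real^'n) \<times> (real^'n))"
  define A where "A = 4 ^ CARD('n) * heat_const lam (2 * t) CARD('n)"
  have A: "A > 0" unfolding A_def using heat_const_pos[of "2 * t" lam] t by simp
  have W: "bergman_weight lam t (cplx p) = A * w p" for p :: "((real^'n) \<times> (real^'n)) \<times> ((real^'n) \<times> (real^'n))"
    unfolding bergman_weight_cplx A_def w_def c2_def ..
  have real_zero: "g (r, 0) = 0" for r
  proof -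
    \<comment> \<open>The Gaussian moved to \<open>r\<close> by a twisted translation. Its transform
      is a multiple of the complex Gaussian centred at the real point \<open>r\<close>, divided by
      the nowhere vanishing function \<open>ch\<close>.\<close>
    define kr where "kr q = exp (- \<i> * of_real (lam / 2 * (r \<bullet> sympl q))) * k (q - r)" for q
    define ch where "ch p = exp (\<i> * of_real (lam / 2) * cinner r (sympl (fst p), sympl (snd p)))"
      for p :: "((real^'n) \<times> (real^'n)) \<times> ((real^'n) \<times> (real^'n))"
    have krs: "sq_integrable lborel kr"
    proof -
      have "sq_integrable lborel (\<lambda>q. k (q - r))"
        unfolding k_def by (rule sq_integrable_gauss[OF c])
      then show ?thesis
        unfolding kr_def sq_integrable_def by (auto simp: norm_mult)
    qed
    have Hkr: "twisted_heat lam t kr (cplx p) = of_real K * (exp (- of_real c2 * csq (p - (r, 0))) / ch p)" for p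
    proof -
      have "twisted_heat lam t kr (cplx p)
         = exp (- \<i> * of_real (lam / 2) * cinner r (sympl (fst p), sympl (snd p))) * twisted_heat lam t k (cplx (p - (r, 0)))"
        unfolding kr_def by (rule twisted_heat_translate[OF km])
      also have "exp (- \<i> * of_real (lam / 2) * cinner r (sympl (fst p), sympl (snd p))) = 1 / ch p"
        unfolding ch_def mult_minus_left exp_minus inverse_eq_divide ..
      finally show ?thesis unfolding Hk by simp
    qed
    have He: "entire_fun (twisted_heat lam t kr)" by (rule entire_twisted_heat[OF t krs])
    have Hm: "twisted_heat lam t kr \<in> borel_measurable borel" by (rule entire_fun_measurable[OF He])
    have Gm: "G \<in> borel_measurable borel" by (rule entire_fun_measurable[OF Ge])
    have Hs: "sq_integrable (bergman_measure lam t) (twisted_heat lam t kr)"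
    proof -
      have "(\<integral>\<^sup>+p. ennreal ((cmod (twisted_heat lam t kr p))\<^sup>2) \<partial>bergman_measure lam t) < \<infinity>"
        unfolding nn_integral_bergman_measure[OF t Hm] twisted_heat_isometry[OF t krs]
          nn_integral_eq_l2_normsq[OF krs] by simp
      then show ?thesis using Hm by (simp add: sq_integrable_iff_nn_integral)
    qed
    define B where "B p = G p * cnj (twisted_heat lam t kr p) * of_real (bergman_weight lam t p)" for p
    have Bm: "B \<in> borel_measurable borel"
      unfolding B_def[abs_def] using Gm Hm measurable_bergman_weight[of lam t, where ?'a = 'n] by measurable
    have Bi: "integrable lborel B"
    proof -
      have "integrable (bergman_measure lam t) (\<lambda>p. G p * cnj (twisted_heat lam t kr p))"
        by (rule integrable_mult_cnj[OF Gs Hs])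
      then have "integrable lborel (\<lambda>p. bergman_weight lam t p *\<^sub>R (G p * cnj (twisted_heat lam t kr p)))"
        unfolding bergman_measure_def using Gm Hm measurable_bergman_weight[of lam t, where ?'a = 'n]
        by (subst (asm) integrable_density) (auto simp: less_imp_le[OF bergman_weight_pos[OF t]])
      then show ?thesis by (simp add: B_def[abs_def] scaleR_conv_of_real mult.commute)
    qed
    have B0: "(\<integral>p. B p \<partial>lborel) = 0"
      using orth[OF krs] by (simp add: bergman_inner_def B_def)
    \<comment> \<open>Writing the conjugate of an exponential as its squared modulus over the
      exponential itself moves everything antiholomorphic into real factors. \<open>E\<close>
      collects the holomorphic part of the recentred integrand and \<open>m\<close> the remaining
      weight.\<close>
    define E where "E p = ch p * (g ((r, 0) + p)) * exp (of_real c2 * csq p)" for p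
    define m where "m p = (cmod (exp (- of_real c2 * csq p)))\<^sup>2 * w p" for p
    have E: "holo E"
    proof -
      have "linear (\<lambda>p::((real^'n) \<times> (real^'n)) \<times> ((real^'n) \<times> (real^'n)). (sympl (fst p), sympl (snd p)))"
        by (rule linearI) (auto simp: linear_add[OF linear_sympl] linear_cmul[OF linear_sympl])
      then have "holo (\<lambda>p. cinner r (0 + (sympl (fst p), sympl (snd p))))"
        by (rule holo_compose_linear[OF holo_cinner]) (simp add: rot_def sympl_def)
      then have 1: "holo ch"
        unfolding ch_def[abs_def] add_0 by (intro holo_exp holo_mult holo_const)
      have 2: "holo (\<lambda>p. g ((r, 0) + p))"
        by (rule holo_compose_linear[OF g, of id, simplified]) (auto simp: linear_id)
      show ?thesis unfolding E_def[abs_def] by (intro holo_mult 1 2 holo_exp holo_const holo_csq)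
    qed
    have key: "B (cplx ((r, 0) + p)) = of_real (A * K) * (E p * of_real (m p))" for p
    proof -
      obtain a b where p: "p = (a, b)" by (cases p)
      have ch': "ch ((r, 0) + p) = ch p"
        unfolding ch_def p by (simp add: linear_add[OF linear_sympl] inner_add cinner_def)
      have w': "w ((r, 0) + p) = w p * exp (- lam * (r \<bullet> sympl b))"
        unfolding w_def p exp_add[symmetric] by (simp add: inner_add algebra_simps)
      have "(cmod (ch p))\<^sup>2 = exp (2 * Re (\<i> * of_real (lam / 2) * cinner r (sympl a, sympl b)))"
        unfolding ch_def p exp_double by simp
      \<comment> \<open>This squared modulus is also the factor by which the weight changes under
        the shift by \<open>(r, 0)\<close>, so the two cancel.\<close>
      then have ch2: "(cmod (ch p))\<^sup>2 = exp (- lam * (r \<bullet> sympl b))"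
        by (simp add: cinner_def)
      have ch0: "ch p \<noteq> 0" by (simp add: ch_def)
      have "of_real ((cmod (ch p))\<^sup>2) / cnj (ch p) = ch p"
        using ch0 unfolding complex_norm_square by simp
      then have c1: "of_real (exp (- lam * (r \<bullet> sympl b))) / cnj (ch p) = ch p"
        unfolding ch2 .
      let ?e = "exp (- of_real c2 * csq p)"
      have "cnj ?e = of_real ((cmod ?e)\<^sup>2) * exp (of_real c2 * csq p)"
      proof -
        have "?e * exp (of_real c2 * csq p) = 1"
          unfolding exp_add[symmetric] by simp
        then have "cnj ?e * (?e * exp (of_real c2 * csq p)) = cnj ?e" by simp
        then show ?thesis unfolding complex_norm_square by (simp only: mult_ac)
      qed
      then have c2: "cnj ?e * of_real (w p) = exp (of_real c2 * csq p) * of_real (m p)"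
        by (simp add: m_def)
      have "B (cplx ((r, 0) + p)) = g ((r, 0) + p) * (of_real K * (cnj ?e / cnj (ch p))) * (of_real A * (of_real (w p) * of_real (exp (- lam * (r \<bullet> sympl b)))))"
        unfolding B_def Hkr W w' ch' g_def by (simp add: add.commute)
      also have "\<dots> = of_real A * of_real K * (g ((r, 0) + p) * (of_real (exp (- lam * (r \<bullet> sympl b))) / cnj (ch p)) * (cnj ?e * of_real (w p)))"
        by (simp add: mult_ac)
      also have "\<dots> = of_real (A * K) * (E p * of_real (m p))"
        unfolding c1 c2 E_def by (simp add: mult_ac)
      finally show ?thesis .
    qed
    have Bci: "integrable lborel (\<lambda>p. B (cplx p))"
      using Bi Bm by (subst (asm) lborel_distr_cplx[symmetric]) (simp add: integrable_distr_eq)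
    have "integrable lborel (\<lambda>p. B (cplx ((r, 0) + p)))"
      by (rule integrable_lborel_shift[OF Bci])
    from integrable_mult_right[OF this, of "1 / of_real (A * K)"]
    have "integrable lborel (\<lambda>p. E p * of_real (m p))" using A K by (simp add: key)
    moreover have "(\<integral>p. E p * of_real (m p) \<partial>lborel) = 0"
    proof -
      have "of_real (A * K) * (\<integral>p. E p * of_real (m p) \<partial>lborel) = (\<integral>p. B (cplx ((r, 0) + p)) \<partial>lborel)"
        by (simp add: key)
      also have "\<dots> = (\<integral>p. B (cplx p) \<partial>lborel)"
        by (rule integral_lborel_shift[OF measurable_compose[OF measurable_cplx Bm]])
      also have "\<dots> = 0" using integral_cplx[OF Bm] B0 by simp
      finally show ?thesis using A K by simp
    qed
    \<comment> \<open>The weight and the transformed Gaussian have the same rate \<open>c2\<close>,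
      so their contributions combine to the full \<open>(norm p)\<^sup>2\<close>, which rotations
      preserve.\<close>
    moreover have m_eq: "m p = exp (- (2 * c2 * (norm p)\<^sup>2) - lam * (fst p \<bullet> sympl (snd p)))" for p
    proof -
      have "(cmod (exp (- of_real c2 * csq p)))\<^sup>2 = exp (2 * (- c2 * ((norm (fst p))\<^sup>2 - (norm (snd p))\<^sup>2)))"
        unfolding exp_double by (simp add: csq_def)
      moreover have "(norm p)\<^sup>2 = (norm (fst p))\<^sup>2 + (norm (snd p))\<^sup>2" by (simp add: norm_prod_def)
      ultimately show ?thesis
        unfolding m_def w_def by (simp add: exp_add[symmetric] algebra_simps)
    qed
    have "E 0 = 0"
    proof (rule circle_invariant_weight_mean[OF E, of m])
      show "m \<in> borel_measurable borel" unfolding m_eq[abs_def] by measurable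
      show "m (cscale w p) = m p" if "cmod w = 1" for w p
        unfolding m_eq cscale_norm[OF that] cscale_sympl[OF that] ..
    qed (use m_eq calculation in auto)
    then show ?thesis by (simp add: E_def ch_def zero_prod_def[symmetric])
  qed
  have "g (a, b) = 0" for a b
  proof -
    \<comment> \<open>From real points to all points: along the complex line through
      \<open>a\<close> in direction \<open>b\<close>, the function vanishes at real parameters, and
      the value wanted is the one at \<open>\<i>\<close>.\<close>
    define \<phi> where "\<phi> \<tau> = g ((a, 0) + cscale \<tau> (b, 0))" for \<tau>
    have "\<phi> \<i> = 0"
    proof (rule analytic_continuation[where f = \<phi> and S = UNIV and U = "\<real>" and \<xi> = 0])
      show "\<phi> holomorphic_on UNIV" unfolding \<phi>_def by (rule holo_complex_line[OF g])
      show "(0::complex) islimpt \<real>"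
        unfolding islimpt_approachable
      proof (intro allI impI)
        fix e :: real assume "e > 0"
        then show "\<exists>x'\<in>\<real>. x' \<noteq> (0::complex) \<and> dist x' 0 < e"
          by (intro bexI[of _ "of_real (e / 2)"]) auto
      qed
      show "\<phi> z = 0" if "z \<in> \<real>" for z
      proof -
        obtain x where "z = of_real x" using \<open>z \<in> \<real>\<close> by (rule Reals_cases)
        then show ?thesis using real_zero[of "a + x *\<^sub>R b"] by (simp add: \<phi>_def cscale_eq)
      qed
    qed auto
    then show ?thesis by (simp add: \<phi>_def cscale_eq)
  qed
  then have "G p = 0" for p
    using cplx_uncplx[of p] unfolding g_def by (metis prod.collapse)
  then show ?thesis by auto
qed

subsection \<open>Hermite functions\<close>

text \<open>One recursion for all degrees: at \<open>k = 0\<close> the truncated index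
  \<open>k - 1\<close> is 0, but its coefficient vanishes.\<close>

lemma hermite_poly_Suc: "hermite_poly (Suc k) x = 2 * x * hermite_poly k x - 2 * real k * hermite_poly (k - 1) x"
  by (cases k) auto

lemma hermite_poly_has_derivative:
  "(hermite_poly k has_real_derivative 2 * real k * hermite_poly (k - 1) x) (at x)"
proof (induction k x rule: hermite_poly.induct)
  case (3 k x)
  have D: "((\<lambda>x. 2 * x * hermite_poly (Suc k) x - 2 * real (Suc k) * hermite_poly k x) has_real_derivative
     2 * hermite_poly (Suc k) x + 2 * x * (2 * real (Suc k) * hermite_poly (Suc k - 1) x)
       - 2 * real (Suc k) * (2 * real k * hermite_poly (k - 1) x)) (at x)"
    using 3 by (auto intro!: derivative_eq_intros)
  have E: "2 * hermite_poly (Suc k) x + 2 * x * (2 * real (Suc k) * hermite_poly (Suc k - 1) x)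
       - 2 * real (Suc k) * (2 * real k * hermite_poly (k - 1) x) = 2 * real (Suc (Suc k)) * hermite_poly (Suc (Suc k) - 1) x"
    by (simp add: hermite_poly_Suc[of k]) (simp add: algebra_simps)
  have fn: "hermite_poly (Suc (Suc k)) = (\<lambda>x. 2 * x * hermite_poly (Suc k) x - 2 * real (Suc k) * hermite_poly k x)"
    by (rule ext) simp
  show ?case unfolding fn by (rule DERIV_cong[OF D E])
next
  case (1 x)
  have "hermite_poly 0 = (\<lambda>x. 1)" by (rule ext) simp
  then show ?case by simp
next
  case (2 x)
  have "hermite_poly (Suc 0) = (\<lambda>x. 2 * x)" by (rule ext) simp
  then show ?case by (auto intro!: derivative_eq_intros)
qed

text \<open>Quantified over all \<open>\<epsilon>\<close> because the induction spends half of it on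
  the factor \<open>2 * x\<close> and the other half on the polynomial that it multiplies.\<close>

lemma hermite_poly_bound:
  assumes "\<epsilon> > 0"
  shows "\<exists>C\<ge>0. \<forall>x. \<bar>hermite_poly k x\<bar> \<le> C * exp (\<epsilon> * x\<^sup>2)"
  using assms
proof (induction k arbitrary: \<epsilon> rule: induct_nat_012)
  case 0
  then show ?case by (intro exI[of _ 1]) auto
next
  case 1
  have "\<bar>2 * x\<bar> \<le> (2 + 2 / \<epsilon>) * exp (\<epsilon> * x\<^sup>2)" for x
  proof -
    have "2 * \<bar>x\<bar> \<le> 1 + x\<^sup>2" using sum_squares_bound[of 1 "\<bar>x\<bar>"] by simp
    also have "\<dots> \<le> (2 + 2 / \<epsilon>) * (1 + \<epsilon> * x\<^sup>2)" using 1 by (simp add: field_simps add_increasing)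
    also have "\<dots> \<le> (2 + 2 / \<epsilon>) * exp (\<epsilon> * x\<^sup>2)" using 1 by (intro mult_left_mono exp_ge_add_one_self) auto
    finally show ?thesis by simp
  qed
  then show ?case using 1 by (intro exI[of _ "2 + 2 / \<epsilon>"]) auto
next
  case (ge2 k)
  obtain C where C: "C \<ge> 0" "\<And>x. \<bar>hermite_poly k x\<bar> \<le> C * exp (\<epsilon> * x\<^sup>2)"
    using ge2.IH(1)[OF ge2.prems] by blast
  obtain C' where C': "C' \<ge> 0" "\<And>x. \<bar>hermite_poly (Suc k) x\<bar> \<le> C' * exp (\<epsilon> / 2 * x\<^sup>2)"
    using ge2.IH(2)[of "\<epsilon>/2"] ge2.prems by auto
  have e2: "\<bar>2 * x\<bar> \<le> (1 + 2 / \<epsilon>) * exp (\<epsilon> / 2 * x\<^sup>2)" for x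
  proof -
    have "2 * \<bar>x\<bar> \<le> 1 + x\<^sup>2" using sum_squares_bound[of 1 "\<bar>x\<bar>"] by simp
    also have "\<dots> \<le> (1 + 2 / \<epsilon>) * (1 + \<epsilon> / 2 * x\<^sup>2)" using ge2.prems by (simp add: field_simps add_increasing)
    also have "\<dots> \<le> (1 + 2 / \<epsilon>) * exp (\<epsilon> / 2 * x\<^sup>2)" using ge2.prems by (intro mult_left_mono exp_ge_add_one_self) auto
    finally show ?thesis by simp
  qed
  have "\<bar>hermite_poly (Suc (Suc k)) x\<bar> \<le> ((1 + 2 / \<epsilon>) * C' + 2 * real (Suc k) * C) * exp (\<epsilon> * x\<^sup>2)" for x
  proof -
    have "\<bar>hermite_poly (Suc (Suc k)) x\<bar> \<le> \<bar>2 * x\<bar> * \<bar>hermite_poly (Suc k) x\<bar> + 2 * real (Suc k) * \<bar>hermite_poly k x\<bar>"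
      unfolding hermite_poly.simps(3) by (rule order_trans[OF abs_triangle_ineq4]) (simp add: abs_mult)
    also have "\<dots> \<le> ((1 + 2 / \<epsilon>) * exp (\<epsilon> / 2 * x\<^sup>2)) * (C' * exp (\<epsilon> / 2 * x\<^sup>2)) + 2 * real (Suc k) * (C * exp (\<epsilon> * x\<^sup>2))"
      using C C' ge2.prems by (intro add_mono mult_mono e2) auto
    also have "\<dots> = (1 + 2 / \<epsilon>) * C' * (exp (\<epsilon> / 2 * x\<^sup>2) * exp (\<epsilon> / 2 * x\<^sup>2)) + 2 * real (Suc k) * C * exp (\<epsilon> * x\<^sup>2)"
      by (simp only: mult_ac)
    also have "exp (\<epsilon> / 2 * x\<^sup>2) * exp (\<epsilon> / 2 * x\<^sup>2) = exp (\<epsilon> * x\<^sup>2)"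
      unfolding exp_add[symmetric] by simp
    finally show ?thesis by (simp only: distrib_right)
  qed
  then show ?case using C C' ge2.prems by (intro exI[of _ "(1 + 2 / \<epsilon>) * C' + 2 * real (Suc k) * C"]) auto
qed

text \<open>Half of the Gaussian exponent is spent on the polynomial; the remaining rate 1/4 is the
  common decay rate in what follows.\<close>

lemma hermite_fun_bound: "\<exists>C\<ge>0. \<forall>x. \<bar>hermite_fun k x\<bar> \<le> C * exp (- (1/4 * x\<^sup>2))"
proof -
  obtain C where C: "C \<ge> 0" "\<And>x. \<bar>hermite_poly k x\<bar> \<le> C * exp (1/4 * x\<^sup>2)"
    using hermite_poly_bound[of "1/4" k] by auto
  define N where "N = sqrt (2 ^ k * fact k * sqrt pi)"
  have N: "N > 0" by (simp add: N_def)
  have "\<bar>hermite_fun k x\<bar> \<le> (C / N) * exp (- (1/4 * x\<^sup>2))" for x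
  proof -
    have "\<bar>hermite_fun k x\<bar> = \<bar>hermite_poly k x\<bar> * exp (- (x\<^sup>2) / 2) / N"
      using N unfolding hermite_fun_def N_def[symmetric] by (simp add: abs_mult)
    also have "\<dots> \<le> C * exp (1/4 * x\<^sup>2) * exp (- (x\<^sup>2) / 2) / N"
      using C N by (intro divide_right_mono mult_right_mono) auto
    also have "\<dots> = (C / N) * (exp (1/4 * x\<^sup>2) * exp (- (x\<^sup>2) / 2))" by simp
    also have "exp (1/4 * x\<^sup>2) * exp (- (x\<^sup>2) / 2) = exp (- (1/4 * x\<^sup>2))" unfolding exp_add[symmetric] by simp
    finally show ?thesis .
  qed
  then show ?thesis using C N by (intro exI[of _ "C / N"]) auto
qed

lemma hermite_norm_Suc: "sqrt (2 ^ Suc k * fact (Suc k) * sqrt pi) = sqrt (2 * real (Suc k)) * sqrt (2 ^ k * fact k * sqrt pi)"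
  by (simp add: real_sqrt_mult[symmetric] mult_ac)

lemma hermite_fun_Suc_poly: "hermite_poly (Suc k) x * exp (- (x\<^sup>2) / 2) / sqrt (2 ^ k * fact k * sqrt pi) = sqrt (2 * real (Suc k)) * hermite_fun (Suc k) x"
proof -
  have "sqrt (2 * real (Suc k)) > 0" by simp
  then show ?thesis unfolding hermite_fun_def hermite_norm_Suc by simp
qed

lemma hermite_fun_pred_poly: "2 * real k * hermite_poly (k - 1) x * exp (- (x\<^sup>2) / 2) / sqrt (2 ^ k * fact k * sqrt pi) = sqrt (2 * real k) * hermite_fun (k - 1) x"
proof (cases k)
  case (Suc m)
  define s N where "s = sqrt (2 * real (Suc m))" and "N = sqrt (2 ^ m * fact m * sqrt pi)"
  have s: "s > 0" "s * s = 2 * real (Suc m)" by (simp_all add: s_def)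
  have "2 * real (Suc m) * hermite_poly m x * exp (- (x\<^sup>2) / 2) / (s * N) = s * (hermite_poly m x * exp (- (x\<^sup>2) / 2) / N)"
    unfolding s(2)[symmetric] using s(1) by simp
  then show ?thesis unfolding Suc hermite_norm_Suc hermite_fun_def s_def N_def by simp
qed simp

text \<open>Creation plus annihilation: multiplication by the variable moves the degree up and down.
  At \<open>k = 0\<close> the term with the truncated index has coefficient 0.\<close>

lemma hermite_fun_mult_var:
  "2 * (x * hermite_fun k x) = sqrt (2 * real (Suc k)) * hermite_fun (Suc k) x + sqrt (2 * real k) * hermite_fun (k - 1) x"
  unfolding hermite_fun_Suc_poly[symmetric] hermite_fun_pred_poly[symmetric] add_divide_distrib[symmetric]
  unfolding hermite_poly_Suc hermite_fun_def by (simp add: algebra_simps)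

text \<open>The derivative of \<open>hermite_fun k\<close>, given by its expansion in the
  neighbouring Hermite functions so that decay and linearity are immediate.\<close>

definition hermite_deriv :: "nat \<Rightarrow> real \<Rightarrow> real" where
  "hermite_deriv k x = (sqrt (2 * real k) * hermite_fun (k - 1) x - sqrt (2 * real (Suc k)) * hermite_fun (Suc k) x) / 2"

lemma hermite_fun_has_derivative: "(hermite_fun k has_real_derivative hermite_deriv k x) (at x)"
proof -
  define N where "N = sqrt (2 ^ k * fact k * sqrt pi)"
  have N: "N > 0" by (simp add: N_def)
  have "((\<lambda>x. exp (- (x\<^sup>2) / 2)) has_real_derivative exp (- (x\<^sup>2) / 2) * (- x)) (at x)"
    by (auto intro!: derivative_eq_intros)
  from DERIV_cdivide[OF DERIV_mult[OF hermite_poly_has_derivative[of k] this], of N]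
  have D: "((\<lambda>x. hermite_poly k x * exp (- (x\<^sup>2) / 2) / N) has_real_derivative
     (2 * real k * hermite_poly (k - 1) x * exp (- (x\<^sup>2) / 2) + exp (- (x\<^sup>2) / 2) * (- x) * hermite_poly k x) / N) (at x)" .
  have E: "(2 * real k * hermite_poly (k - 1) x * exp (- (x\<^sup>2) / 2) + exp (- (x\<^sup>2) / 2) * (- x) * hermite_poly k x) / N
     = hermite_deriv k x"
    unfolding hermite_deriv_def hermite_fun_Suc_poly[symmetric] hermite_fun_pred_poly[symmetric] N_def[symmetric] hermite_poly_Suc
    using N by (simp add: field_simps)
  have fn: "hermite_fun k = (\<lambda>x. hermite_poly k x * exp (- (x\<^sup>2) / 2) / N)"
    unfolding hermite_fun_def N_def by (rule ext) simp
  show ?thesis unfolding fn by (rule DERIV_cong[OF D E])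
qed

lemma isCont_hermite_fun: "isCont (hermite_fun k) x"
  using hermite_fun_has_derivative by (rule DERIV_isCont)

lemma continuous_hermite_fun [continuous_intros]:
  "continuous_on A f \<Longrightarrow> continuous_on A (\<lambda>x. hermite_fun k (f x))"
  using continuous_on_compose2[of UNIV "hermite_fun k" A f] isCont_hermite_fun
  by (auto simp: continuous_at_imp_continuous_on)

lemma measurable_hermite_fun [measurable]: "hermite_fun k \<in> borel_measurable borel"
  by (intro borel_measurable_continuous_onI continuous_intros)

lemma continuous_hermite_deriv [continuous_intros]:
  "continuous_on A f \<Longrightarrow> continuous_on A (\<lambda>x. hermite_deriv k (f x))"
  unfolding hermite_deriv_def by (intro continuous_intros) auto

lemma hermite_deriv_bound: "\<exists>C\<ge>0. \<forall>x. \<bar>hermite_deriv k x\<bar> \<le> C * exp (- (1/4 * x\<^sup>2))"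
proof -
  obtain C where C: "C \<ge> 0" "\<And>x. \<bar>hermite_fun (k - 1) x\<bar> \<le> C * exp (- (1/4 * x\<^sup>2))"
    using hermite_fun_bound[of "k - 1"] by blast
  obtain C' where C': "C' \<ge> 0" "\<And>x. \<bar>hermite_fun (Suc k) x\<bar> \<le> C' * exp (- (1/4 * x\<^sup>2))"
    using hermite_fun_bound[of "Suc k"] by blast
  let ?K = "sqrt (2 * real k) * C + sqrt (2 * real (Suc k)) * C'"
  have "\<bar>hermite_deriv k x\<bar> \<le> ?K * exp (- (1/4 * x\<^sup>2))" for x
  proof -
    have "\<bar>hermite_deriv k x\<bar> \<le> \<bar>sqrt (2 * real k) * hermite_fun (k - 1) x - sqrt (2 * real (Suc k)) * hermite_fun (Suc k) x\<bar>"
      unfolding hermite_deriv_def by simp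
    also have "\<dots> \<le> sqrt (2 * real k) * \<bar>hermite_fun (k - 1) x\<bar> + sqrt (2 * real (Suc k)) * \<bar>hermite_fun (Suc k) x\<bar>"
      by (rule order_trans[OF abs_triangle_ineq4]) (simp add: abs_mult)
    also have "\<dots> \<le> sqrt (2 * real k) * (C * exp (- (1/4 * x\<^sup>2))) + sqrt (2 * real (Suc k)) * (C' * exp (- (1/4 * x\<^sup>2)))"
      using C C' by (intro add_mono mult_left_mono) auto
    finally show ?thesis by (simp add: algebra_simps)
  qed
  then show ?thesis using C C' by (intro exI[of _ ?K]) auto
qed

text \<open>Integration by parts without boundary terms, since Gaussian decay kills \<open>F\<close>
  at both ends. It yields the orthogonality relations and the rule for multiplication by
  \<open>x\<close>.\<close>

lemma integral_derivative_zero: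
  fixes F f :: "real \<Rightarrow> complex"
  assumes F: "\<And>x. (F has_vector_derivative f x) (at x)" and f: "continuous_on UNIV f"
    and Fb: "\<And>x. cmod (F x) \<le> C * exp (- (1/4 * x\<^sup>2))" and fi: "integrable lborel f"
  shows "(\<integral>x. f x \<partial>lborel) = 0"
proof -
  have lim: "(F \<longlongrightarrow> 0) at_top" "(F \<longlongrightarrow> 0) at_bot"
  proof -
    have "((\<lambda>x::real. C * exp (- (1/4 * x\<^sup>2))) \<longlongrightarrow> C * 0) at_top"
      by (intro tendsto_mult tendsto_const) real_asymp
    then show "(F \<longlongrightarrow> 0) at_top"
      by (intro Lim_null_comparison[OF always_eventually[OF allI[OF Fb]]]) simp
    have "((\<lambda>x::real. C * exp (- (1/4 * x\<^sup>2))) \<longlongrightarrow> C * 0) at_bot"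
      by (intro tendsto_mult tendsto_const) real_asymp
    then show "(F \<longlongrightarrow> 0) at_bot"
      by (intro Lim_null_comparison[OF always_eventually[OF allI[OF Fb]]]) simp
  qed
  have "(LBINT x=-\<infinity>..\<infinity>. f x) = 0 - 0"
  proof (rule interval_integral_FTC_integrable)
    show "isCont f x" for x using f by (simp add: continuous_on_eq_continuous_at)
    show "set_integrable lborel (einterval (-\<infinity>) \<infinity>) f"
      using fi by (simp add: set_integrable_def)
  qed (use F lim in \<open>auto simp: ereal_tendsto_simps\<close>)
  then show ?thesis
    by (simp add: interval_lebesgue_integral_def set_lebesgue_integral_def)
qed

lemma integrable_gauss_bound:
  fixes f :: "'a::euclidean_space \<Rightarrow> 'b::{banach,second_countable_topology}"
  assumes "f \<in> borel_measurable borel" "\<And>x. norm (f x) \<le> C * exp (- (c * (norm x)\<^sup>2))" "c > 0"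
  shows "integrable lborel f"
proof (rule Bochner_Integration.integrable_bound)
  show "integrable lborel (\<lambda>x::'a. C * exp (- (c * (norm x)\<^sup>2)))"
    using gaussian_abs_integrable[OF assms(3), of "0::'a"] by simp
  show "AE x in lborel. norm (f x) \<le> norm (C * exp (- (c * (norm x)\<^sup>2)))"
    using order_trans[OF assms(2) abs_ge_self] by auto
qed (use assms in simp)

lemma integrable_hermite_poly_gauss: "integrable lborel (\<lambda>x. hermite_poly j x * hermite_poly k x * exp (- x\<^sup>2))"
proof -
  obtain C where C: "C \<ge> 0" "\<And>x. \<bar>hermite_poly j x\<bar> \<le> C * exp (1/4 * x\<^sup>2)"
    using hermite_poly_bound[of "1/4" j] by auto
  obtain D where D: "D \<ge> 0" "\<And>x. \<bar>hermite_poly k x\<bar> \<le> D * exp (1/4 * x\<^sup>2)"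
    using hermite_poly_bound[of "1/4" k] by auto
  have m: "hermite_poly i \<in> borel_measurable borel" for i
    using DERIV_isCont[OF hermite_poly_has_derivative]
    by (intro borel_measurable_continuous_onI continuous_at_imp_continuous_on) auto
  have "norm (hermite_poly j x * hermite_poly k x * exp (- x\<^sup>2)) \<le> (C * D) * exp (- (1/2 * (norm x)\<^sup>2))" for x
  proof -
    have "norm (hermite_poly j x * hermite_poly k x * exp (- x\<^sup>2)) \<le> (C * exp (1/4 * x\<^sup>2)) * (D * exp (1/4 * x\<^sup>2)) * exp (- x\<^sup>2)"
      unfolding real_norm_def abs_mult abs_exp_cancel using C(1) D(1)
      by (intro mult_right_mono mult_mono C(2) D(2)) auto
    also have "\<dots> = (C * D) * (exp (1/4 * x\<^sup>2) * exp (1/4 * x\<^sup>2) * exp (- x\<^sup>2))" by (simp only: mult_ac)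
    also have "exp (1/4 * x\<^sup>2) * exp (1/4 * x\<^sup>2) * exp (- x\<^sup>2) = exp (- (1/2 * (norm x)\<^sup>2))"
      unfolding exp_add[symmetric] by simp
    finally show ?thesis .
  qed
  then show ?thesis using m by (intro integrable_gauss_bound[where c = "1/2"]) auto
qed

text \<open>Integrating the derivative of
  \<open>hermite_poly j x * hermite_poly k x * exp (- x\<^sup>2)\<close> gives a recursion that
  lowers both degrees by one; together with symmetry it reduces everything to the Gaussian
  integral.\<close>

lemma hermite_poly_orthogonal:
  "(\<integral>x. hermite_poly j x * hermite_poly k x * exp (- x\<^sup>2) \<partial>lborel) = (if j = k then 2 ^ k * fact k * sqrt pi else 0)"
proof -
  define I where "I j k = (\<integral>x. hermite_poly j x * hermite_poly k x * exp (- x\<^sup>2) \<partial>lborel)" for j k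
  note int = integrable_hermite_poly_gauss
  have cont: "continuous_on UNIV (hermite_poly i)" for i
    using DERIV_isCont[OF hermite_poly_has_derivative] by (intro continuous_at_imp_continuous_on) auto
  have step: "I j (Suc k) = 2 * real j * I (j - 1) k" for j k
  proof -
    define F where "F x = hermite_poly j x * hermite_poly k x * exp (- x\<^sup>2)" for x
    define f where "f x = 2 * real j * (hermite_poly (j - 1) x * hermite_poly k x * exp (- x\<^sup>2))
        - hermite_poly j x * hermite_poly (Suc k) x * exp (- x\<^sup>2)" for x
    have fi: "integrable lborel f" unfolding f_def[abs_def]
      by (intro Bochner_Integration.integrable_diff integrable_mult_right int)
    have "(F has_real_derivative f x) (at x)" for x
      unfolding F_def[abs_def]
      by (rule derivative_eq_intros hermite_poly_has_derivative refl)+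
        (simp add: f_def hermite_poly_Suc[of k] algebra_simps power2_eq_square)
    then have d: "((\<lambda>x. complex_of_real (F x)) has_vector_derivative complex_of_real (f x)) (at x)" for x
      by (intro has_vector_derivative_of_real) (simp add: has_real_derivative_iff_has_vector_derivative)
    obtain C where C: "C \<ge> 0" "\<And>x. \<bar>hermite_poly j x\<bar> \<le> C * exp (1/4 * x\<^sup>2)"
      using hermite_poly_bound[of "1/4" j] by auto
    obtain D where D: "D \<ge> 0" "\<And>x. \<bar>hermite_poly k x\<bar> \<le> D * exp (1/4 * x\<^sup>2)"
      using hermite_poly_bound[of "1/4" k] by auto
    have b: "cmod (complex_of_real (F x)) \<le> (C * D) * exp (- (1/4 * x\<^sup>2))" for x
    proof -
      have "\<bar>F x\<bar> \<le> (C * exp (1/4 * x\<^sup>2)) * (D * exp (1/4 * x\<^sup>2)) * exp (- x\<^sup>2)"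
        unfolding F_def abs_mult abs_exp_cancel using C(1) D(1)
        by (intro mult_right_mono mult_mono C(2) D(2)) auto
      also have "\<dots> = (C * D) * (exp (1/4 * x\<^sup>2) * exp (1/4 * x\<^sup>2) * exp (- x\<^sup>2))" by (simp only: mult_ac)
      also have "\<dots> \<le> (C * D) * exp (- (1/4 * x\<^sup>2))"
        unfolding exp_add[symmetric] using C D by (intro mult_left_mono) auto
      finally show ?thesis by simp
    qed
    have "(\<integral>x. complex_of_real (f x) \<partial>lborel) = 0"
    proof (rule integral_derivative_zero[OF d _ b])
      show "continuous_on UNIV (\<lambda>x. complex_of_real (f x))"
        unfolding f_def by (intro continuous_intros cont)
      show "integrable lborel (\<lambda>x. complex_of_real (f x))" using fi by simp
    qed
    then have "(\<integral>x. f x \<partial>lborel) = 0" by simp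
    then show ?thesis unfolding f_def I_def using int by simp
  qed
  have sym: "I j k = I k j" for j k unfolding I_def by (simp add: mult_ac)
  have I00: "I 0 0 = sqrt pi"
    using gaussian_abs_integral[of 1 "0::real"] by (simp add: I_def)
  have "I j k = (if j = k then 2 ^ k * fact k * sqrt pi else 0)"
  proof (induction k arbitrary: j)
    case 0
    show ?case
    proof (cases j)
      case (Suc i)
      then show ?thesis using sym[of j 0] step[of 0 i] by simp
    qed (simp add: I00)
  next
    case (Suc k)
    show ?case
    proof (cases j)
      case 0
      then show ?thesis using step[of 0 k] by simp
    next
      case (Suc i)
      then show ?thesis using step[of j k] Suc.IH[of i] by simp
    qed
  qed
  then show ?thesis unfolding I_def .
qed

lemma hermite_fun_orthonormal:
  "integrable lborel (\<lambda>x. hermite_fun j x * hermite_fun k x)"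
  "(\<integral>x. hermite_fun j x * hermite_fun k x \<partial>lborel) = (if j = k then 1 else 0)"
proof -
  define N where "N k = sqrt (2 ^ k * fact k * sqrt pi)" for k :: nat
  have N: "N k > 0" "N k * N k = 2 ^ k * fact k * sqrt pi" for k by (simp_all add: N_def)
  have e: "hermite_fun j x * hermite_fun k x = (1 / (N j * N k)) * (hermite_poly j x * hermite_poly k x * exp (- x\<^sup>2))" for x
  proof -
    have "exp (- x\<^sup>2) = exp (- (x\<^sup>2) / 2) * exp (- (x\<^sup>2) / 2)" unfolding exp_add[symmetric] by simp
    then show ?thesis unfolding hermite_fun_def N_def by simp
  qed
  show "integrable lborel (\<lambda>x. hermite_fun j x * hermite_fun k x)"
    unfolding e by (intro integrable_mult_right integrable_hermite_poly_gauss)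
  show "(\<integral>x. hermite_fun j x * hermite_fun k x \<partial>lborel) = (if j = k then 1 else 0)"
    unfolding e integral_mult_right_zero hermite_poly_orthogonal using N by auto
qed

subsection \<open>Special Hermite functions\<close>

lemma integral_vec_prod:
  fixes f :: "'n::finite \<Rightarrow> real \<Rightarrow> complex"
  assumes f: "\<And>j. integrable lborel (f j)"
  shows "(\<integral>\<xi>. (\<Prod>j\<in>UNIV. f j (\<xi> $ j)) \<partial>(lborel :: (real^'n) measure)) = (\<Prod>j\<in>UNIV. \<integral>x. f j x \<partial>lborel)"
proof -
  \<comment> \<open>Recovers the index from a basis vector, which determines it uniquely.\<close>
  define F where "F b = f (SOME j. b = axis j (1::real))" for b :: "real^'n"
  have inj: "inj (\<lambda>j::'n. axis j (1::real))" by (auto simp: inj_on_def axis_eq_axis)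
  have B: "(Basis :: (real^'n) set) = range (\<lambda>j. axis j 1)" by (auto simp: Basis_vec_def)
  have F: "F (axis j 1) = f j" for j
    by (simp add: F_def axis_eq_axis)
  have "(\<Prod>b\<in>Basis. F b (\<xi> \<bullet> b)) = (\<Prod>j\<in>UNIV. f j (\<xi> $ j))" for \<xi>
    unfolding B by (subst prod.reindex[OF inj]) (simp add: F inner_axis)
  moreover have "(\<Prod>b\<in>Basis. \<integral>x. F b x \<partial>lborel) = (\<Prod>j\<in>UNIV. \<integral>x. f j x \<partial>lborel)"
    unfolding B by (subst prod.reindex[OF inj]) (simp add: F)
  moreover have "integrable lborel (F b)" for b unfolding F_def by (rule f)
  ultimately show ?thesis
    using integral_lborel_prod[of F] by simp
qed

text \<open>The Fourier-Wigner transform of two functions of one variable, the building block of a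
  special Hermite function. Its arguments are general so that derivatives of Hermite functions can
  be inserted.\<close>

definition wigner :: "real \<Rightarrow> real \<Rightarrow> (real \<Rightarrow> real) \<Rightarrow> (real \<Rightarrow> real) \<Rightarrow> complex" where
  "wigner x u A B = (\<integral>\<xi>. exp (\<i> * of_real (x * \<xi> + 1/2 * (x * u))) * of_real (A (\<xi> + u) * B \<xi>) \<partial>lborel)"

text \<open>The rate 1/4 is available for Hermite functions and their derivatives alike, and the
  class is closed under linear combinations.\<close>

definition gauss_bounded :: "(real \<Rightarrow> real) \<Rightarrow> bool" where
  "gauss_bounded A \<longleftrightarrow> continuous_on UNIV A \<and> (\<exists>C\<ge>0. \<forall>x. \<bar>A x\<bar> \<le> C * exp (- (1/4 * x\<^sup>2)))"

lemma gauss_bounded_hermite [simp]: "gauss_bounded (hermite_fun k)" "gauss_bounded (hermite_deriv k)"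
  using hermite_fun_bound[of k] hermite_deriv_bound[of k]
  by (auto simp: gauss_bounded_def intro!: continuous_intros)

lemma wigner_integrand:
  assumes A: "gauss_bounded A" and B: "gauss_bounded B"
  shows "\<exists>C. \<forall>\<xi>. cmod (exp (\<i> * of_real (x * \<xi> + 1/2 * (x * u))) * of_real (A (\<xi> + u) * B \<xi>)) \<le> C * exp (- (1/4 * \<xi>\<^sup>2))"
    and "continuous_on UNIV (\<lambda>\<xi>. exp (\<i> * of_real (x * \<xi> + 1/2 * (x * u))) * complex_of_real (A (\<xi> + u) * B \<xi>))"
    and "integrable lborel (\<lambda>\<xi>. exp (\<i> * of_real (x * \<xi> + 1/2 * (x * u))) * complex_of_real (A (\<xi> + u) * B \<xi>))"
proof -
  let ?f = "\<lambda>\<xi>. exp (\<i> * of_real (x * \<xi> + 1/2 * (x * u))) * complex_of_real (A (\<xi> + u) * B \<xi>)"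
  obtain C where C: "C \<ge> 0" "\<And>x. \<bar>A x\<bar> \<le> C * exp (- (1/4 * x\<^sup>2))" using A unfolding gauss_bounded_def by blast
  obtain D where D: "D \<ge> 0" "\<And>x. \<bar>B x\<bar> \<le> D * exp (- (1/4 * x\<^sup>2))" using B unfolding gauss_bounded_def by blast
  have CA: "\<bar>A x\<bar> \<le> C" for x
    using C(2)[of x] mult_left_le[of "exp (- (1/4 * x\<^sup>2))" C] C(1) by simp
  have b: "cmod (?f \<xi>) \<le> (C * D) * exp (- (1/4 * \<xi>\<^sup>2))" for \<xi>
  proof -
    have "cmod (?f \<xi>) = \<bar>A (\<xi> + u)\<bar> * \<bar>B \<xi>\<bar>" by (simp add: norm_mult abs_mult)
    also have "\<dots> \<le> C * (D * exp (- (1/4 * \<xi>\<^sup>2)))"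
      by (intro mult_mono CA D(2)) (use C in auto)
    finally show ?thesis by simp
  qed
  then show "\<exists>C. \<forall>\<xi>. cmod (?f \<xi>) \<le> C * exp (- (1/4 * \<xi>\<^sup>2))" by blast
  have "continuous_on UNIV A" "continuous_on UNIV B" using A B by (auto simp: gauss_bounded_def)
  then have "continuous_on UNIV (\<lambda>\<xi>. A (\<xi> + u))" "continuous_on UNIV B"
    by (auto intro!: continuous_on_compose2[of UNIV A] continuous_intros)
  then show c: "continuous_on UNIV ?f" by (intro continuous_intros)
  show "integrable lborel ?f"
    using b by (intro integrable_gauss_bound[of _ "C * D" "1/4"] borel_measurable_continuous_onI c) auto
qed

lemma wigner_linear_left:
  assumes "gauss_bounded A" "gauss_bounded A'" "gauss_bounded B"
  shows "wigner x u (\<lambda>s. a * A s + b * A' s) B = of_real a * wigner x u A B + of_real b * wigner x u A' B"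
proof -
  note i = wigner_integrand(3)[OF assms(1,3), of x u] wigner_integrand(3)[OF assms(2,3), of x u]
  show ?thesis
    unfolding wigner_def integral_mult_right_zero[symmetric]
    by (subst Bochner_Integration.integral_add[OF integrable_mult_right[OF i(1)] integrable_mult_right[OF i(2)], symmetric])
      (simp add: algebra_simps)
qed

lemma wigner_linear_right:
  assumes "gauss_bounded A" "gauss_bounded B" "gauss_bounded B'"
  shows "wigner x u A (\<lambda>s. a * B s + b * B' s) = of_real a * wigner x u A B + of_real b * wigner x u A B'"
proof -
  note i = wigner_integrand(3)[OF assms(1,2), of x u] wigner_integrand(3)[OF assms(1,3), of x u]
  show ?thesis
    unfolding wigner_def integral_mult_right_zero[symmetric]
    by (subst Bochner_Integration.integral_add[OF integrable_mult_right[OF i(1)] integrable_mult_right[OF i(2)], symmetric])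
      (simp add: algebra_simps)
qed

abbreviation whermite :: "nat \<Rightarrow> nat \<Rightarrow> real \<Rightarrow> real \<Rightarrow> complex" where
  "whermite a b x u \<equiv> wigner x u (hermite_fun a) (hermite_fun b)"

lemma gauss_bounded_lin:
  assumes "gauss_bounded A" "gauss_bounded B" shows "gauss_bounded (\<lambda>s. a * A s + b * B s)"
proof -
  obtain C where C: "C \<ge> 0" "\<And>x. \<bar>A x\<bar> \<le> C * exp (- (1/4 * x\<^sup>2))" using assms unfolding gauss_bounded_def by blast
  obtain D where D: "D \<ge> 0" "\<And>x. \<bar>B x\<bar> \<le> D * exp (- (1/4 * x\<^sup>2))" using assms unfolding gauss_bounded_def by blast
  have "\<bar>a * A x + b * B x\<bar> \<le> (\<bar>a\<bar> * C + \<bar>b\<bar> * D) * exp (- (1/4 * x\<^sup>2))" for x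
  proof -
    have "\<bar>a * A x + b * B x\<bar> \<le> \<bar>a\<bar> * \<bar>A x\<bar> + \<bar>b\<bar> * \<bar>B x\<bar>"
      by (rule order_trans[OF abs_triangle_ineq]) (simp add: abs_mult)
    also have "\<dots> \<le> \<bar>a\<bar> * (C * exp (- (1/4 * x\<^sup>2))) + \<bar>b\<bar> * (D * exp (- (1/4 * x\<^sup>2)))"
      by (intro add_mono mult_left_mono C D) auto
    finally show ?thesis by (simp add: algebra_simps)
  qed
  moreover have "continuous_on UNIV (\<lambda>s. a * A s + b * B s)"
    using assms by (auto simp: gauss_bounded_def intro!: continuous_intros)
  ultimately show ?thesis using C D unfolding gauss_bounded_def
    by (intro conjI exI[of _ "\<bar>a\<bar> * C + \<bar>b\<bar> * D"]) auto
qed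

text \<open>Write \<open>u\<close> as \<open>(\<xi> + u) - \<xi>\<close> under the integral and
  apply the multiplication rule for Hermite functions to each factor.\<close>

lemma whermite_mult_u:
  "2 * of_real u * whermite a b x u
    = of_real (sqrt (2 * real (Suc a))) * whermite (Suc a) b x u + of_real (sqrt (2 * real a)) * whermite (a - 1) b x u
      - (of_real (sqrt (2 * real (Suc b))) * whermite a (Suc b) x u + of_real (sqrt (2 * real b)) * whermite a (b - 1) x u)"
proof -
  let ?A = "\<lambda>s. sqrt (2 * real (Suc a)) * hermite_fun (Suc a) s + sqrt (2 * real a) * hermite_fun (a - 1) s"
  let ?B = "\<lambda>s. sqrt (2 * real (Suc b)) * hermite_fun (Suc b) s + sqrt (2 * real b) * hermite_fun (b - 1) s"
  have gA: "gauss_bounded ?A" "gauss_bounded ?B" by (intro gauss_bounded_lin gauss_bounded_hermite)+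
  have "2 * u * (hermite_fun a (\<xi> + u) * hermite_fun b \<xi>) = ?A (\<xi> + u) * hermite_fun b \<xi> - hermite_fun a (\<xi> + u) * ?B \<xi>" for \<xi>
    unfolding hermite_fun_mult_var[symmetric] by (simp add: algebra_simps)
  then have e: "complex_of_real (2 * u * (hermite_fun a (\<xi> + u) * hermite_fun b \<xi>)) = of_real (?A (\<xi> + u) * hermite_fun b \<xi>) - of_real (hermite_fun a (\<xi> + u) * ?B \<xi>)" for \<xi>
    by (simp only: of_real_diff)
  have "2 * of_real u * whermite a b x u = (\<integral>\<xi>. exp (\<i> * of_real (x * \<xi> + 1/2 * (x * u))) *
      (of_real (?A (\<xi> + u) * hermite_fun b \<xi>) - of_real (hermite_fun a (\<xi> + u) * ?B \<xi>)) \<partial>lborel)"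
    unfolding e[symmetric] wigner_def integral_mult_right_zero[symmetric] by (simp add: mult_ac)
  also have "\<dots> = wigner x u ?A (hermite_fun b) - wigner x u (hermite_fun a) ?B"
    unfolding right_diff_distrib wigner_def
    by (rule Bochner_Integration.integral_diff) (intro wigner_integrand(3) gA gauss_bounded_hermite)+
  also have "\<dots> = of_real (sqrt (2 * real (Suc a))) * whermite (Suc a) b x u + of_real (sqrt (2 * real a)) * whermite (a - 1) b x u
      - (of_real (sqrt (2 * real (Suc b))) * whermite a (Suc b) x u + of_real (sqrt (2 * real b)) * whermite a (b - 1) x u)"
    by (simp only: wigner_linear_left[OF gauss_bounded_hermite(1,1,1)] wigner_linear_right[OF gauss_bounded_hermite(1,1,1)])
  finally show ?thesis .
qed

text \<open>The total derivative in \<xi> of the integrand has integral 0; the exponential brings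
  down \<open>\<i> * of_real x\<close>, and the other two terms are expanded through
  \<open>hermite_deriv\<close>.\<close>

lemma whermite_mult_x:
  "2 * \<i> * of_real x * whermite a b x u
    = of_real (sqrt (2 * real (Suc a))) * whermite (Suc a) b x u - of_real (sqrt (2 * real a)) * whermite (a - 1) b x u
      + (of_real (sqrt (2 * real (Suc b))) * whermite a (Suc b) x u - of_real (sqrt (2 * real b)) * whermite a (b - 1) x u)"
proof -
  let ?e = "\<lambda>\<xi>. exp (\<i> * complex_of_real (x * \<xi> + 1/2 * (x * u)))"
  define F where "F \<xi> = ?e \<xi> * of_real (hermite_fun a (\<xi> + u) * hermite_fun b \<xi>)" for \<xi>
  define f1 where "f1 \<xi> = ?e \<xi> * of_real (hermite_deriv a (\<xi> + u) * hermite_fun b \<xi>)" for \<xi>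
  define f2 where "f2 \<xi> = ?e \<xi> * of_real (hermite_fun a (\<xi> + u) * hermite_deriv b \<xi>)" for \<xi>
  note g = gauss_bounded_hermite
  obtain C where C: "\<And>\<xi>. cmod (F \<xi>) \<le> C * exp (- (1/4 * \<xi>\<^sup>2))"
    using wigner_integrand(1)[OF g(1)[of a] g(1)[of b], of x u] unfolding F_def by blast
  have i: "integrable lborel F" "integrable lborel f1" "integrable lborel f2"
    unfolding F_def f1_def f2_def by (intro wigner_integrand(3) g)+
  have c: "continuous_on UNIV F" "continuous_on UNIV f1" "continuous_on UNIV f2"
    unfolding F_def f1_def f2_def by (intro wigner_integrand(2) g)+
  have d: "(F has_vector_derivative (\<i> * of_real x * F \<xi> + f1 \<xi> + f2 \<xi>)) (at \<xi>)" for \<xi>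
  proof -
    have e': "(?e has_vector_derivative (\<i> * of_real x * ?e \<xi>)) (at \<xi>)"
    proof -
      have "((\<lambda>s. exp (\<i> * (of_real x * s + of_real (1/2 * (x * u))))) has_field_derivative (\<i> * of_real x * ?e \<xi>)) (at (of_real \<xi>))"
        by (auto intro!: derivative_eq_intros simp: mult_ac)
      from has_vector_derivative_real_field[OF this] show ?thesis by simp
    qed
    have "((\<lambda>\<xi>. hermite_fun a (\<xi> + u)) has_real_derivative hermite_deriv a (\<xi> + u)) (at \<xi>)"
      using hermite_fun_has_derivative[of a "\<xi> + u"] by (simp add: DERIV_shift)
    from DERIV_mult[OF this hermite_fun_has_derivative[of b \<xi>]]
    have "((\<lambda>\<xi>. complex_of_real (hermite_fun a (\<xi> + u) * hermite_fun b \<xi>)) has_vector_derivative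
        of_real (hermite_deriv a (\<xi> + u) * hermite_fun b \<xi> + hermite_deriv b \<xi> * hermite_fun a (\<xi> + u))) (at \<xi>)"
      by (intro has_vector_derivative_of_real) (simp add: has_real_derivative_iff_has_vector_derivative)
    from has_vector_derivative_mult[OF e' this] show ?thesis
      unfolding F_def f1_def f2_def by (rule has_vector_derivative_eq_rhs) (simp add: algebra_simps)
  qed
  have "(\<integral>\<xi>. \<i> * of_real x * F \<xi> + f1 \<xi> + f2 \<xi> \<partial>lborel) = 0"
    by (rule integral_derivative_zero[OF d _ C]) (intro continuous_intros c Bochner_Integration.integrable_add integrable_mult_right i)+
  then have "\<i> * of_real x * whermite a b x u + wigner x u (hermite_deriv a) (hermite_fun b) + wigner x u (hermite_fun a) (hermite_deriv b) = 0"
    using i unfolding wigner_def F_def f1_def f2_def by simp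
  moreover have hd: "hermite_deriv k = (\<lambda>s. (sqrt (2 * real k) / 2) * hermite_fun (k - 1) s + (- sqrt (2 * real (Suc k)) / 2) * hermite_fun (Suc k) s)" for k
    by (rule ext) (simp add: hermite_deriv_def field_simps)
  moreover have "wigner x u (hermite_deriv a) (hermite_fun b)
     = of_real (sqrt (2 * real a) / 2) * whermite (a - 1) b x u + of_real (- sqrt (2 * real (Suc a)) / 2) * whermite (Suc a) b x u"
    unfolding hd by (rule wigner_linear_left[OF g(1,1,1)])
  moreover have "wigner x u (hermite_fun a) (hermite_deriv b)
     = of_real (sqrt (2 * real b) / 2) * whermite a (b - 1) x u + of_real (- sqrt (2 * real (Suc b)) / 2) * whermite a (Suc b) x u"
    unfolding hd by (rule wigner_linear_right[OF g(1,1,1)])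
  ultimately have "\<i> * of_real x * whermite a b x u
     + (of_real (sqrt (2 * real a) / 2) * whermite (a - 1) b x u + of_real (- sqrt (2 * real (Suc a)) / 2) * whermite (Suc a) b x u)
     + (of_real (sqrt (2 * real b) / 2) * whermite a (b - 1) x u + of_real (- sqrt (2 * real (Suc b)) / 2) * whermite a (Suc b) x u) = 0"
    by simp
  then have eq: "\<i> * of_real x * whermite a b x u
     = - ((of_real (sqrt (2 * real a) / 2) * whermite (a - 1) b x u + of_real (- sqrt (2 * real (Suc a)) / 2) * whermite (Suc a) b x u)
     + (of_real (sqrt (2 * real b) / 2) * whermite a (b - 1) x u + of_real (- sqrt (2 * real (Suc b)) / 2) * whermite a (Suc b) x u))"
    by (simp only: eq_neg_iff_add_eq_0 add.assoc)
  have "2 * \<i> * of_real x * whermite a b x u = 2 * (\<i> * of_real x * whermite a b x u)"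
    by (simp only: mult.assoc)
  then show ?thesis unfolding eq by (simp add: algebra_simps)
qed

lemma whermite_00: "whermite 0 0 x u = exp (of_real (- (x\<^sup>2 + u\<^sup>2) / 4))"
proof -
  \<comment> \<open>The coefficient of \<xi> in the exponent: the oscillation contributes the
    imaginary part, the shifted Gaussian the real part.\<close>
  define z where "z = \<i> * of_real x - of_real u"
  have h: "hermite_fun 0 s = exp (- (s\<^sup>2) / 2) / sqrt (sqrt pi)" for s by (simp add: hermite_fun_def)
  have "exp (\<i> * of_real (x * \<xi> + 1/2 * (x * u))) * of_real (hermite_fun 0 (\<xi> + u) * hermite_fun 0 \<xi>)
     = (of_real (1 / sqrt pi) * exp (\<i> * of_real (1/2 * (x * u)) - of_real (u\<^sup>2 / 2))) * exp (of_real \<xi> * z - of_real (1 * \<xi>\<^sup>2))" for \<xi>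
  proof -
    have "hermite_fun 0 (\<xi> + u) * hermite_fun 0 \<xi> = 1 / sqrt pi * exp (- ((\<xi> + u)\<^sup>2) / 2 + - (\<xi>\<^sup>2) / 2)"
      unfolding h exp_add by simp
    then have "exp (\<i> * of_real (x * \<xi> + 1/2 * (x * u))) * of_real (hermite_fun 0 (\<xi> + u) * hermite_fun 0 \<xi>)
      = of_real (1 / sqrt pi) * (exp (\<i> * of_real (x * \<xi> + 1/2 * (x * u))) * exp (of_real (- ((\<xi> + u)\<^sup>2) / 2 + - (\<xi>\<^sup>2) / 2)))"
      by (simp only: of_real_mult exp_of_real mult_ac)
    also have "exp (\<i> * of_real (x * \<xi> + 1/2 * (x * u))) * exp (of_real (- ((\<xi> + u)\<^sup>2) / 2 + - (\<xi>\<^sup>2) / 2))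
      = exp (\<i> * of_real (1/2 * (x * u)) - of_real (u\<^sup>2 / 2)) * exp (of_real \<xi> * z - of_real (1 * \<xi>\<^sup>2))"
      unfolding exp_add[symmetric] by (rule arg_cong[where f = exp]) (simp add: z_def complex_eq_iff power2_eq_square field_simps)
    finally show ?thesis by (simp only: mult.assoc)
  qed
  then have "whermite 0 0 x u = (of_real (1 / sqrt pi) * exp (\<i> * of_real (1/2 * (x * u)) - of_real (u\<^sup>2 / 2)))
      * (of_real (sqrt (pi / 1)) * exp (z\<^sup>2 / of_real (4 * 1)))"
    unfolding wigner_def gaussian_integral_real[OF zero_less_one, of z, symmetric] by simp
  also have "\<dots> = exp (\<i> * of_real (1/2 * (x * u)) - of_real (u\<^sup>2 / 2)) * exp (z\<^sup>2 / of_real (4 * 1))"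
    by (simp add: mult_ac)
  also have "\<dots> = exp (of_real (- (x\<^sup>2 + u\<^sup>2) / 4))"
    unfolding exp_add[symmetric]
    by (rule arg_cong[where f = exp]) (simp add: z_def complex_eq_iff power2_eq_square field_simps)
  finally show ?thesis .
qed

lemma special_hermite_prod:
  fixes \<alpha> \<beta> :: "'n::finite \<Rightarrow> nat"
  shows "special_hermite \<alpha> \<beta> (x, u) = of_real ((2 * pi) powr (- real CARD('n) / 2))
    * (\<Prod>j\<in>UNIV. whermite (\<alpha> j) (\<beta> j) (x $ j) (u $ j))"
proof -
  let ?f = "\<lambda>j s. exp (\<i> * of_real (x $ j * s + 1/2 * (x $ j * u $ j))) * complex_of_real (hermite_fun (\<alpha> j) (s + u $ j) * hermite_fun (\<beta> j) s)"
  have "exp (\<i> * complex_of_real (x \<bullet> \<xi> + 1/2 * (x \<bullet> u))) * complex_of_real (hermite_fun_n \<alpha> (\<xi> + u) * hermite_fun_n \<beta> \<xi>)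
      = (\<Prod>j\<in>UNIV. ?f j (\<xi> $ j))" for \<xi>
  proof -
    have "\<i> * complex_of_real (x \<bullet> \<xi> + 1/2 * (x \<bullet> u)) = (\<Sum>j\<in>UNIV. \<i> * of_real (x $ j * \<xi> $ j + 1/2 * (x $ j * u $ j)))"
      unfolding inner_vec_def by (simp add: sum.distrib sum_distrib_left distrib_left)
    then show ?thesis
      unfolding hermite_fun_n_def by (simp add: exp_sum prod.distrib)
  qed
  moreover have "integrable lborel (?f j)" for j
    by (rule wigner_integrand(3)) simp_all
  ultimately show ?thesis
    unfolding special_hermite_def wigner_def using integral_vec_prod[of ?f] by simp
qed

lemma special_hermite_lam_prod:
  fixes \<alpha> \<beta> :: "'n::finite \<Rightarrow> nat"
  shows "special_hermite_lam lam \<alpha> \<beta> (x, u) = of_real (\<bar>lam\<bar> powr (real CARD('n) / 2) * (2 * pi) powr (- real CARD('n) / 2))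
    * (\<Prod>j\<in>UNIV. whermite (\<alpha> j) (\<beta> j) (sqrt \<bar>lam\<bar> * x $ j) (sgn lam * sqrt \<bar>lam\<bar> * u $ j))"
  unfolding special_hermite_lam_def by (simp add: special_hermite_prod)

lemma prod_fun_upd:
  fixes W :: "'c \<Rightarrow> 'n::finite \<Rightarrow> complex"
  shows "(\<Prod>i\<in>UNIV. W ((\<alpha>(j := a)) i) i) = W a j * (\<Prod>i\<in>UNIV - {j}. W (\<alpha> i) i)"
  by (subst prod.remove[of _ j]) (auto intro!: prod.cong)

lemma mult_linear_combination:
  fixes R :: complex
  assumes "F * w = (c1 * w1 + c2 * w2 + c3 * w3 + c4 * w4) / k"
  shows "F * (R * w) = (c1 / k) * (R * w1) + (c2 / k) * (R * w2) + (c3 / k) * (R * w3) + (c4 / k) * (R * w4)"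
proof -
  have "F * (R * w) = R * (F * w)" by simp
  then show ?thesis unfolding assms by (simp add: divide_inverse algebra_simps)
qed

text \<open>Only the factor with index \<open>j\<close> changes, so the one-variable rules apply
  with the rest of the product as a common factor. The coefficients are existential because all that
  matters later is that they do not depend on \<open>q\<close>.\<close>

lemma special_hermite_lam_mult_coord:
  fixes \<alpha> \<beta> :: "'n::finite \<Rightarrow> nat"
  assumes lam: "lam \<noteq> 0"
  shows "\<exists>c1 c2 c3 c4. \<forall>q. of_real (fst q $ j) * special_hermite_lam lam \<alpha> \<beta> q
      = c1 * special_hermite_lam lam (\<alpha>(j := Suc (\<alpha> j))) \<beta> q + c2 * special_hermite_lam lam (\<alpha>(j := \<alpha> j - 1)) \<beta> q
        + c3 * special_hermite_lam lam \<alpha> (\<beta>(j := Suc (\<beta> j))) q + c4 * special_hermite_lam lam \<alpha> (\<beta>(j := \<beta> j - 1)) q" (is ?X)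
    and "\<exists>c1 c2 c3 c4. \<forall>q. of_real (snd q $ j) * special_hermite_lam lam \<alpha> \<beta> q
      = c1 * special_hermite_lam lam (\<alpha>(j := Suc (\<alpha> j))) \<beta> q + c2 * special_hermite_lam lam (\<alpha>(j := \<alpha> j - 1)) \<beta> q
        + c3 * special_hermite_lam lam \<alpha> (\<beta>(j := Suc (\<beta> j))) q + c4 * special_hermite_lam lam \<alpha> (\<beta>(j := \<beta> j - 1)) q" (is ?U)
proof -
  define s s' where "s = sqrt \<bar>lam\<bar>" and "s' = sgn lam * sqrt \<bar>lam\<bar>"
  have s: "s \<noteq> 0" "s' \<noteq> 0" using lam by (auto simp: s_def s'_def sgn_zero_iff)
  define K where "K = complex_of_real (\<bar>lam\<bar> powr (real CARD('n) / 2) * (2 * pi) powr (- real CARD('n) / 2))"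
  define R where "R q = K * (\<Prod>i\<in>UNIV - {j}. whermite (\<alpha> i) (\<beta> i) (s * fst q $ i) (s' * snd q $ i))" for q
  have eqA: "special_hermite_lam lam (\<alpha>(j := a)) \<beta> q = R q * whermite a (\<beta> j) (s * fst q $ j) (s' * snd q $ j)" for a q
    using special_hermite_lam_prod[of lam "\<alpha>(j := a)" \<beta> "fst q" "snd q"]
      prod_fun_upd[of "\<lambda>a i. whermite a (\<beta> i) (s * fst q $ i) (s' * snd q $ i)" \<alpha> j a]
    by (simp add: K_def R_def s_def s'_def mult_ac)
  have eqB: "special_hermite_lam lam \<alpha> (\<beta>(j := b)) q = R q * whermite (\<alpha> j) b (s * fst q $ j) (s' * snd q $ j)" for b q
    using special_hermite_lam_prod[of lam \<alpha> "\<beta>(j := b)" "fst q" "snd q"]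
      prod_fun_upd[of "\<lambda>b i. whermite (\<alpha> i) b (s * fst q $ i) (s' * snd q $ i)" \<beta> j b]
    by (simp add: K_def R_def s_def s'_def mult_ac)
  have eq0: "special_hermite_lam lam \<alpha> \<beta> q = R q * whermite (\<alpha> j) (\<beta> j) (s * fst q $ j) (s' * snd q $ j)" for q
    using eqA[of "\<alpha> j" q] by simp
  let ?a = "\<alpha> j" and ?b = "\<beta> j"
  show ?X
  proof (intro exI allI)
    fix q :: "(real^'n) \<times> (real^'n)"
    define W where "W a b = whermite a b (s * fst q $ j) (s' * snd q $ j)" for a b
    have "2 * \<i> * of_real (s * fst q $ j) * W ?a ?b
      = of_real (sqrt (2 * real (Suc ?a))) * W (Suc ?a) ?b - of_real (sqrt (2 * real ?a)) * W (?a - 1) ?b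
      + (of_real (sqrt (2 * real (Suc ?b))) * W ?a (Suc ?b) - of_real (sqrt (2 * real ?b)) * W ?a (?b - 1))"
      unfolding W_def by (rule whermite_mult_x)
    then have "of_real (fst q $ j) * W ?a ?b = (of_real (sqrt (2 * real (Suc ?a))) * W (Suc ?a) ?b + (- of_real (sqrt (2 * real ?a))) * W (?a - 1) ?b
      + of_real (sqrt (2 * real (Suc ?b))) * W ?a (Suc ?b) + (- of_real (sqrt (2 * real ?b))) * W ?a (?b - 1)) / (2 * \<i> * of_real s)"
      using s by (simp add: nonzero_eq_divide_eq mult_ac)
    then show "of_real (fst q $ j) * special_hermite_lam lam \<alpha> \<beta> q
      = (of_real (sqrt (2 * real (Suc ?a))) / (2 * \<i> * of_real s)) * special_hermite_lam lam (\<alpha>(j := Suc (\<alpha> j))) \<beta> q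
        + (- of_real (sqrt (2 * real ?a)) / (2 * \<i> * of_real s)) * special_hermite_lam lam (\<alpha>(j := \<alpha> j - 1)) \<beta> q
        + (of_real (sqrt (2 * real (Suc ?b))) / (2 * \<i> * of_real s)) * special_hermite_lam lam \<alpha> (\<beta>(j := Suc (\<beta> j))) q
        + (- of_real (sqrt (2 * real ?b)) / (2 * \<i> * of_real s)) * special_hermite_lam lam \<alpha> (\<beta>(j := \<beta> j - 1)) q"
      unfolding eqA eqB eq0 W_def[symmetric] by (rule mult_linear_combination)
  qed
  show ?U
  proof (intro exI allI)
    fix q :: "(real^'n) \<times> (real^'n)"
    define W where "W a b = whermite a b (s * fst q $ j) (s' * snd q $ j)" for a b
    have "2 * of_real (s' * snd q $ j) * W ?a ?b
      = of_real (sqrt (2 * real (Suc ?a))) * W (Suc ?a) ?b + of_real (sqrt (2 * real ?a)) * W (?a - 1) ?b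
      - (of_real (sqrt (2 * real (Suc ?b))) * W ?a (Suc ?b) + of_real (sqrt (2 * real ?b)) * W ?a (?b - 1))"
      unfolding W_def by (rule whermite_mult_u)
    then have "of_real (snd q $ j) * W ?a ?b = (of_real (sqrt (2 * real (Suc ?a))) * W (Suc ?a) ?b + of_real (sqrt (2 * real ?a)) * W (?a - 1) ?b
      + (- of_real (sqrt (2 * real (Suc ?b)))) * W ?a (Suc ?b) + (- of_real (sqrt (2 * real ?b))) * W ?a (?b - 1)) / (2 * of_real s')"
      using s by (simp add: nonzero_eq_divide_eq mult_ac)
    then show "of_real (snd q $ j) * special_hermite_lam lam \<alpha> \<beta> q
      = (of_real (sqrt (2 * real (Suc ?a))) / (2 * of_real s')) * special_hermite_lam lam (\<alpha>(j := Suc (\<alpha> j))) \<beta> q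
        + (of_real (sqrt (2 * real ?a)) / (2 * of_real s')) * special_hermite_lam lam (\<alpha>(j := \<alpha> j - 1)) \<beta> q
        + (- of_real (sqrt (2 * real (Suc ?b))) / (2 * of_real s')) * special_hermite_lam lam \<alpha> (\<beta>(j := Suc (\<beta> j))) q
        + (- of_real (sqrt (2 * real ?b)) / (2 * of_real s')) * special_hermite_lam lam \<alpha> (\<beta>(j := \<beta> j - 1)) q"
      unfolding eqA eqB eq0 W_def[symmetric] by (rule mult_linear_combination)
  qed
qed

text \<open>The ground state is a Gaussian; totality is reduced to moments against it.\<close>

lemma special_hermite_lam_00:
  assumes lam: "lam \<noteq> 0"
  obtains K where "K > 0" "\<And>q :: (real^'n) \<times> (real^'n). special_hermite_lam lam (\<lambda>_. 0) (\<lambda>_. 0) q = of_real (K * exp (- (\<bar>lam\<bar> / 4 * (norm q)\<^sup>2)))"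
proof
  let ?K = "\<bar>lam\<bar> powr (real CARD('n) / 2) * (2 * pi) powr (- real CARD('n) / 2)"
  show "?K > 0" using lam by simp
  fix q :: "(real^'n) \<times> (real^'n)"
  obtain x u where q: "q = (x, u)" by (cases q)
  have s: "(sqrt \<bar>lam\<bar> * a)\<^sup>2 = \<bar>lam\<bar> * a\<^sup>2" "(sgn lam * sqrt \<bar>lam\<bar> * a)\<^sup>2 = \<bar>lam\<bar> * a\<^sup>2" for a
    using lam by (auto simp: power_mult_distrib sgn_if)
  have nq: "(norm q)\<^sup>2 = (\<Sum>j\<in>UNIV. (x $ j)\<^sup>2 + (u $ j)\<^sup>2)"
    unfolding power2_norm_eq_inner q by (simp add: inner_vec_def power2_eq_square sum.distrib)
  have "- (\<bar>lam\<bar> / 4 * (norm q)\<^sup>2) = (\<Sum>j\<in>UNIV. - (\<bar>lam\<bar> * (x $ j)\<^sup>2 + \<bar>lam\<bar> * (u $ j)\<^sup>2) / 4)"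
    unfolding nq sum_distrib_left sum_negf[symmetric] by (intro sum.cong) (auto simp: field_simps)
  then have "exp (- (\<bar>lam\<bar> / 4 * (norm q)\<^sup>2)) = (\<Prod>j\<in>UNIV. exp (- (\<bar>lam\<bar> * (x $ j)\<^sup>2 + \<bar>lam\<bar> * (u $ j)\<^sup>2) / 4))"
    by (simp only: exp_sum finite_class.finite_UNIV)
  then have "complex_of_real (exp (- (\<bar>lam\<bar> / 4 * (norm q)\<^sup>2))) = (\<Prod>j\<in>UNIV. exp (of_real (- (\<bar>lam\<bar> * (x $ j)\<^sup>2 + \<bar>lam\<bar> * (u $ j)\<^sup>2) / 4)))"
    by (simp only: of_real_prod exp_of_real)
  then show "special_hermite_lam lam (\<lambda>_. 0) (\<lambda>_. 0) q = of_real (?K * exp (- (\<bar>lam\<bar> / 4 * (norm q)\<^sup>2)))"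
    unfolding q special_hermite_lam_prod whermite_00 s by (simp only: of_real_mult)
qed

section \<open>Orthonormality of the special Hermite functions by Plancherel's identity\<close>

lemma fourier_diff_cmult:
  assumes "integrable lborel g1" "integrable lborel g2"
  shows "fourier (\<lambda>q. g1 q - c * g2 q) \<eta> = fourier g1 \<eta> - c * fourier g2 \<eta>"
proof -
  have i: "integrable lborel (\<lambda>q. g q * cis (q \<bullet> \<eta>))" if "integrable lborel g" for g :: "'a \<Rightarrow> complex"
    by (rule Bochner_Integration.integrable_bound[OF that]) (use that in \<open>auto simp: norm_mult\<close>)
  show ?thesis
    unfolding fourier_def integral_mult_right_zero[symmetric]
    by (subst Bochner_Integration.integral_diff[OF i[OF assms(1)] integrable_mult_right[OF i[OF assms(2)]], symmetric])
      (simp add: algebra_simps)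
qed

lemma fourier_l2:
  fixes g :: "'a::euclidean_space \<Rightarrow> complex"
  assumes g: "integrable lborel g" "sq_integrable lborel g"
  shows "sq_integrable lborel (fourier g)" "l2_normsq lborel (fourier g) = (2 * pi) ^ DIM('a) * l2_normsq lborel g"
proof -
  have [measurable]: "g \<in> borel_measurable borel" using g by auto
  show 1: "sq_integrable lborel (fourier g)"
    by (subst sq_integrable_iff_nn_integral) (auto simp: plancherel[OF g])
  show "l2_normsq lborel (fourier g) = (2 * pi) ^ DIM('a) * l2_normsq lborel g"
    using plancherel[OF g] nn_integral_eq_l2_normsq[OF 1] by simp
qed

lemma fourier_l2_inner:
  fixes g1 g2 :: "'a::euclidean_space \<Rightarrow> complex"
  assumes g1: "integrable lborel g1" "sq_integrable lborel g1" and g2: "integrable lborel g2" "sq_integrable lborel g2"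
  shows "l2_inner lborel (fourier g1) (fourier g2) = (2 * pi) ^ DIM('a) * l2_inner lborel g1 g2"
proof -
  have n: "l2_normsq lborel (\<lambda>q. fourier g1 q - c * fourier g2 q) = (2 * pi) ^ DIM('a) * l2_normsq lborel (\<lambda>q. g1 q - c * g2 q)" for c
    unfolding fourier_diff_cmult[OF g1(1) g2(1), symmetric]
    by (rule fourier_l2) (intro Bochner_Integration.integrable_diff integrable_mult_right sq_integrable_diff sq_integrable_cmult g1 g2)+
  have "4 * l2_inner lborel (fourier g1) (fourier g2) = (2 * pi) ^ DIM('a) * (4 * l2_inner lborel g1 g2)"
    unfolding l2_polarization[OF fourier_l2(1)[OF g1] fourier_l2(1)[OF g2]] l2_polarization[OF g1(2) g2(2)] n
    by (simp add: algebra_simps)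
  then show ?thesis by simp
qed

lemma measurable_hermite_fun_n [measurable]: "hermite_fun_n \<alpha> \<in> borel_measurable borel"
proof -
  have "continuous_on UNIV (hermite_fun_n \<alpha>)"
    unfolding hermite_fun_n_def[abs_def] by (intro continuous_intros)
  then show ?thesis by (rule borel_measurable_continuous_onI)
qed

lemma hermite_fun_n_bound: "\<exists>C\<ge>0. \<forall>x. \<bar>hermite_fun_n \<alpha> x\<bar> \<le> C * exp (- (1/4 * (norm x)\<^sup>2))"
proof -
  have "\<forall>j. \<exists>C\<ge>0. \<forall>x. \<bar>hermite_fun (\<alpha> j) x\<bar> \<le> C * exp (- (1/4 * x\<^sup>2))" using hermite_fun_bound by blast
  then obtain C where C: "\<And>j. C j \<ge> 0" "\<And>j x. \<bar>hermite_fun (\<alpha> j) x\<bar> \<le> C j * exp (- (1/4 * x\<^sup>2))" by metis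
  have "\<bar>hermite_fun_n \<alpha> x\<bar> \<le> (\<Prod>j\<in>UNIV. C j) * exp (- (1/4 * (norm x)\<^sup>2))" for x
  proof -
    have "\<bar>hermite_fun_n \<alpha> x\<bar> \<le> (\<Prod>j\<in>UNIV. C j * exp (- (1/4 * (x $ j)\<^sup>2)))"
      unfolding hermite_fun_n_def abs_prod by (intro prod_mono) (auto intro: C(2)[simplified] simp: C)
    also have "\<dots> = (\<Prod>j\<in>UNIV. C j) * exp (\<Sum>j\<in>UNIV. - (1/4 * (x $ j)\<^sup>2))"
      by (simp add: prod.distrib exp_sum)
    also have "(\<Sum>j\<in>UNIV. - (1/4 * (x $ j)\<^sup>2)) = - (1/4 * (norm x)\<^sup>2)"
      unfolding power2_norm_eq_inner inner_vec_def by (simp add: sum_negf sum_distrib_left power2_eq_square sum_divide_distrib)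
    finally show ?thesis .
  qed
  then show ?thesis using C by (intro exI[of _ "\<Prod>j\<in>UNIV. C j"]) (auto simp: prod_nonneg)
qed

lemma hermite_fun_n_orthonormal:
  fixes \<alpha> \<gamma> :: "'n::finite \<Rightarrow> nat"
  shows "integrable lborel (\<lambda>x. complex_of_real (hermite_fun_n \<alpha> x * hermite_fun_n \<gamma> x))"
    and "(\<integral>x. complex_of_real (hermite_fun_n \<alpha> x * hermite_fun_n \<gamma> x) \<partial>lborel) = (if \<alpha> = \<gamma> then 1 else 0)"
proof -
  obtain C where C: "C \<ge> 0" "\<And>x. \<bar>hermite_fun_n \<alpha> x\<bar> \<le> C * exp (- (1/4 * (norm x)\<^sup>2))" using hermite_fun_n_bound by blast
  obtain D where D: "D \<ge> 0" "\<And>x. \<bar>hermite_fun_n \<gamma> x\<bar> \<le> D * exp (- (1/4 * (norm x)\<^sup>2))" using hermite_fun_n_bound by blast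
  have "cmod (complex_of_real (hermite_fun_n \<alpha> x * hermite_fun_n \<gamma> x)) \<le> (C * D) * exp (- (1/2 * (norm x)\<^sup>2))" for x
  proof -
    have "\<bar>hermite_fun_n \<alpha> x * hermite_fun_n \<gamma> x\<bar> \<le> (C * exp (- (1/4 * (norm x)\<^sup>2))) * (D * exp (- (1/4 * (norm x)\<^sup>2)))"
      unfolding abs_mult by (intro mult_mono C D) (use C D in auto)
    also have "\<dots> = (C * D) * (exp (- (1/4 * (norm x)\<^sup>2)) * exp (- (1/4 * (norm x)\<^sup>2)))" by (simp only: mult_ac)
    also have "exp (- (1/4 * (norm x)\<^sup>2)) * exp (- (1/4 * (norm x)\<^sup>2)) = exp (- (1/2 * (norm x)\<^sup>2))"
      unfolding exp_add[symmetric] by simp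
    finally show ?thesis unfolding norm_of_real .
  qed
  then show "integrable lborel (\<lambda>x. complex_of_real (hermite_fun_n \<alpha> x * hermite_fun_n \<gamma> x))"
    by (intro integrable_gauss_bound[where c = "1/2"]) auto
  have "(\<integral>x. complex_of_real (hermite_fun_n \<alpha> x * hermite_fun_n \<gamma> x) \<partial>lborel)
     = (\<integral>x. (\<Prod>j\<in>UNIV. complex_of_real (hermite_fun (\<alpha> j) (x $ j) * hermite_fun (\<gamma> j) (x $ j))) \<partial>lborel)"
    unfolding hermite_fun_n_def by (simp add: prod.distrib)
  also have "\<dots> = (\<Prod>j\<in>UNIV. \<integral>x. complex_of_real (hermite_fun (\<alpha> j) x * hermite_fun (\<gamma> j) x) \<partial>lborel)"
    using integral_vec_prod[of "\<lambda>j x. complex_of_real (hermite_fun (\<alpha> j) x * hermite_fun (\<gamma> j) x)"] hermite_fun_orthonormal(1)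
    by (simp add: complex_of_real_integrable_eq del: of_real_mult)
  also have "\<dots> = (\<Prod>j\<in>UNIV. if \<alpha> j = \<gamma> j then 1 else 0)"
    by (intro prod.cong refl) (simp add: hermite_fun_orthonormal(2) del: of_real_mult)
  also have "\<dots> = (if \<alpha> = \<gamma> then 1 else 0)"
    by (auto simp: fun_eq_iff)
  finally show "(\<integral>x. complex_of_real (hermite_fun_n \<alpha> x * hermite_fun_n \<gamma> x) \<partial>lborel) = (if \<alpha> = \<gamma> then 1 else 0)" .
qed

text \<open>Moyal's identity. For fixed \<open>u\<close>, Plancherel in \<open>x\<close> leaves the
  integral of \<open>a \<xi> * b (\<xi> + u)\<close>, and integration over \<open>u\<close>
  separates this into two Hermite inner products.\<close>

lemma special_hermite_orthonormal:
  fixes \<alpha> \<beta> \<gamma> \<delta> :: "'n::finite \<Rightarrow> nat"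
  shows "sq_integrable lborel (special_hermite \<alpha> \<beta>)"
    and "l2_inner lborel (special_hermite \<alpha> \<beta>) (special_hermite \<gamma> \<delta>) = (if \<alpha> = \<gamma> \<and> \<beta> = \<delta> then 1 else 0)"
proof -
  define N where "N = (2 * pi) powr (- real CARD('n) / 2)"
  \<comment> \<open>The normalization is the one that cancels the constant in Plancherel's
    identity.\<close>
  have N2: "N\<^sup>2 * (2 * pi) ^ CARD('n) = 1"
  proof -
    have *: "N\<^sup>2 = (2 * pi) powr (- real CARD('n))"
      unfolding N_def power2_eq_square powr_add[symmetric] by simp
    have **: "(2 * pi) ^ CARD('n) = (2 * pi) powr real CARD('n)"
      by (subst powr_realpow) simp_all
    show ?thesis unfolding * ** powr_add[symmetric] by simp
  qed
  define h where "h \<alpha> \<beta> u \<xi> = complex_of_real (hermite_fun_n \<alpha> (\<xi> + u) * hermite_fun_n \<beta> \<xi>)"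
    for \<alpha> \<beta> :: "'n \<Rightarrow> nat" and u \<xi> :: "real^'n"
  have hm [measurable]: "h \<alpha> \<beta> u \<in> borel_measurable borel" for \<alpha> \<beta> u unfolding h_def[abs_def] by measurable
  have hi: "integrable lborel (h \<alpha> \<beta> u)" and h2: "sq_integrable lborel (h \<alpha> \<beta> u)" for \<alpha> \<beta> u
  proof -
    obtain C where C: "C \<ge> 0" "\<And>x. \<bar>hermite_fun_n \<alpha> x\<bar> \<le> C * exp (- (1/4 * (norm x)\<^sup>2))" using hermite_fun_n_bound by blast
    obtain D where D: "D \<ge> 0" "\<And>x. \<bar>hermite_fun_n \<beta> x\<bar> \<le> D * exp (- (1/4 * (norm x)\<^sup>2))" using hermite_fun_n_bound by blast
    have CA: "\<bar>hermite_fun_n \<alpha> x\<bar> \<le> C" for x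
      using C(2)[of x] mult_left_le[of "exp (- (1/4 * (norm x)\<^sup>2))" C] C(1) by simp
    have b: "cmod (h \<alpha> \<beta> u \<xi>) \<le> (C * D) * exp (- (1/4 * (norm \<xi>)\<^sup>2))" for \<xi>
    proof -
      have "cmod (h \<alpha> \<beta> u \<xi>) = \<bar>hermite_fun_n \<alpha> (\<xi> + u)\<bar> * \<bar>hermite_fun_n \<beta> \<xi>\<bar>" by (simp add: h_def abs_mult norm_mult)
      also have "\<dots> \<le> C * (D * exp (- (1/4 * (norm \<xi>)\<^sup>2)))" by (intro mult_mono CA D(2)) (use C in auto)
      finally show ?thesis by simp
    qed
    show "integrable lborel (h \<alpha> \<beta> u)" by (rule integrable_gauss_bound[OF hm b]) simp
    have "integrable lborel (\<lambda>\<xi>::real^'n. (C * D)\<^sup>2 * exp (- (1/2 * (norm \<xi>)\<^sup>2)))"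
      using gaussian_abs_integrable[of "1/2" "0::real^'n"] by simp
    moreover have "(cmod (h \<alpha> \<beta> u \<xi>))\<^sup>2 \<le> (C * D)\<^sup>2 * exp (- (1/2 * (norm \<xi>)\<^sup>2))" for \<xi>
    proof -
      have "(cmod (h \<alpha> \<beta> u \<xi>))\<^sup>2 \<le> ((C * D) * exp (- (1/4 * (norm \<xi>)\<^sup>2)))\<^sup>2" by (intro power_mono b) simp
      also have "\<dots> = (C * D)\<^sup>2 * exp (2 * - (1/4 * (norm \<xi>)\<^sup>2))" unfolding power_mult_distrib[of "C * D"] exp_double ..
      finally show ?thesis by simp
    qed
    ultimately show "sq_integrable lborel (h \<alpha> \<beta> u)" by (rule sq_integrableI_bound[rotated]) simp
  qed
  \<comment> \<open>The symmetrizing phase is independent of \<xi> and has modulus 1, so it drops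
    out of norms and of products with a conjugate at the same point.\<close>
  have SH: "special_hermite \<alpha> \<beta> (x, u) = of_real N * (cis (x \<bullet> u / 2) * fourier (h \<alpha> \<beta> u) x)" for \<alpha> \<beta> :: "'n \<Rightarrow> nat" and x u
  proof -
    have "exp (\<i> * complex_of_real (x \<bullet> \<xi> + 1/2 * (x \<bullet> u))) = cis (x \<bullet> u / 2) * cis (\<xi> \<bullet> x)" for \<xi>
      unfolding cis_mult by (simp add: cis_conv_exp inner_commute add.commute)
    then show ?thesis
      unfolding special_hermite_def fourier_def h_def N_def integral_mult_right_zero[symmetric]
      by (simp add: mult_ac)
  qed
  have SHm [measurable]: "special_hermite \<alpha> \<beta> \<in> borel_measurable borel" for \<alpha> \<beta> :: "'n \<Rightarrow> nat"
    unfolding special_hermite_def case_prod_unfold by measurable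
  have SHx: "(\<integral>\<^sup>+x. ennreal ((cmod (special_hermite \<alpha> \<beta> (x, u)))\<^sup>2) \<partial>lborel) = (\<integral>\<^sup>+\<xi>. ennreal ((cmod (h \<alpha> \<beta> u \<xi>))\<^sup>2) \<partial>lborel)"
    for \<alpha> \<beta> :: "'n \<Rightarrow> nat" and u
  proof -
    have "(\<integral>\<^sup>+x. ennreal ((cmod (special_hermite \<alpha> \<beta> (x, u)))\<^sup>2) \<partial>lborel)
       = (\<integral>\<^sup>+x. ennreal (N\<^sup>2) * ennreal ((cmod (fourier (h \<alpha> \<beta> u) x))\<^sup>2) \<partial>lborel)"
      unfolding SH norm_mult power_mult_distrib norm_cis by (simp add: ennreal_mult)
    also have "\<dots> = ennreal (N\<^sup>2) * ennreal ((2 * pi) ^ CARD('n) * l2_normsq lborel (h \<alpha> \<beta> u))"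
      by (subst nn_integral_cmult) (auto simp: plancherel[OF hi h2])
    also have "\<dots> = ennreal ((N\<^sup>2 * (2 * pi) ^ CARD('n)) * l2_normsq lborel (h \<alpha> \<beta> u))"
      by (simp add: ennreal_mult mult.assoc)
    finally show ?thesis unfolding N2 nn_integral_eq_l2_normsq[OF h2] by simp
  qed
  show SH2: "sq_integrable lborel (special_hermite \<alpha> \<beta>)" for \<alpha> \<beta> :: "'n \<Rightarrow> nat"
  proof -
    have int: "integrable lborel (\<lambda>x. (hermite_fun_n \<gamma> x)\<^sup>2)" for \<gamma> :: "'n \<Rightarrow> nat"
      using hermite_fun_n_orthonormal(1)[of \<gamma> \<gamma>]
      by (simp add: complex_of_real_integrable_eq power2_eq_square del: of_real_mult)
    then have fin: "(\<integral>\<^sup>+x. ennreal ((hermite_fun_n \<gamma> x)\<^sup>2) \<partial>lborel) < \<infinity>" for \<gamma> :: "'n \<Rightarrow> nat"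
      using integrableD(2)[OF int[of \<gamma>]] by (simp add: less_top[symmetric])
    have "(\<integral>\<^sup>+p. ennreal ((cmod (special_hermite \<alpha> \<beta> p))\<^sup>2) \<partial>lborel)
      = (\<integral>\<^sup>+u. \<integral>\<^sup>+x. ennreal ((cmod (special_hermite \<alpha> \<beta> (x, u)))\<^sup>2) \<partial>lborel \<partial>lborel)"
      by (rule nn_integral_lborel_snd) measurable
    also have "\<dots> = (\<integral>\<^sup>+u. \<integral>\<^sup>+\<xi>. ennreal ((hermite_fun_n \<alpha> (\<xi> + u))\<^sup>2) * ennreal ((hermite_fun_n \<beta> \<xi>)\<^sup>2) \<partial>lborel \<partial>lborel)"
      unfolding SHx h_def norm_of_real power2_abs power_mult_distrib by (simp add: ennreal_mult)
    also have "\<dots> = (\<integral>\<^sup>+\<xi>. \<integral>\<^sup>+u. ennreal ((hermite_fun_n \<alpha> (\<xi> + u))\<^sup>2) * ennreal ((hermite_fun_n \<beta> \<xi>)\<^sup>2) \<partial>lborel \<partial>lborel)"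
      by (rule lborel_pair.Fubini') measurable
    also have "\<dots> = (\<integral>\<^sup>+\<xi>. (\<integral>\<^sup>+x. ennreal ((hermite_fun_n \<alpha> x)\<^sup>2) \<partial>lborel) * ennreal ((hermite_fun_n \<beta> \<xi>)\<^sup>2) \<partial>lborel)"
    proof (rule nn_integral_cong)
      fix \<xi> :: "real^'n"
      have "(\<integral>\<^sup>+u. ennreal ((hermite_fun_n \<alpha> (\<xi> + u))\<^sup>2) \<partial>lborel) = (\<integral>\<^sup>+x. ennreal ((hermite_fun_n \<alpha> x)\<^sup>2) \<partial>lborel)"
        by (rule nn_integral_lborel_shift[where f = "\<lambda>x. ennreal ((hermite_fun_n \<alpha> x)\<^sup>2)"]) measurable
      then show "(\<integral>\<^sup>+u. ennreal ((hermite_fun_n \<alpha> (\<xi> + u))\<^sup>2) * ennreal ((hermite_fun_n \<beta> \<xi>)\<^sup>2) \<partial>lborel)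
         = (\<integral>\<^sup>+x. ennreal ((hermite_fun_n \<alpha> x)\<^sup>2) \<partial>lborel) * ennreal ((hermite_fun_n \<beta> \<xi>)\<^sup>2)"
        by (subst nn_integral_multc) auto
    qed
    also have "\<dots> = (\<integral>\<^sup>+x. ennreal ((hermite_fun_n \<alpha> x)\<^sup>2) \<partial>lborel) * (\<integral>\<^sup>+x. ennreal ((hermite_fun_n \<beta> x)\<^sup>2) \<partial>lborel)"
      by (rule nn_integral_cmult) measurable
    also have "\<dots> < \<infinity>"
      using fin by (simp add: ennreal_mult_less_top)
    finally show ?thesis by (subst sq_integrable_iff_nn_integral) auto
  qed
  let ?F = "\<lambda>p. special_hermite \<alpha> \<beta> p * cnj (special_hermite \<gamma> \<delta> p)"
  define a where "a \<xi> = complex_of_real (hermite_fun_n \<beta> \<xi> * hermite_fun_n \<delta> \<xi>)" for \<xi>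
  define b where "b \<xi> = complex_of_real (hermite_fun_n \<alpha> \<xi> * hermite_fun_n \<gamma> \<xi>)" for \<xi>
  have ai: "integrable lborel a" and bi: "integrable lborel b"
    unfolding a_def b_def by (rule hermite_fun_n_orthonormal(1))+
  have [measurable]: "a \<in> borel_measurable borel" "b \<in> borel_measurable borel" using ai bi by auto
  have inner: "(\<integral>x. ?F (x, u) \<partial>lborel) = (\<integral>\<xi>. a \<xi> * b (\<xi> + u) \<partial>lborel)" for u
  proof -
    have "?F (x, u) = of_real (N\<^sup>2) * (fourier (h \<alpha> \<beta> u) x * cnj (fourier (h \<gamma> \<delta> u) x))" for x
    proof -
      have c1: "cis (x \<bullet> u / 2) * cnj (cis (x \<bullet> u / 2)) = 1" by (simp add: cis_cnj cis_mult)
      have "?F (x, u) = of_real N * of_real N * (cis (x \<bullet> u / 2) * cnj (cis (x \<bullet> u / 2))) * (fourier (h \<alpha> \<beta> u) x * cnj (fourier (h \<gamma> \<delta> u) x))"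
        unfolding SH complex_cnj_mult complex_cnj_complex_of_real by (simp only: mult_ac)
      then show ?thesis unfolding c1 by (simp add: power2_eq_square)
    qed
    then have "(\<integral>x. ?F (x, u) \<partial>lborel) = of_real (N\<^sup>2) * l2_inner lborel (fourier (h \<alpha> \<beta> u)) (fourier (h \<gamma> \<delta> u))"
      by (simp add: l2_inner_def)
    also have "\<dots> = of_real (N\<^sup>2 * (2 * pi) ^ CARD('n)) * l2_inner lborel (h \<alpha> \<beta> u) (h \<gamma> \<delta> u)"
      by (simp add: fourier_l2_inner[OF hi h2 hi h2])
    finally show ?thesis unfolding N2 by (simp add: l2_inner_def h_def a_def b_def mult_ac)
  qed
  have Fi: "integrable (lborel \<Otimes>\<^sub>M lborel) (\<lambda>(x, u). ?F (x, u))"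
    using integrable_mult_cnj[OF SH2[of \<alpha> \<beta>] SH2[of \<gamma> \<delta>]] by (simp add: lborel_prod case_prod_unfold)
  have ab: "integrable (lborel \<Otimes>\<^sub>M lborel) (\<lambda>(\<xi>, u). a \<xi> * b (\<xi> + u))"
  proof (rule lborel_pair.Fubini_integrable)
    show "(\<lambda>(\<xi>, u). a \<xi> * b (\<xi> + u)) \<in> borel_measurable (lborel \<Otimes>\<^sub>M lborel)" by measurable
    have "(\<integral>u. norm (a \<xi> * b (\<xi> + u)) \<partial>lborel) = norm (a \<xi>) * (\<integral>u. norm (b u) \<partial>lborel)" for \<xi>
      unfolding norm_mult integral_mult_right_zero
      by (rule arg_cong[OF integral_lborel_shift[where f = "\<lambda>x. norm (b x)"]]) measurable
    then show "integrable lborel (\<lambda>\<xi>. \<integral>u. norm (case (\<xi>, u) of (\<xi>, u) \<Rightarrow> a \<xi> * b (\<xi> + u)) \<partial>lborel)"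
      using ai by simp
    show "AE \<xi> in lborel. integrable lborel (\<lambda>u. case (\<xi>, u) of (\<xi>, u) \<Rightarrow> a \<xi> * b (\<xi> + u))"
      using integrable_lborel_shift[OF bi] by simp
  qed
  have "l2_inner lborel (special_hermite \<alpha> \<beta>) (special_hermite \<gamma> \<delta>) = (\<integral>p. ?F p \<partial>(lborel \<Otimes>\<^sub>M lborel))"
    unfolding l2_inner_def lborel_prod ..
  also have "\<dots> = (\<integral>u. (\<integral>x. ?F (x, u) \<partial>lborel) \<partial>lborel)"
    using lborel_pair.integral_snd[OF Fi] by (simp add: case_prod_unfold)
  also have "\<dots> = (\<integral>u. (\<integral>\<xi>. a \<xi> * b (\<xi> + u) \<partial>lborel) \<partial>lborel)"
    unfolding inner ..
  also have "\<dots> = (\<integral>\<xi>. (\<integral>u. a \<xi> * b (\<xi> + u) \<partial>lborel) \<partial>lborel)"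
    by (rule lborel_pair.Fubini_integral[OF ab])
  also have "\<dots> = (\<integral>\<xi>. a \<xi> * (\<integral>x. b x \<partial>lborel) \<partial>lborel)"
    unfolding integral_mult_right_zero by (subst integral_lborel_shift[of b]) simp_all
  also have "\<dots> = (\<integral>\<xi>. a \<xi> \<partial>lborel) * (\<integral>x. b x \<partial>lborel)" by simp
  also have "\<dots> = (if \<alpha> = \<gamma> \<and> \<beta> = \<delta> then 1 else 0)"
    unfolding a_def b_def hermite_fun_n_orthonormal(2) by simp
  finally show "l2_inner lborel (special_hermite \<alpha> \<beta>) (special_hermite \<gamma> \<delta>) = (if \<alpha> = \<gamma> \<and> \<beta> = \<delta> then 1 else 0)" .
qed

text \<open>Applied with \<open>\<sigma> = sgn lam\<close>: for negative \<open>lam\<close> the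
  scaled special Hermite functions reflect the second variable.\<close>

lemma lborel_distr_reflect:
  assumes s: "\<bar>\<sigma>\<bar> = (1::real)"
  shows "distr lborel borel (\<lambda>p::'a::euclidean_space \<times> 'b::euclidean_space. (fst p, \<sigma> *\<^sub>R snd p)) = lborel"
proof (rule measure_eqI)
  let ?R = "\<lambda>p::'a \<times> 'b. (fst p, \<sigma> *\<^sub>R snd p)"
  have R [measurable]: "?R \<in> borel \<rightarrow>\<^sub>M borel"
    by (intro borel_measurable_continuous_onI continuous_intros)
  fix A :: "('a \<times> 'b) set" assume "A \<in> sets (distr lborel borel ?R)"
  then have A [measurable]: "A \<in> sets borel" by simp
  have ind: "(indicator A :: 'a \<times> 'b \<Rightarrow> ennreal) \<in> borel_measurable borel" by simp
  have "emeasure (distr lborel borel ?R) A = (\<integral>\<^sup>+p. indicator A p \<partial>distr lborel borel ?R)" by simp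
  also have "\<dots> = (\<integral>\<^sup>+p. indicator A (?R p) \<partial>lborel)" by (rule nn_integral_distr) auto
  also have "\<dots> = (\<integral>\<^sup>+x. \<integral>\<^sup>+y. indicator A (x, \<sigma> *\<^sub>R y) \<partial>lborel \<partial>lborel)"
    by (subst nn_integral_lborel_fst) simp_all
  also have "\<dots> = (\<integral>\<^sup>+x. \<integral>\<^sup>+y. indicator A (x, y) \<partial>lborel \<partial>lborel)"
  proof (rule nn_integral_cong)
    fix x :: 'a
    have "(indicator A :: 'a \<times> 'b \<Rightarrow> ennreal) \<in> borel_measurable (borel \<Otimes>\<^sub>M borel)" using ind by (simp add: borel_prod)
    then have "(\<lambda>y. indicator A (x, y) :: ennreal) \<in> borel_measurable borel" by measurable
    from nn_integral_lborel_affine[OF this, of \<sigma> 0] s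
    show "(\<integral>\<^sup>+y. indicator A (x, \<sigma> *\<^sub>R y) \<partial>lborel) = (\<integral>\<^sup>+y. indicator A (x, y) \<partial>lborel)" by auto
  qed
  also have "\<dots> = emeasure lborel A"
    by (subst nn_integral_lborel_fst[OF ind, symmetric]) simp
  finally show "emeasure (distr lborel borel ?R) A = emeasure lborel A" .
qed simp

lemma
  fixes F :: "(real^'n) \<times> (real^'n) \<Rightarrow> 'b::{banach,second_countable_topology}"
  assumes F: "integrable lborel F" and lam: "lam \<noteq> 0"
  shows integrable_twist_scale: "integrable lborel (\<lambda>p. F (sqrt \<bar>lam\<bar> *\<^sub>R fst p, (sgn lam * sqrt \<bar>lam\<bar>) *\<^sub>R snd p))"
    and integral_twist_scale: "(\<bar>lam\<bar> ^ CARD('n)) *\<^sub>R (\<integral>p. F (sqrt \<bar>lam\<bar> *\<^sub>R fst p, (sgn lam * sqrt \<bar>lam\<bar>) *\<^sub>R snd p) \<partial>lborel) = (\<integral>p. F p \<partial>lborel)"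
proof -
  have Fm [measurable]: "F \<in> borel_measurable borel" using F by auto
  let ?R = "\<lambda>p::(real^'n) \<times> (real^'n). (fst p, sgn lam *\<^sub>R snd p)"
  have R [measurable]: "?R \<in> borel \<rightarrow>\<^sub>M borel"
    by (intro borel_measurable_continuous_onI continuous_intros)
  have s: "\<bar>sgn lam\<bar> = 1" using lam by (simp add: sgn_if)
  have FR: "integrable lborel (\<lambda>p. F (?R p))"
    using F by (subst (asm) lborel_distr_reflect[OF s, symmetric]) (simp add: integrable_distr_eq)
  have r: "sqrt \<bar>lam\<bar> \<noteq> 0" using lam by simp
  have e: "?R (0 + sqrt \<bar>lam\<bar> *\<^sub>R p) = (sqrt \<bar>lam\<bar> *\<^sub>R fst p, (sgn lam * sqrt \<bar>lam\<bar>) *\<^sub>R snd p)" for p by simp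
  show "integrable lborel (\<lambda>p. F (sqrt \<bar>lam\<bar> *\<^sub>R fst p, (sgn lam * sqrt \<bar>lam\<bar>) *\<^sub>R snd p))"
    using integrable_lborel_affine[OF FR r, of 0] unfolding e .
  have d: "\<bar>sqrt \<bar>lam\<bar>\<bar> ^ DIM((real^'n) \<times> (real^'n)) = \<bar>lam\<bar> ^ CARD('n)"
    by (simp add: power_add power_mult_distrib[symmetric])
  have "(\<integral>p. F p \<partial>lborel) = (\<integral>p. F (?R p) \<partial>lborel)"
    by (subst lborel_distr_reflect[OF s, symmetric]) (simp add: integral_distr)
  also have "\<dots> = (\<bar>lam\<bar> ^ CARD('n)) *\<^sub>R (\<integral>p. F (?R (0 + sqrt \<bar>lam\<bar> *\<^sub>R p)) \<partial>lborel)"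
    using integral_lborel_affine[of "\<lambda>p. F (?R p)", OF _ r, of 0] unfolding d by simp
  finally show "(\<bar>lam\<bar> ^ CARD('n)) *\<^sub>R (\<integral>p. F (sqrt \<bar>lam\<bar> *\<^sub>R fst p, (sgn lam * sqrt \<bar>lam\<bar>) *\<^sub>R snd p) \<partial>lborel) = (\<integral>p. F p \<partial>lborel)"
    unfolding e by simp
qed

lemma special_hermite_lam_orthonormal:
  fixes \<alpha> \<beta> \<gamma> \<delta> :: "'n::finite \<Rightarrow> nat"
  assumes lam: "lam \<noteq> 0"
  shows "sq_integrable lborel (special_hermite_lam lam \<alpha> \<beta>)"
    and "l2_inner lborel (special_hermite_lam lam \<alpha> \<beta>) (special_hermite_lam lam \<gamma> \<delta>) = (if \<alpha> = \<gamma> \<and> \<beta> = \<delta> then 1 else 0)"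
proof -
  define K where "K = \<bar>lam\<bar> powr (real CARD('n) / 2)"
  \<comment> \<open>The squared prefactor is the Jacobian of the dilation by
    \<open>sqrt \<bar>lam\<bar>\<close> in all \<open>2 * CARD('n)\<close> real coordinates.\<close>
  have K2: "K * K = \<bar>lam\<bar> ^ CARD('n)"
    unfolding K_def powr_add[symmetric] using lam by (simp add: powr_realpow)
  let ?D = "\<lambda>p::(real^'n) \<times> (real^'n). (sqrt \<bar>lam\<bar> *\<^sub>R fst p, (sgn lam * sqrt \<bar>lam\<bar>) *\<^sub>R snd p)"
  have SL: "special_hermite_lam lam \<alpha> \<beta> p = of_real K * special_hermite \<alpha> \<beta> (?D p)" for \<alpha> \<beta> :: "'n \<Rightarrow> nat" and p
    by (simp add: special_hermite_lam_def K_def case_prod_unfold)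
  have D [measurable]: "?D \<in> borel \<rightarrow>\<^sub>M borel"
    by (intro borel_measurable_continuous_onI continuous_intros)
  have m [measurable]: "special_hermite \<alpha> \<beta> \<in> borel_measurable borel" for \<alpha> \<beta> :: "'n \<Rightarrow> nat"
    using special_hermite_orthonormal(1)[of \<alpha> \<beta>] by (auto simp: sq_integrable_def)
  have i: "integrable lborel (\<lambda>p. special_hermite \<alpha> \<beta> p * cnj (special_hermite \<gamma> \<delta> p))"
    by (intro integrable_mult_cnj special_hermite_orthonormal)
  have "integrable lborel (\<lambda>p. (cmod (special_hermite \<alpha> \<beta> p))\<^sup>2)"
    using special_hermite_orthonormal(1)[of \<alpha> \<beta>] by (simp add: sq_integrable_def)
  from integrable_twist_scale[OF this lam]
  have "integrable lborel (\<lambda>p. (cmod (special_hermite \<alpha> \<beta> (?D p)))\<^sup>2)" .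
  moreover have "(\<lambda>p. special_hermite \<alpha> \<beta> (?D p)) \<in> borel_measurable borel" by measurable
  ultimately have "sq_integrable lborel (\<lambda>p. special_hermite \<alpha> \<beta> (?D p))"
    by (simp add: sq_integrable_def)
  then show "sq_integrable lborel (special_hermite_lam lam \<alpha> \<beta>)"
    unfolding SL[abs_def] by (rule sq_integrable_cmult)
  have "l2_inner lborel (special_hermite_lam lam \<alpha> \<beta>) (special_hermite_lam lam \<gamma> \<delta>)
     = (\<integral>p. of_real (K * K) * (special_hermite \<alpha> \<beta> (?D p) * cnj (special_hermite \<gamma> \<delta> (?D p))) \<partial>lborel)"
    unfolding l2_inner_def SL by (simp add: mult_ac)
  also have "\<dots> = (\<bar>lam\<bar> ^ CARD('n)) *\<^sub>R (\<integral>p. special_hermite \<alpha> \<beta> (?D p) * cnj (special_hermite \<gamma> \<delta> (?D p)) \<partial>lborel)"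
    unfolding K2 by (simp add: scaleR_conv_of_real)
  also have "\<dots> = l2_inner lborel (special_hermite \<alpha> \<beta>) (special_hermite \<gamma> \<delta>)"
    unfolding integral_twist_scale[OF i lam] l2_inner_def ..
  finally show "l2_inner lborel (special_hermite_lam lam \<alpha> \<beta>) (special_hermite_lam lam \<gamma> \<delta>) = (if \<alpha> = \<gamma> \<and> \<beta> = \<delta> then 1 else 0)"
    unfolding special_hermite_orthonormal(2) .
qed

subsection \<open>Surjectivity and the orthonormal basis\<close>

text \<open>The bridge from moments to the Fourier transform is the exponential series, which the
  Gaussian factor keeps dominated. Functions are determined only up to null sets, hence a conclusion
  about the norm.\<close>

lemma special_hermite_lam_total:
  fixes f :: "(real^'n) \<times> (real^'n) \<Rightarrow> complex"
  assumes lam: "lam \<noteq> 0" and f: "sq_integrable lborel f"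
    and orth: "\<And>\<alpha> \<beta>. l2_inner lborel f (special_hermite_lam lam \<alpha> \<beta>) = 0"
  shows "l2_normsq lborel f = 0"
proof -
  have fm [measurable]: "f \<in> borel_measurable borel" using f by (auto simp: sq_integrable_def)
  define \<gamma> where "\<gamma> = \<bar>lam\<bar> / 4"
  have \<gamma>: "\<gamma> > 0" using lam by (simp add: \<gamma>_def)
  \<comment> \<open>Orthogonality to \<open>f\<close> together with integrability of the product,
    which makes the condition closed under sums.\<close>
  define Q where "Q g \<longleftrightarrow> integrable lborel (\<lambda>q. f q * cnj (g q)) \<and> (\<integral>q. f q * cnj (g q) \<partial>lborel) = 0" for g
  have Qadd: "Q (\<lambda>q. g q + g' q)" if "Q g" "Q g'" for g g'
    using that unfolding Q_def by (simp add: distrib_left)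
  have Qmult: "Q (\<lambda>q. c * g q)" if "Q g" for g c
  proof -
    have e: "f q * cnj (c * g q) = cnj c * (f q * cnj (g q))" for q by simp
    show ?thesis using that unfolding Q_def e by simp
  qed
  have Qsum: "Q (\<lambda>q. \<Sum>j\<in>A. g j q)" if "\<And>j. j \<in> A \<Longrightarrow> Q (g j)" for A :: "'n set" and g
    using that
  proof (induction A rule: infinite_finite_induct)
    case (insert x A)
    then show ?case using Qadd[of "g x" "\<lambda>q. \<Sum>j\<in>A. g j q"] by simp
  qed (simp_all add: Q_def)
  \<comment> \<open>The indices are generalized since each multiplication by a coordinate leads to
    neighbouring special Hermite functions.\<close>
  have mono: "Q (\<lambda>q. of_real ((q \<bullet> \<eta>) ^ k) * special_hermite_lam lam \<alpha> \<beta> q)" for \<eta> k \<alpha> \<beta>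
  proof (induction k arbitrary: \<alpha> \<beta>)
    case 0
    show ?case
      using orth[of \<alpha> \<beta>] integrable_mult_cnj[OF f special_hermite_lam_orthonormal(1)[OF lam, of \<alpha> \<beta>]]
      by (simp add: Q_def l2_inner_def)
  next
    case (Suc k)
    let ?S = "\<lambda>\<alpha> \<beta> q. of_real ((q \<bullet> \<eta>) ^ k) * special_hermite_lam lam \<alpha> \<beta> q"
    have comb: "Q (\<lambda>q. of_real ((q \<bullet> \<eta>) ^ k) * (of_real (c q) * special_hermite_lam lam \<alpha> \<beta> q))"
      if "\<exists>c1 c2 c3 c4. \<forall>q. of_real (c q) * special_hermite_lam lam \<alpha> \<beta> q
          = c1 * special_hermite_lam lam \<alpha>1 \<beta> q + c2 * special_hermite_lam lam \<alpha>2 \<beta> q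
            + c3 * special_hermite_lam lam \<alpha> \<beta>1 q + c4 * special_hermite_lam lam \<alpha> \<beta>2 q" for c \<alpha>1 \<alpha>2 \<beta>1 \<beta>2
    proof -
      obtain c1 c2 c3 c4 where e: "\<And>q. of_real (c q) * special_hermite_lam lam \<alpha> \<beta> q
          = c1 * special_hermite_lam lam \<alpha>1 \<beta> q + c2 * special_hermite_lam lam \<alpha>2 \<beta> q
            + c3 * special_hermite_lam lam \<alpha> \<beta>1 q + c4 * special_hermite_lam lam \<alpha> \<beta>2 q"
        using \<open>\<exists>c1 c2 c3 c4. _\<close> by blast
      have "Q (\<lambda>q. c1 * ?S \<alpha>1 \<beta> q + c2 * ?S \<alpha>2 \<beta> q + c3 * ?S \<alpha> \<beta>1 q + c4 * ?S \<alpha> \<beta>2 q)"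
        by (intro Qadd Qmult Suc.IH)
      then show ?thesis unfolding e by (simp add: algebra_simps)
    qed
    have x: "Q (\<lambda>q. of_real ((q \<bullet> \<eta>) ^ k) * (of_real (fst q $ j) * special_hermite_lam lam \<alpha> \<beta> q))" for j
      by (rule comb[OF special_hermite_lam_mult_coord(1)[OF lam]])
    have u: "Q (\<lambda>q. of_real ((q \<bullet> \<eta>) ^ k) * (of_real (snd q $ j) * special_hermite_lam lam \<alpha> \<beta> q))" for j
      by (rule comb[OF special_hermite_lam_mult_coord(2)[OF lam]])
    have "Q (\<lambda>q. (\<Sum>j\<in>UNIV. of_real (fst \<eta> $ j) * (of_real ((q \<bullet> \<eta>) ^ k) * (of_real (fst q $ j) * special_hermite_lam lam \<alpha> \<beta> q)))
        + (\<Sum>j\<in>UNIV. of_real (snd \<eta> $ j) * (of_real ((q \<bullet> \<eta>) ^ k) * (of_real (snd q $ j) * special_hermite_lam lam \<alpha> \<beta> q))))"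
      by (intro Qadd Qsum Qmult x u)
    moreover have "(\<Sum>j\<in>UNIV. of_real (fst \<eta> $ j) * (of_real ((q \<bullet> \<eta>) ^ k) * (of_real (fst q $ j) * special_hermite_lam lam \<alpha> \<beta> q)))
        + (\<Sum>j\<in>UNIV. of_real (snd \<eta> $ j) * (of_real ((q \<bullet> \<eta>) ^ k) * (of_real (snd q $ j) * special_hermite_lam lam \<alpha> \<beta> q)))
      = of_real ((q \<bullet> \<eta>) ^ Suc k) * special_hermite_lam lam \<alpha> \<beta> q" for q
    proof -
      have "q \<bullet> \<eta> = (\<Sum>j\<in>UNIV. fst \<eta> $ j * fst q $ j) + (\<Sum>j\<in>UNIV. snd \<eta> $ j * snd q $ j)"
        by (simp add: inner_prod_def inner_vec_def mult.commute)
      then have "complex_of_real (q \<bullet> \<eta>) = (\<Sum>j\<in>UNIV. of_real (fst \<eta> $ j) * of_real (fst q $ j)) + (\<Sum>j\<in>UNIV. of_real (snd \<eta> $ j) * of_real (snd q $ j))"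
        by simp
      then have eq: "of_real ((q \<bullet> \<eta>) ^ Suc k) * special_hermite_lam lam \<alpha> \<beta> q
        = ((\<Sum>j\<in>UNIV. of_real (fst \<eta> $ j) * of_real (fst q $ j)) + (\<Sum>j\<in>UNIV. of_real (snd \<eta> $ j) * of_real (snd q $ j)))
          * (of_real ((q \<bullet> \<eta>) ^ k) * special_hermite_lam lam \<alpha> \<beta> q)"
        by (simp only: power_Suc of_real_mult mult.assoc)
      show ?thesis unfolding eq distrib_right sum_distrib_right by (simp only: mult_ac)
    qed
    ultimately show ?case by simp
  qed
  obtain K where K: "K > 0" "\<And>q :: (real^'n) \<times> (real^'n). special_hermite_lam lam (\<lambda>_. 0) (\<lambda>_. 0) q = of_real (K * exp (- (\<gamma> * (norm q)\<^sup>2)))"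
    using special_hermite_lam_00[OF lam, where ?'n = 'n] unfolding \<gamma>_def by blast
  define G where "G q = f q * of_real (exp (- (\<gamma> * (norm q)\<^sup>2)))" for q
  have moment: "integrable lborel (\<lambda>q. G q * of_real ((q \<bullet> \<eta>) ^ k)) \<and> (\<integral>q. G q * of_real ((q \<bullet> \<eta>) ^ k) \<partial>lborel) = 0" for \<eta> k
  proof -
    have e: "f q * cnj ((1 / of_real K) * (of_real ((q \<bullet> \<eta>) ^ k) * special_hermite_lam lam (\<lambda>_. 0) (\<lambda>_. 0) q)) = G q * of_real ((q \<bullet> \<eta>) ^ k)" for q
      using K(1) unfolding K(2) G_def by simp
    have "Q (\<lambda>q. (1 / of_real K) * (of_real ((q \<bullet> \<eta>) ^ k) * special_hermite_lam lam (\<lambda>_. 0) (\<lambda>_. 0) q))"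
      by (intro Qmult mono)
    then show ?thesis unfolding Q_def e .
  qed
  have zero: "gauss_laplace \<gamma> f (0, \<eta>) = 0" for \<eta>
  proof -
    \<comment> \<open>Partial sums of the exponential series: each is a finite combination of
      vanishing moments, and all are dominated by
      \<open>cmod (G q) * exp (norm \<eta> * norm q)\<close>.\<close>
    define s where "s N q = (\<Sum>k<N. (\<i> ^ k / fact k) * (G q * of_real ((q \<bullet> \<eta>) ^ k)))" for N q
    have si: "integrable lborel (s N)" and s0: "(\<integral>q. s N q \<partial>lborel) = 0" for N
      using moment unfolding s_def[abs_def]
      by (auto intro!: Bochner_Integration.integrable_sum simp: Bochner_Integration.integral_sum)
    have s_eq: "s N q = G q * (\<Sum>k<N. (\<i> * of_real (q \<bullet> \<eta>)) ^ k /\<^sub>R fact k)" for N q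
      unfolding s_def sum_distrib_left
      by (intro sum.cong) (auto simp: power_mult_distrib scaleR_conv_of_real divide_inverse mult_ac)
    have e: "f q * exp (cinner q (0, \<eta>) - of_real (\<gamma> * (norm q)\<^sup>2)) = G q * exp (\<i> * of_real (q \<bullet> \<eta>))" for q
    proof -
      have "cinner q (0, \<eta>) - of_real (\<gamma> * (norm q)\<^sup>2) = of_real (- (\<gamma> * (norm q)\<^sup>2)) + \<i> * of_real (q \<bullet> \<eta>)"
        by (simp add: cinner_def complex_eq_iff)
      then show ?thesis unfolding G_def by (simp only: exp_add exp_of_real mult.assoc)
    qed
    have "(\<lambda>N. \<integral>q. s N q \<partial>lborel) \<longlonglongrightarrow> (\<integral>q. f q * exp (cinner q (0, \<eta>) - of_real (\<gamma> * (norm q)\<^sup>2)) \<partial>lborel)"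
    proof (rule integral_dominated_convergence[OF _ _ gauss_laplace_dominator[OF \<gamma> f, of "norm \<eta>"]])
      show "AE q in lborel. (\<lambda>N. s N q) \<longlonglongrightarrow> f q * exp (cinner q (0, \<eta>) - of_real (\<gamma> * (norm q)\<^sup>2))"
      proof (rule AE_I2)
        fix q
        show "(\<lambda>N. s N q) \<longlonglongrightarrow> f q * exp (cinner q (0, \<eta>) - of_real (\<gamma> * (norm q)\<^sup>2))"
          unfolding s_eq e using exp_converges[of "\<i> * of_real (q \<bullet> \<eta>)"]
          by (intro tendsto_mult tendsto_const) (simp add: sums_def)
      qed
      show "AE q in lborel. norm (s N q) \<le> cmod (f q) * exp (norm \<eta> * norm q - \<gamma> * (norm q)\<^sup>2)" for N
      proof (rule AE_I2)
        fix q
        define z where "z = \<i> * complex_of_real (q \<bullet> \<eta>)"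
        have z: "norm z \<le> norm \<eta> * norm q"
          using Cauchy_Schwarz_ineq2[of q \<eta>] by (simp add: z_def norm_mult mult.commute)
        have "norm (\<Sum>k<N. z ^ k /\<^sub>R fact k) \<le> (\<Sum>k<N. norm z ^ k /\<^sub>R fact k)"
          by (rule order_trans[OF norm_sum]) (simp add: norm_power)
        also have "\<dots> \<le> exp (norm z)"
          unfolding exp_def by (rule sum_le_suminf[OF sums_summable[OF exp_converges]]) auto
        also have "\<dots> \<le> exp (norm \<eta> * norm q)" using z by simp
        finally have "norm (G q) * norm (\<Sum>k<N. z ^ k /\<^sub>R fact k) \<le> norm (G q) * exp (norm \<eta> * norm q)"
          by (rule mult_left_mono) simp
        also have "\<dots> = cmod (f q) * exp (norm \<eta> * norm q - \<gamma> * (norm q)\<^sup>2)"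
          unfolding G_def norm_mult norm_of_real abs_exp_cancel mult.assoc exp_add[symmetric] by simp
        finally show "norm (s N q) \<le> cmod (f q) * exp (norm \<eta> * norm q - \<gamma> * (norm q)\<^sup>2)"
          unfolding s_eq z_def[symmetric] norm_mult .
      qed
      show "(\<lambda>q. f q * exp (cinner q (0, \<eta>) - of_real (\<gamma> * (norm q)\<^sup>2))) \<in> borel_measurable lborel"
        by measurable
      show "s N \<in> borel_measurable lborel" for N using si[of N] by auto
    qed
    then show ?thesis
      unfolding s0 gauss_laplace_def by (simp add: LIMSEQ_const_iff)
  qed
  \<comment> \<open>Plancherel at real part 0: the squared modulus of \<open>f\<close> times a
    positive weight integrates to 0.\<close>
  have "ennreal ((2 * pi) ^ DIM((real^'n) \<times> (real^'n)))
      * (\<integral>\<^sup>+q. ennreal ((cmod (f q))\<^sup>2 * exp (2 * (q \<bullet> 0 - \<gamma> * (norm q)\<^sup>2))) \<partial>lborel) = 0"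
    using gauss_laplace_plancherel[OF \<gamma> f, of 0] by (simp add: zero)
  then have "(\<integral>\<^sup>+q. ennreal ((cmod (f q))\<^sup>2 * exp (2 * (q \<bullet> 0 - \<gamma> * (norm q)\<^sup>2))) \<partial>lborel) = 0"
    by simp
  then have "AE q in lborel. ennreal ((cmod (f q))\<^sup>2 * exp (2 * (q \<bullet> 0 - \<gamma> * (norm q)\<^sup>2))) = 0"
    by (subst (asm) nn_integral_0_iff_AE) auto
  then have "AE q in lborel. (cmod (f q))\<^sup>2 = 0"
    by eventually_elim (simp add: ennreal_eq_0_iff mult_le_0_iff)
  then show ?thesis
    unfolding l2_normsq_def by (rule integral_eq_zero_AE)
qed

section \<open>The transform as a surjective linear isometry\<close>

lemma twisted_heat_linear:
  fixes f g :: "(real^'n) \<times> (real^'n) \<Rightarrow> complex"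
  assumes t: "t > 0" "lam \<noteq> 0" and f: "sq_integrable lborel f" and g: "sq_integrable lborel g"
  shows "twisted_heat lam t (\<lambda>q. f q + c * g q) p = twisted_heat lam t f p + c * twisted_heat lam t g p"
proof -
  have h: "heat_rate lam t > 0" by (rule heat_rate_pos[OF t])
  have "gauss_laplace (heat_rate lam t) (\<lambda>q. f q + c * g q) \<zeta>
      = gauss_laplace (heat_rate lam t) f \<zeta> + c * gauss_laplace (heat_rate lam t) g \<zeta>" for \<zeta>
    unfolding gauss_laplace_def distrib_right mult.assoc
    using gauss_laplace_integrable[OF h f, of \<zeta>] gauss_laplace_integrable[OF h g, of \<zeta>] by simp
  then have "twisted_heat lam t (\<lambda>q. f q + c * g q) (cplx q) = twisted_heat lam t f (cplx q) + c * twisted_heat lam t g (cplx q)" for q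
    unfolding twisted_heat_cplx by (simp add: algebra_simps)
  from this[of "uncplx p"] show ?thesis by simp
qed

lemma twisted_heat_zero: "twisted_heat lam t (\<lambda>q. 0) p = 0"
  by (simp add: twisted_heat_def case_prod_unfold)

lemma twisted_heat_sum:
  fixes f :: "'i \<Rightarrow> (real^'n) \<times> (real^'n) \<Rightarrow> complex"
  assumes t: "t > 0" "lam \<noteq> 0" and f: "\<And>k. sq_integrable lborel (f k)"
  shows "twisted_heat lam t (\<lambda>q. \<Sum>k\<in>S. c k * f k q) p = (\<Sum>k\<in>S. c k * twisted_heat lam t (f k) p)"
proof (induction S rule: infinite_finite_induct)
  case (insert x S)
  have "sq_integrable lborel (\<lambda>q. \<Sum>k\<in>S. c k * f k q)"
    by (intro sq_integrable_sum sq_integrable_cmult f)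
  from twisted_heat_linear[OF t this f[of x], of "c x" p] insert show ?case
    by (simp add: add.commute)
qed (simp_all add: twisted_heat_zero)

lemma
  fixes f :: "(real^'n) \<times> (real^'n) \<Rightarrow> complex"
  assumes t: "t > 0" "lam \<noteq> 0" and f: "sq_integrable lborel f"
  shows twisted_heat_bergman: "twisted_heat lam t f \<in> bergman_space lam t"
    and twisted_heat_sq_integrable: "sq_integrable (bergman_measure lam t) (twisted_heat lam t f)"
    and twisted_heat_normsq: "l2_normsq (bergman_measure lam t) (twisted_heat lam t f) = l2_normsq lborel f"
proof -
  have e: "entire_fun (twisted_heat lam t f)" by (rule entire_twisted_heat[OF t f])
  have m: "twisted_heat lam t f \<in> borel_measurable borel" by (rule entire_fun_measurable[OF e])
  have n: "(\<integral>\<^sup>+p. ennreal ((cmod (twisted_heat lam t f p))\<^sup>2) \<partial>bergman_measure lam t) = ennreal (l2_normsq lborel f)"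
    unfolding nn_integral_bergman_measure[OF t m] twisted_heat_isometry[OF t f] nn_integral_eq_l2_normsq[OF f] ..
  then show s: "sq_integrable (bergman_measure lam t) (twisted_heat lam t f)"
    using m by (subst sq_integrable_iff_nn_integral) simp_all
  then show "twisted_heat lam t f \<in> bergman_space lam t"
    using e by (simp add: bergman_space_iff[OF t])
  show "l2_normsq (bergman_measure lam t) (twisted_heat lam t f) = l2_normsq lborel f"
    using n unfolding nn_integral_eq_l2_normsq[OF s] by simp
qed

lemma twisted_heat_diff:
  fixes f g :: "(real^'n) \<times> (real^'n) \<Rightarrow> complex"
  assumes t: "t > 0" "lam \<noteq> 0" and f: "sq_integrable lborel f" and g: "sq_integrable lborel g"
  shows "(\<lambda>p. twisted_heat lam t f p - c * twisted_heat lam t g p) = twisted_heat lam t (\<lambda>q. f q - c * g q)"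
  using twisted_heat_linear[OF t f g, of "- c"] by (simp add: fun_eq_iff)

lemma twisted_heat_inner:
  fixes f g :: "(real^'n) \<times> (real^'n) \<Rightarrow> complex"
  assumes t: "t > 0" "lam \<noteq> 0" and f: "sq_integrable lborel f" and g: "sq_integrable lborel g"
  shows "bergman_inner lam t (twisted_heat lam t f) (twisted_heat lam t g) = l2_inner lborel f g"
proof -
  have n: "l2_normsq (bergman_measure lam t) (\<lambda>p. twisted_heat lam t f p - c * twisted_heat lam t g p) = l2_normsq lborel (\<lambda>q. f q - c * g q)" for c
    unfolding twisted_heat_diff[OF t f g]
    by (intro twisted_heat_normsq[OF t] sq_integrable_diff sq_integrable_cmult f g)
  have "4 * l2_inner (bergman_measure lam t) (twisted_heat lam t f) (twisted_heat lam t g) = 4 * l2_inner lborel f g"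
    unfolding l2_polarization[OF twisted_heat_sq_integrable[OF t f] twisted_heat_sq_integrable[OF t g]] l2_polarization[OF f g] n ..
  then show ?thesis
    using l2_inner_bergman[OF t entire_fun_measurable[OF entire_twisted_heat[OF t f]] entire_fun_measurable[OF entire_twisted_heat[OF t g]]]
    by simp
qed

text \<open>The minimizing sequence in the image is pulled back along the isometry: its preimages
  are Cauchy in the real L2 space, and the transform of their limit is entire by construction. The
  residual is a Bergman function orthogonal to the whole image.\<close>

lemma twisted_heat_surj:
  fixes F :: "(complex^'n) \<times> (complex^'n) \<Rightarrow> complex"
  assumes t: "t > 0" "lam \<noteq> 0" and F: "F \<in> bergman_space lam t"
  obtains f where "sq_integrable lborel f" "twisted_heat lam t f = F"
proof -
  let ?M = "bergman_measure lam t :: ((complex^'n) \<times> (complex^'n)) measure"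
  let ?H = "twisted_heat lam t :: ((real^'n) \<times> (real^'n) \<Rightarrow> complex) \<Rightarrow> (complex^'n) \<times> (complex^'n) \<Rightarrow> complex"
  have Fs: "sq_integrable ?M F" and Fe: "entire_fun F" using F by (auto simp: bergman_space_iff[OF t])
  define P where "P = {?H f | f. sq_integrable lborel f}"
  have P: "g \<in> P \<Longrightarrow> sq_integrable ?M g" for g
    unfolding P_def by (auto intro: twisted_heat_sq_integrable[OF t])
  have P0: "(\<lambda>x. 0) \<in> P"
    unfolding P_def using sq_integrable_zero[of lborel] twisted_heat_zero[of lam t] by (auto simp: fun_eq_iff intro!: exI[of _ "\<lambda>_. 0"])
  have Plin: "(\<lambda>x. g x + c * h x) \<in> P" if gh: "g \<in> P" "h \<in> P" for g h c
  proof -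
    obtain f1 f2 where f: "sq_integrable lborel f1" "sq_integrable lborel f2" "g = ?H f1" "h = ?H f2"
      using gh unfolding P_def by blast
    have "(\<lambda>x. g x + c * h x) = ?H (\<lambda>q. f1 q + c * f2 q)"
      unfolding f by (simp add: twisted_heat_linear[OF t f(1,2)] fun_eq_iff)
    then show ?thesis
      unfolding P_def using f by (auto intro!: exI[of _ "\<lambda>q. f1 q + c * f2 q"] sq_integrable_add sq_integrable_cmult)
  qed
  obtain g where gP: "\<And>k. g k \<in> P"
    and cau: "\<And>e. e > 0 \<Longrightarrow> \<exists>N. \<forall>k\<ge>N. \<forall>m\<ge>N. l2_normsq ?M (\<lambda>x. g k x - g m x) < e"
    and orth: "\<And>h. h \<in> P \<Longrightarrow> (\<lambda>k. l2_inner ?M (\<lambda>x. F x - g k x) h) \<longlonglongrightarrow> 0"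
    using l2_minimizing_sequence[OF P P0 Plin Fs] by blast
  have "\<forall>k. \<exists>f. sq_integrable lborel f \<and> g k = ?H f" using gP unfolding P_def by blast
  then obtain f where f: "\<And>k. sq_integrable lborel (f k)" and gf: "\<And>k. g k = ?H (f k)" by metis
  have diff: "l2_normsq ?M (\<lambda>x. ?H f1 x - ?H f2 x) = l2_normsq lborel (\<lambda>x. f1 x - f2 x)"
    if "sq_integrable lborel f1" "sq_integrable lborel f2" for f1 f2
    using twisted_heat_normsq[OF t sq_integrable_diff[OF that]] twisted_heat_diff[OF t that, of 1] by simp
  obtain f' where f': "sq_integrable lborel f'" and lim: "(\<lambda>k. l2_normsq lborel (\<lambda>x. f k x - f' x)) \<longlonglongrightarrow> 0"
    using l2_complete[of lborel f] f cau unfolding gf diff[OF f f] by blast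
  define G where "G p = F p - ?H f' p" for p
  have "holo ((F \<circ> cplx))" "holo ((?H f') \<circ> cplx)"
    using Fe entire_twisted_heat[OF t f'] by (simp_all add: entire_fun_iff_holo)
  from holo_diff[OF this] have Ge: "entire_fun G"
    by (simp add: entire_fun_iff_holo G_def[abs_def] o_def)
  have Gs: "sq_integrable ?M G"
    unfolding G_def by (intro sq_integrable_diff Fs twisted_heat_sq_integrable[OF t f'])
  have "G = (\<lambda>p. 0)"
  proof (rule bergman_orthogonal_zero[OF t])
    show "G \<in> bergman_space lam t" using Ge Gs by (simp add: bergman_space_iff[OF t])
    fix h :: "(real^'n) \<times> (real^'n) \<Rightarrow> complex" assume h: "sq_integrable lborel h"
    \<comment> \<open>The residuals of the approximants converge to \<open>G\<close>, so their
      asymptotic orthogonality becomes orthogonality of \<open>G\<close>.\<close>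
    have "l2_normsq ?M (\<lambda>x. (F x - g k x) - G x) = l2_normsq lborel (\<lambda>x. f k x - f' x)" for k
    proof -
      have "(\<lambda>x. (F x - g k x) - G x) = (\<lambda>x. ?H f' x - ?H (f k) x)" by (simp add: G_def gf fun_eq_iff)
      then show ?thesis using diff[OF f' f[of k]] by (simp add: l2_normsq_minus_commute[of lborel f'])
    qed
    then have "(\<lambda>k. l2_inner ?M (\<lambda>x. F x - g k x) (?H h)) \<longlonglongrightarrow> l2_inner ?M G (?H h)"
      using lim by (intro l2_inner_tendsto sq_integrable_diff Fs P gP Gs twisted_heat_sq_integrable[OF t h]) simp
    moreover have "(\<lambda>k. l2_inner ?M (\<lambda>x. F x - g k x) (?H h)) \<longlonglongrightarrow> 0"
      by (rule orth) (use h in \<open>auto simp: P_def\<close>)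
    ultimately have "l2_inner ?M G (?H h) = 0" by (rule LIMSEQ_unique)
    then show "bergman_inner lam t G (?H h) = 0"
      using l2_inner_bergman[OF t entire_fun_measurable[OF Ge] entire_fun_measurable[OF entire_twisted_heat[OF t h]]] by simp
  qed
  then have "?H f' = F" by (auto simp: G_def fun_eq_iff)
  with f' that show ?thesis by blast
qed

text \<open>Projection onto the span: the limiting residual is orthogonal to every special Hermite
  function, so it has norm 0 by totality, and the near-minimizers themselves approximate
  \<open>f\<close>.\<close>

lemma special_hermite_lam_dense:
  fixes f :: "(real^'n) \<times> (real^'n) \<Rightarrow> complex"
  assumes lam: "lam \<noteq> 0" and f: "sq_integrable lborel f" and e: "e > 0"
  obtains S c where "finite S" "l2_normsq lborel (\<lambda>q. f q - (\<Sum>k\<in>S. c k * special_hermite_lam lam (fst k) (snd k) q)) < e"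
proof -
  define B where "B k = special_hermite_lam lam (fst k) (snd k)" for k :: "('n \<Rightarrow> nat) \<times> ('n \<Rightarrow> nat)"
  have Bs: "sq_integrable lborel (B k)" for k
    unfolding B_def by (rule special_hermite_lam_orthonormal(1)[OF lam])
  define P where "P = {g. \<exists>S c. finite S \<and> g = (\<lambda>q. \<Sum>k\<in>S. c k * B k q)}"
  have P: "g \<in> P \<Longrightarrow> sq_integrable lborel g" for g
    unfolding P_def by (auto intro!: sq_integrable_sum sq_integrable_cmult Bs)
  have P0: "(\<lambda>x. 0) \<in> P"
    unfolding P_def by (intro CollectI exI[of _ "{}"]) auto
  have Plin: "(\<lambda>x. g x + d * h x) \<in> P" if gh: "g \<in> P" "h \<in> P" for g h d
  proof -
    obtain S a T b where g: "finite S" "g = (\<lambda>q. \<Sum>k\<in>S. a k * B k q)" and h: "finite T" "h = (\<lambda>q. \<Sum>k\<in>T. b k * B k q)"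
      using gh unfolding P_def by blast
    \<comment> \<open>Coefficients are extended by 0 so that both sums run over the union of the
      index sets.\<close>
    let ?c = "\<lambda>k. (if k \<in> S then a k else 0) + d * (if k \<in> T then b k else 0)"
    have r: "(\<Sum>k\<in>S \<union> T. (if k \<in> R then v k else 0) * B k q) = (\<Sum>k\<in>R. v k * B k q)" if "R \<subseteq> S \<union> T" for R v q
    proof -
      have "(\<Sum>k\<in>S \<union> T. (if k \<in> R then v k else 0) * B k q) = (\<Sum>k\<in>S \<union> T. if k \<in> R then v k * B k q else 0)"
        by (intro sum.cong) auto
      also have "\<dots> = (\<Sum>k\<in>(S \<union> T) \<inter> R. v k * B k q)"
        using g h by (subst sum.inter_restrict) auto
      also have "(S \<union> T) \<inter> R = R" using that by blast
      finally show ?thesis .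
    qed
    have "(\<Sum>k\<in>S \<union> T. ?c k * B k q) = g q + d * h q" for q
    proof -
      have "(\<Sum>k\<in>S \<union> T. ?c k * B k q) = (\<Sum>k\<in>S \<union> T. (if k \<in> S then a k else 0) * B k q)
          + d * (\<Sum>k\<in>S \<union> T. (if k \<in> T then b k else 0) * B k q)"
        by (simp only: distrib_right sum.distrib sum_distrib_left mult.assoc)
      then show ?thesis using r[of S a q] r[of T b q] by (simp add: g h)
    qed
    then show ?thesis
      unfolding P_def using g h by (intro CollectI exI[of _ "S \<union> T"] exI[of _ ?c]) (auto simp: fun_eq_iff)
  qed
  obtain g where gP: "\<And>k. g k \<in> P"
    and cau: "\<And>e. e > 0 \<Longrightarrow> \<exists>N. \<forall>k\<ge>N. \<forall>m\<ge>N. l2_normsq lborel (\<lambda>x. g k x - g m x) < e"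
    and orth: "\<And>h. h \<in> P \<Longrightarrow> (\<lambda>k. l2_inner lborel (\<lambda>x. f x - g k x) h) \<longlonglongrightarrow> 0"
    using l2_minimizing_sequence[OF P P0 Plin f] by blast
  obtain g' where g': "sq_integrable lborel g'" and lim: "(\<lambda>k. l2_normsq lborel (\<lambda>x. g k x - g' x)) \<longlonglongrightarrow> 0"
    using l2_complete[of lborel g] P[OF gP] cau by blast
  have fg: "sq_integrable lborel (\<lambda>x. f x - g' x)" by (rule sq_integrable_diff[OF f g'])
  have "l2_normsq lborel (\<lambda>x. f x - g' x) = 0"
  proof (rule special_hermite_lam_total[OF lam fg])
    fix \<alpha> \<beta> :: "'n \<Rightarrow> nat"
    have "(\<lambda>q. \<Sum>k\<in>{(\<alpha>, \<beta>)}. 1 * B k q) \<in> P"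
      unfolding P_def by (rule CollectI, rule exI[of _ "{(\<alpha>, \<beta>)}"], rule exI[of _ "\<lambda>_. 1"]) simp
    then have BP: "special_hermite_lam lam \<alpha> \<beta> \<in> P" by (simp add: B_def)
    have "l2_normsq lborel (\<lambda>x. (f x - g k x) - (f x - g' x)) = l2_normsq lborel (\<lambda>x. g k x - g' x)" for k
      using l2_normsq_minus_commute[of lborel g' "g k"] by simp
    then have "(\<lambda>k. l2_inner lborel (\<lambda>x. f x - g k x) (special_hermite_lam lam \<alpha> \<beta>)) \<longlonglongrightarrow> l2_inner lborel (\<lambda>x. f x - g' x) (special_hermite_lam lam \<alpha> \<beta>)"
      using lim by (intro l2_inner_tendsto sq_integrable_diff f P gP fg BP g') simp
    then show "l2_inner lborel (\<lambda>x. f x - g' x) (special_hermite_lam lam \<alpha> \<beta>) = 0"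
      using orth[OF BP] by (rule LIMSEQ_unique)
  qed
  moreover obtain k where k: "l2_normsq lborel (\<lambda>x. g k x - g' x) < e / 2"
    using LIMSEQ_D[OF lim, of "e/2"] e by auto
  moreover have "l2_normsq lborel (\<lambda>x. f x - g k x) \<le> 2 * l2_normsq lborel (\<lambda>x. f x - g' x) + 2 * l2_normsq lborel (\<lambda>x. g' x - g k x)"
    using l2_normsq_add_le[OF fg sq_integrable_diff[OF g' P[OF gP[of k]]]] by simp
  ultimately have small: "l2_normsq lborel (\<lambda>x. f x - g k x) < e"
    using l2_normsq_minus_commute[of lborel g' "g k"] by simp
  obtain S c where "finite S" "g k = (\<lambda>q. \<Sum>k\<in>S. c k * B k q)" using gP[of k] unfolding P_def by blast
  with small that show ?thesis unfolding B_def by simp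
qed

lemma L2_iff_sq_integrable: "f \<in> L2 \<longleftrightarrow> sq_integrable lborel f"
proof (cases "f \<in> borel_measurable lborel")
  case True
  then show ?thesis by (simp add: L2_def sq_integrable_iff_nn_integral[OF True])
next
  case False
  then show ?thesis unfolding L2_def sq_integrable_def by blast
qed

theorem theorem4p6:
  fixes t lam :: real
  assumes "t > 0" and "lam \<noteq> 0"
  shows "(\<forall>f \<in> (L2 :: ((real^'n) \<times> (real^'n) \<Rightarrow> complex) set).
            twisted_heat lam t f \<in> bergman_space lam t \<and>
            (\<integral>\<^sup>+ p. ennreal ((cmod (twisted_heat lam t f p))\<^sup>2 * bergman_weight lam t p) \<partial>lborel)
              = (\<integral>\<^sup>+ x. ennreal ((cmod (f x))\<^sup>2) \<partial>lborel))
       \<and> (\<forall>F \<in> (bergman_space lam t :: ((complex^'n) \<times> (complex^'n) \<Rightarrow> complex) set).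
            \<exists>f \<in> L2. twisted_heat lam t f = F)
       \<and> bergman_ONB lam t
           (\<lambda>(\<alpha>, \<beta>). twisted_heat lam t (special_hermite_lam lam \<alpha> \<beta> :: (real^'n) \<times> (real^'n) \<Rightarrow> complex))"
proof (intro conjI ballI)
  note t = assms
  fix f :: "(real^'n) \<times> (real^'n) \<Rightarrow> complex" assume "f \<in> L2"
  then have f: "sq_integrable lborel f" by (simp add: L2_iff_sq_integrable)
  show "twisted_heat lam t f \<in> bergman_space lam t" by (rule twisted_heat_bergman[OF t f])
  show "(\<integral>\<^sup>+ p. ennreal ((cmod (twisted_heat lam t f p))\<^sup>2 * bergman_weight lam t p) \<partial>lborel)
      = (\<integral>\<^sup>+ x. ennreal ((cmod (f x))\<^sup>2) \<partial>lborel)"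
    by (rule twisted_heat_isometry[OF t f])
next
  note t = assms
  fix F :: "(complex^'n) \<times> (complex^'n) \<Rightarrow> complex" assume "F \<in> bergman_space lam t"
  then show "\<exists>f\<in>L2. twisted_heat lam t f = F"
    using twisted_heat_surj[OF t] by (metis L2_iff_sq_integrable)
next
  note t = assms
  let ?\<Psi> = "\<lambda>(\<alpha>, \<beta>). twisted_heat lam t (special_hermite_lam lam \<alpha> \<beta> :: (real^'n) \<times> (real^'n) \<Rightarrow> complex)"
  note S = special_hermite_lam_orthonormal(1)[OF t(2)]
  show "bergman_ONB lam t ?\<Psi>"
    unfolding bergman_ONB_def
  proof (intro conjI allI ballI impI)
    fix k l :: "('n \<Rightarrow> nat) \<times> ('n \<Rightarrow> nat)"
    obtain \<alpha> \<beta> \<gamma> \<delta> where k: "k = (\<alpha>, \<beta>)" "l = (\<gamma>, \<delta>)" by (cases k, cases l)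
    show "?\<Psi> k \<in> bergman_space lam t"
      unfolding k prod.case by (rule twisted_heat_bergman[OF t S])
    show "bergman_inner lam t (?\<Psi> k) (?\<Psi> l) = (if k = l then 1 else 0)"
      unfolding k prod.case twisted_heat_inner[OF t S S] special_hermite_lam_orthonormal(2)[OF t(2)] by simp
  next
    fix F :: "(complex^'n) \<times> (complex^'n) \<Rightarrow> complex" and e :: real
    assume F: "F \<in> bergman_space lam t" and e: "e > 0"
    obtain f where f: "sq_integrable lborel f" and Hf: "twisted_heat lam t f = F"
      using twisted_heat_surj[OF t F] .
    \<comment> \<open>Density is measured in the square norm, the basis condition in the
      norm.\<close>
    have e2: "e\<^sup>2 > 0" using e by simp
    obtain A c where A: "finite A"
      and small: "l2_normsq lborel (\<lambda>q. f q - (\<Sum>k\<in>A. c k * special_hermite_lam lam (fst k) (snd k) q)) < e\<^sup>2"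
      by (rule special_hermite_lam_dense[OF t(2) f e2])
    define g where "g q = (\<Sum>k\<in>A. c k * special_hermite_lam lam (fst k) (snd k) q)" for q
    have g: "sq_integrable lborel g" unfolding g_def by (intro sq_integrable_sum sq_integrable_cmult S)
    have fg: "sq_integrable lborel (\<lambda>q. f q - g q)" by (rule sq_integrable_diff[OF f g])
    have "(\<Sum>k\<in>A. c k * ?\<Psi> k p) = twisted_heat lam t g p" for p
      using twisted_heat_sum[OF t S, of c fst snd A p] unfolding g_def by (simp add: case_prod_unfold)
    then have eq: "(\<lambda>p. F p - (\<Sum>k\<in>A. c k * ?\<Psi> k p)) = twisted_heat lam t (\<lambda>q. f q - g q)"
      using twisted_heat_diff[OF t f g, of 1] Hf by simp
    have "(bergman_norm lam t (\<lambda>p. F p - (\<Sum>k\<in>A. c k * ?\<Psi> k p)))\<^sup>2 = l2_normsq lborel (\<lambda>q. f q - g q)"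
      unfolding eq l2_normsq_bergman[OF t entire_fun_measurable[OF entire_twisted_heat[OF t fg]], symmetric]
      by (rule twisted_heat_normsq[OF t fg])
    also have "\<dots> < e\<^sup>2" using small by (simp add: g_def)
    finally have "bergman_norm lam t (\<lambda>p. F p - (\<Sum>k\<in>A. c k * ?\<Psi> k p)) < e"
      using e by (rule power_less_imp_less_base[OF _ less_imp_le])
    with A show "\<exists>S c. finite S \<and> bergman_norm lam t (\<lambda>p. F p - (\<Sum>k\<in>S. c k * ?\<Psi> k p)) < e"
      by blast
  qed
qed

end
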